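(* Let $k \ge 7$ be an odd integer and let $\chi$ be a nonprincipal, real, primitive, odd Dirichlet character modulo $k$. Then \begin{align*} \sum_{ j=1 }^{ k-1 } \chi(j) \sin^2 \left( \frac{ \pi j }{ k } \right) \tan \left( \frac{ \pi j }{ k } \right) &= \sqrt k \left( - \frac 1 2 + \left( 2 - 4 \, \chi(2) \right) h(-k) \right) \\ &= \begin{cases} \sqrt k \left( - \frac 1 2 + 6 h(-k) \right) & \text{ if } k \equiv 3 \bmod 8 , \\ \sqrt k \left( - \frac 1 2 - 2 h(-k) \right) & \text{ if } k \equiv 7 \bmod 8 , \end{cases} \end{align*} where $h(-k)$ is the class number of the imaginary quadratic field $\mathbb{Q}(\sqrt{-k})$.
   Context: A Dirichlet character modulo $k$ is a nonzero completely multiplicative $k$-periodic function $\chi:\mathbb{Z}\to\mathbb{C}$ with $\chi(n)=0$ whenever $\gcd(n,k)>1$; it is real if it takes only real values, odd if $\chi(-n)=-\chi(n)$, and primitive if it is not induced by a character modulo a proper divisor of $k$. $h(-k)$ denotes the class number of $\mathbb{Q}(\sqrt{-k})$. *)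

theory Defs
  imports
    Complex_Main
    "HOL-Computational_Algebra.Polynomial"
    "HOL-Algebra.Ideal"
begin

section \<open>Dirichlet characters\<close>

definition dirichlet_character :: "nat \<Rightarrow> (int \<Rightarrow> complex) \<Rightarrow> bool" where
  "dirichlet_character k \<chi> \<longleftrightarrow>
     (\<exists>n. \<chi> n \<noteq> 0) \<and>
     (\<forall>m n. \<chi> (m * n) = \<chi> m * \<chi> n) \<and>
     (\<forall>n. \<chi> (n + int k) = \<chi> n) \<and>
     (\<forall>n. gcd n (int k) > 1 \<longrightarrow> \<chi> n = 0)"

definition principal_character :: "nat \<Rightarrow> (int \<Rightarrow> complex) \<Rightarrow> bool" where
  "principal_character k \<chi> \<longleftrightarrow> (\<forall>n. \<chi> n = (if coprime n (int k) then 1 else 0))"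

definition real_character :: "(int \<Rightarrow> complex) \<Rightarrow> bool" where
  "real_character \<chi> \<longleftrightarrow> (\<forall>n. \<chi> n \<in> \<real>)"

definition odd_character :: "(int \<Rightarrow> complex) \<Rightarrow> bool" where
  "odd_character \<chi> \<longleftrightarrow> (\<forall>n. \<chi> (- n) = - \<chi> n)"

definition induced_character ::
    "nat \<Rightarrow> (int \<Rightarrow> complex) \<Rightarrow> (int \<Rightarrow> complex) \<Rightarrow> bool" where
  "induced_character k \<chi> \<psi> \<longleftrightarrow>
     (\<forall>n. \<chi> n = (if coprime n (int k) then \<psi> n else 0))"

definition primitive_character :: "nat \<Rightarrow> (int \<Rightarrow> complex) \<Rightarrow> bool" where
  "primitive_character k \<chi> \<longleftrightarrow>
     dirichlet_character k \<chi> \<and>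
     \<not> (\<exists>d \<psi>. d dvd k \<and> d < k \<and> dirichlet_character d \<psi> \<and> induced_character k \<chi> \<psi>)"


section \<open>The class number of a number field\<close>

text \<open>Number fields are represented as subfields \<open>K\<close> of the complex numbers.\<close>

definition quadratic_field :: "int \<Rightarrow> complex set" where
  "quadratic_field d = {of_rat a + of_rat b * csqrt (of_int d) | a b. True}"

definition ring_of_integers :: "complex set \<Rightarrow> complex ring" where
  "ring_of_integers K =
     \<lparr>carrier = {x \<in> K. algebraic_int x}, mult = (*), one = 1, zero = 0, add = (+)\<rparr>"

definition nonzero_ideals :: "complex set \<Rightarrow> complex set set" where
  "nonzero_ideals K = {I. ideal I (ring_of_integers K) \<and> I \<noteq> {0}}"

text \<open>
  Two nonzero ideals lie in the same class iff \<open>\<alpha> I = \<beta> J\<close> for some nonzero \<open>\<alpha>, \<beta>\<close> in the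
  ring of integers. Every class of the group of fractional ideals modulo principal ones
  contains an integral ideal, so the quotient below is the underlying set of the ideal class group.
\<close>

definition ideal_class_rel :: "complex set \<Rightarrow> (complex set \<times> complex set) set" where
  "ideal_class_rel K = {(I, J). I \<in> nonzero_ideals K \<and> J \<in> nonzero_ideals K \<and>
     (\<exists>\<alpha>\<in>carrier (ring_of_integers K) - {0}. \<exists>\<beta>\<in>carrier (ring_of_integers K) - {0}.
        (\<lambda>x. \<alpha> * x) ` I = (\<lambda>x. \<beta> * x) ` J)}"

definition class_number :: "complex set \<Rightarrow> nat" where
  "class_number K = card (nonzero_ideals K // ideal_class_rel K)"

text \<open>The class number \<open>h(-k)\<close> of \<open>\<rat>(\<surd>(-k))\<close>.\<close>

definition h_neg :: "nat \<Rightarrow> nat" where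
  "h_neg k = class_number (quadratic_field (- int k))"

lemma equiv_ideal_class_rel: "equiv (nonzero_ideals K) (ideal_class_rel K)"
proof (rule equivI)
  show "ideal_class_rel K \<subseteq> nonzero_ideals K \<times> nonzero_ideals K"
    by (auto simp: ideal_class_rel_def)
  show "refl_on (nonzero_ideals K) (ideal_class_rel K)"
  proof (rule refl_onI)
    fix I assume I: "I \<in> nonzero_ideals K"
    then interpret ideal I "ring_of_integers K" by (simp add: nonzero_ideals_def)
    have "1 \<in> carrier (ring_of_integers K) - {0}"
      using one_closed by (simp add: ring_of_integers_def)
    with I show "(I, I) \<in> ideal_class_rel K" unfolding ideal_class_rel_def by blast
  qed
  show "sym (ideal_class_rel K)"
  proof (rule symI)
    fix I J assume "(I, J) \<in> ideal_class_rel K"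
    then show "(J, I) \<in> ideal_class_rel K"
      unfolding ideal_class_rel_def mem_Collect_eq case_prod_conv by metis
  qed
  show "trans (ideal_class_rel K)"
  proof (rule transI)
    fix I J L assume IJ: "(I, J) \<in> ideal_class_rel K" and JL: "(J, L) \<in> ideal_class_rel K"
    from IJ interpret ideal I "ring_of_integers K"
      by (simp add: ideal_class_rel_def nonzero_ideals_def)
    let ?O = "carrier (ring_of_integers K) - {0}"
    have m: "x * y \<in> ?O" if "x \<in> ?O" "y \<in> ?O" for x y
      using m_closed[of x y] that by (simp add: ring_of_integers_def)
    from IJ obtain a b where ab: "a \<in> ?O" "b \<in> ?O" "(\<lambda>x. a * x) ` I = (\<lambda>x. b * x) ` J"
      by (auto simp: ideal_class_rel_def)
    from JL obtain c d where cd: "c \<in> ?O" "d \<in> ?O" "(\<lambda>x. c * x) ` J = (\<lambda>x. d * x) ` L"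
      by (auto simp: ideal_class_rel_def)
    have "(\<lambda>x. (a * c) * x) ` I = (\<lambda>x. c * x) ` ((\<lambda>x. a * x) ` I)"
      by (simp add: image_image mult_ac)
    also have "\<dots> = (\<lambda>x. c * x) ` ((\<lambda>x. b * x) ` J)"
      by (simp only: ab(3))
    also have "\<dots> = (\<lambda>x. b * x) ` ((\<lambda>x. c * x) ` J)"
      by (simp add: image_image mult_ac)
    also have "\<dots> = (\<lambda>x. b * x) ` ((\<lambda>x. d * x) ` L)"
      by (simp only: cd(3))
    also have "\<dots> = (\<lambda>x. (b * d) * x) ` L"
      by (simp add: image_image mult_ac)
    finally have "(\<lambda>x. (a * c) * x) ` I = (\<lambda>x. (b * d) * x) ` L" .
    moreover have "a * c \<in> ?O" "b * d \<in> ?O"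
      using m ab(1,2) cd(1,2) by blast+
    moreover have "I \<in> nonzero_ideals K" "L \<in> nonzero_ideals K"
      using IJ JL by (simp_all add: ideal_class_rel_def)
    ultimately show "(I, L) \<in> ideal_class_rel K"
      unfolding ideal_class_rel_def by blast
  qed
qed

end

theory Submission
  imports Defs
    "HOL-Probability.Distributions"
    "HOL-Number_Theory.Number_Theory"
    "HOL-Real_Asymp.Real_Asymp"
begin

text \<open>
  Since \<open>sin\<^sup>2 x tan x = tan x - sin (2 x) / 2\<close> and \<open>tan x = cot x - 2 cot (2 x)\<close>, the sum equals
  \<open>(1 - 2 \<chi>(2)) C - g / 2\<close>, where \<open>C = \<Sum> \<chi>(j) cot (\<pi> j / k)\<close> and the Gauss sum of \<open>\<chi>\<close> is
  \<open>i g\<close>. Both \<open>g = \<surd>k\<close> and \<open>C = 2 \<surd>k h(-k)\<close> come from expanding \<open>\<Sum>\<^sub>I exp (- \<epsilon> N(I))\<close>, the sum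
  over all nonzero ideals of the ring of integers of \<open>\<rat>(\<surd>(-k))\<close>, in two ways as \<open>\<epsilon>\<close> tends to \<open>0\<close>.

  Each ideal class contributes half of a binary theta series minus its constant term, which is
  \<open>\<pi> / (\<surd>k \<epsilon>) - 1/2 + o(1)\<close>; this also shows that there are only finitely many classes. On the
  other hand the number of ideals of norm \<open>n\<close> is \<open>\<Sum> \<chi>(d)\<close> over the divisors \<open>d\<close> of \<open>n\<close>, so the series is
  \<open>\<Sum>\<^sub>m \<Sum>\<^sub>d \<chi>(d) exp (- \<epsilon> d m)\<close>; Fourier expansion of \<open>\<chi>\<close> turns it into a combination of the sums
  \<open>\<Sum>\<^sub>m sin \<theta> / (cosh (\<epsilon> m) - cos \<theta>)\<close>, to which the trapezoidal rule applies. Comparing the coefficients of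
  \<open>1/\<epsilon>\<close> gives \<open>h(-k)\<close> in terms of \<open>\<Sum> j \<chi>(j)\<close>, comparing the constant terms gives it in terms
  of \<open>C\<close>. Since \<open>h(-k) > 0\<close>, the two together force the sign of the Gauss sum.
\<close>

text \<open>The hypotheses describe an abstract character, so its link with Q(sqrt(-k)) has to be
  earned. Squarefreeness of k comes straight from primitivity. An Euler criterion extracted from the
  Gauss sum identifies \<chi>(p) with the Legendre symbol of -k at odd primes p; it yields k = 3
  modulo 4, the value \<chi>(2), and the number of ideals of each norm. The square of the Gauss sum
  is elementary, its sign is not, so g is carried as an unknown with g^2 = k. With M the sum of j
  \<chi>(j), the coefficient of 1/\<epsilon> gives h(-k) = -M / (g sqrt k), which is odd in g. The
  constant term gives C / (2 g), and k C = -2 g M turns this into -M / k, which is free of g.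
  Comparison leaves g = sqrt k. Damping by exp (- \<epsilon> N) keeps every series absolutely
  convergent, so no analytic continuation is involved and errors o(1) suffice. With k >= 7 the only
  units are 1 and -1, hence the factor one half.\<close>

no_notation vec_lambda (binder "\<chi>" 10)
hide_const (open) up_ring.monom up_ring.coeff


section \<open>Gaussian sums over the integers\<close>

text \<open>An error function. The antiderivative vanishing at 0 is odd, so the Gaussian integral
  over the half-line fixes both limits.\<close>

lemma gauss_primitive:
  obtains E :: "real \<Rightarrow> real" where
    "\<And>y. (E has_real_derivative exp (- y\<^sup>2)) (at y)"
    "(E \<longlongrightarrow> sqrt pi / 2) at_top" "(E \<longlongrightarrow> - sqrt pi / 2) at_bot"
proof -
  have "\<exists>F. \<forall>x::real. -\<infinity> < ereal x \<longrightarrow> ereal x < \<infinity> \<longrightarrow> (F has_vector_derivative exp (- x\<^sup>2)) (at x)"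
    by (rule einterval_antiderivative) (auto intro!: continuous_intros)
  then obtain F where F: "\<And>x::real. (F has_real_derivative exp (- x\<^sup>2)) (at x)"
    by (auto simp: has_real_derivative_iff_has_vector_derivative)
  define E where "E x = F x - F 0" for x
  have E: "(E has_real_derivative exp (- x\<^sup>2)) (at x)" for x
    unfolding E_def using F[of x] by (auto intro!: derivative_eq_intros)
  let ?g = "\<lambda>x::real. indicat_real {0..} x *\<^sub>R exp (- x\<^sup>2)"
  have int: "integrable lborel ?g" "integral\<^sup>L lborel ?g = sqrt pi / 2"
    using gaussian_moment_0 by (auto simp: has_bochner_integral_iff)
  have "((\<lambda>y. LINT x|lborel. indicat_real {..y} x *\<^sub>R ?g x) \<longlongrightarrow> integral\<^sup>L lborel ?g) at_top"
    by (rule tendsto_integral_at_top) (use int in auto)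
  moreover have "\<forall>\<^sub>F y in at_top. (LINT x|lborel. indicat_real {..y} x *\<^sub>R ?g x) = E y"
  proof (rule eventually_mono[OF eventually_ge_at_top[of 0]])
    fix y :: real assume y: "0 \<le> y"
    have "(LINT x|lborel. exp (- x\<^sup>2) * indicat_real {0..y} x) = E y - E 0"
      by (rule integral_FTC_Icc_real) (use y E in \<open>auto intro!: continuous_intros\<close>)
    moreover have "(\<lambda>x. indicat_real {..y} x *\<^sub>R ?g x) = (\<lambda>x. exp (- x\<^sup>2) * indicat_real {0..y} x)"
      by (auto simp: indicator_def)
    ultimately show "(LINT x|lborel. indicat_real {..y} x *\<^sub>R ?g x) = E y"
      by (simp add: E_def)
  qed
  ultimately have lim: "(E \<longlongrightarrow> sqrt pi / 2) at_top"
    unfolding int(2) by (rule Lim_transform_eventually)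
  have "((\<lambda>x. E x + E (- x)) has_real_derivative 0) (at x)" for x
  proof -
    have "((\<lambda>x. E (- x)) has_real_derivative exp (- (- x)\<^sup>2) * (- 1)) (at x)"
      by (rule DERIV_chain2[OF E]) (auto intro!: derivative_eq_intros)
    from DERIV_add[OF E this] show ?thesis by simp
  qed
  then have "E x + E (- x) = E 0 + E (- 0)" for x
    using DERIV_isconst_all by blast
  then have "E x + E (- x) = 0" for x by (simp add: E_def)
  then have odd: "E (- x) = - E x" for x by (simp add: eq_neg_iff_add_eq_0 add.commute)
  have "((\<lambda>x. - E x) \<longlongrightarrow> - sqrt pi / 2) at_top"
    using tendsto_minus[OF lim] by simp
  then have "(E \<longlongrightarrow> - sqrt pi / 2) at_bot"
    unfolding at_bot_mirror filterlim_filtermap using odd by simp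
  with E lim that show thesis by blast
qed

text \<open>The third derivative is needed: the error \<open>O(c)\<close> in the Gaussian sum below is summed over about
  \<open>c\<^bsup>-1/2\<^esup>\<close> rows of a binary form and must still tend to \<open>0\<close>.\<close>

lemma euler_maclaurin_unit_interval:
  fixes F f f1 f2 f3 G :: "real \<Rightarrow> real"
  assumes F: "\<And>t. (F has_real_derivative f t) (at t)"
    and f: "\<And>t. (f has_real_derivative f1 t) (at t)"
    and f1: "\<And>t. (f1 has_real_derivative f2 t) (at t)"
    and f2: "\<And>t. (f2 has_real_derivative f3 t) (at t)"
    and G: "\<And>t. (G has_real_derivative g t) (at t)"
    and bound: "\<And>t. \<bar>f3 t\<bar> \<le> g t"
  shows "\<bar>(f x + f (x + 1)) / 2 - (f1 (x + 1) - f1 x) / 12 - (F (x + 1) - F x)\<bar> \<le> G (x + 1) - G x"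
proof -
  \<comment> \<open>\<open>b\<close> is B_3(t)/6 for the Bernoulli polynomial B_3. Its derivatives
    B_2(t)/2 and B_1(t) are the other weights in \<open>P\<close>, so that all terms of the
    derivative of \<open>P\<close> cancel except \<open>f3 (x + t) * b t\<close>.\<close>
  define b where "b t = t ^ 3 / 6 - t ^ 2 / 4 + t / 12" for t :: real
  define P where "P t = f2 (x + t) * b t - f1 (x + t) * (t ^ 2 / 2 - t / 2 + 1 / 12)
      + f (x + t) * (t - 1 / 2) - F (x + t)" for t
  have shift: "((\<lambda>t. u (x + t)) has_real_derivative u' (x + t)) (at t)"
    if "\<And>t. (u has_real_derivative u' t) (at t)" for u u' :: "real \<Rightarrow> real" and t
    by (rule DERIV_chain2[OF that, of "\<lambda>t. x + t" 1 t UNIV, simplified]) (auto intro!: derivative_eq_intros)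
  have b': "(b has_real_derivative (t ^ 2 / 2 - t / 2 + 1 / 12)) (at t)" for t
    unfolding b_def by (auto intro!: derivative_eq_intros simp: field_simps power2_eq_square)
  have b2': "((\<lambda>t. t ^ 2 / 2 - t / 2 + 1 / 12) has_real_derivative (t - 1 / 2)) (at t)" for t :: real
    by (auto intro!: derivative_eq_intros simp: field_simps)
  have b1': "((\<lambda>t. t - 1 / 2) has_real_derivative 1) (at t)" for t :: real
    by (auto intro!: derivative_eq_intros)
  have P: "(P has_real_derivative f3 (x + t) * b t) (at t)" for t
    unfolding P_def
    by (rule DERIV_cong[OF DERIV_diff[OF DERIV_add[OF DERIV_diff[OF DERIV_mult[OF shift[OF f2] b']
          DERIV_mult[OF shift[OF f1] b2']] DERIV_mult[OF shift[OF f] b1']] shift[OF F]]])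
      (simp add: algebra_simps)
  have bb: "\<bar>b t\<bar> \<le> 1" if "0 \<le> t" "t \<le> 1" for t
  proof -
    have "t ^ 3 \<le> 1" "t ^ 2 \<le> 1" "0 \<le> t ^ 3" "0 \<le> t ^ 2"
      using that by (auto simp: power_le_one)
    then show ?thesis using that unfolding b_def abs_le_iff by (intro conjI; linarith)
  qed
  have fb: "\<bar>f3 (x + t) * b t\<bar> \<le> g (x + t)" if "0 \<le> t" "t \<le> 1" for t
    using mult_mono[OF bound[of "x + t"] bb[OF that]] order_trans[OF abs_ge_zero bound[of "x + t"]]
    by (simp add: abs_mult)
  \<comment> \<open>Monotonicity of \<open>G - P\<close> and \<open>G + P\<close> on the unit
    interval replaces integrating the bound on \<open>f3\<close>.\<close>
  have "G (x + 0) - P 0 \<le> G (x + 1) - P 1"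
  proof (rule DERIV_nonneg_imp_nondecreasing[of 0 1 "\<lambda>t. G (x + t) - P t"])
    fix t :: real assume t: "0 \<le> t" "t \<le> 1"
    show "\<exists>y. ((\<lambda>t. G (x + t) - P t) has_real_derivative y) (at t) \<and> 0 \<le> y"
      using DERIV_diff[OF shift[OF G, of t] P[of t]] fb[OF t] by (auto simp: abs_le_iff)
  qed simp
  moreover have "G (x + 0) + P 0 \<le> G (x + 1) + P 1"
  proof (rule DERIV_nonneg_imp_nondecreasing[of 0 1 "\<lambda>t. G (x + t) + P t"])
    fix t :: real assume t: "0 \<le> t" "t \<le> 1"
    show "\<exists>y. ((\<lambda>t. G (x + t) + P t) has_real_derivative y) (at t) \<and> 0 \<le> y"
    proof (intro exI conjI)
      show "((\<lambda>t. G (x + t) + P t) has_real_derivative g (x + t) + f3 (x + t) * b t) (at t)"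
        by (rule DERIV_add[OF shift[OF G] P])
      show "0 \<le> g (x + t) + f3 (x + t) * b t"
        using fb[OF t] by (simp add: abs_le_iff)
    qed
  qed simp
  moreover have "P 1 - P 0 = (f x + f (x + 1)) / 2 - (f1 (x + 1) - f1 x) / 12 - (F (x + 1) - F x)"
    by (simp add: P_def b_def field_simps)
  ultimately show ?thesis by (auto simp: abs_le_iff)
qed

text \<open>Nonnegativity makes the symmetric partial sums increase and dominate every finite sum,
  so their limit is the unordered sum. The half-open windows suit the telescoping of f(n + 1) -
  f(n).\<close>

lemma has_sum_int_symmetric:
  fixes f :: "int \<Rightarrow> real"
  assumes nonneg: "\<And>n. 0 \<le> f n"
    and lim: "(\<lambda>N. \<Sum>n\<in>{- int N..<int N}. f n) \<longlonglongrightarrow> S"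
  shows "(f has_sum S) UNIV"
proof -
  have inc: "incseq (\<lambda>N. \<Sum>n\<in>{- int N..<int N}. f n)"
    by (intro monoI sum_mono2) (auto simp: nonneg)
  have sub: "\<exists>N. F \<subseteq> {- int N..<int N}" if "finite F" for F
  proof -
    have "bdd_above (abs ` F)" using that by (intro bdd_above_finite finite_imageI)
    then obtain M where M: "\<bar>x\<bar> \<le> M" if "x \<in> F" for x
      unfolding bdd_above_def by blast
    have "F \<subseteq> {- int (nat M + 1)..<int (nat M + 1)}"
      using M by fastforce
    then show ?thesis by blast
  qed
  have le: "sum f F \<le> S" if fin: "finite F" for F
  proof -
    obtain N where "F \<subseteq> {- int N..<int N}" using sub[OF fin] by blast
    then have "sum f F \<le> (\<Sum>n\<in>{- int N..<int N}. f n)"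
      by (intro sum_mono2) (auto simp: nonneg)
    also have "\<dots> \<le> S" by (rule incseq_le[OF inc lim])
    finally show ?thesis .
  qed
  have summ: "f summable_on UNIV"
    by (rule nonneg_bdd_above_summable_on) (auto simp: nonneg intro!: bdd_aboveI2 le)
  then have hs: "(f has_sum infsum f UNIV) UNIV" by simp
  have "infsum f UNIV \<le> S"
    by (rule has_sum_le_finite_sums[OF hs]) (use le in auto)
  moreover have "S \<le> infsum f UNIV"
    by (rule LIMSEQ_le_const2[OF lim]) (auto intro!: exI[of _ 0] finite_sum_le_has_sum[OF hs] simp: nonneg)
  ultimately show ?thesis using hs by simp
qed

lemma sum_int_telescope:
  fixes f :: "int \<Rightarrow> 'a::ab_group_add"
  shows "(\<Sum>n\<in>{- int N..<int N}. f (n + 1) - f n) = f (int N) - f (- int N)"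
proof (induction N)
  case (Suc N)
  have "{- int (Suc N)..<int (Suc N)} = insert (- int (Suc N)) (insert (int N) {- int N..<int N})"
    by auto
  then show ?case using Suc by (simp add: algebra_simps)
qed simp

text \<open>Poisson summation would give an exponentially small error; Euler-Maclaurin with three
  derivatives gives a linear one, which is enough. What matters is uniformity in the shift
  \<open>a\<close>, since it varies from row to row of a binary form.\<close>

theorem gaussian_int_sum:
  fixes c a :: real
  assumes c: "c > 0"
  shows "(\<lambda>n::int. exp (- c * (of_int n + a)\<^sup>2)) summable_on UNIV"
    and "\<bar>(\<Sum>\<^sub>\<infinity>n::int. exp (- c * (of_int n + a)\<^sup>2)) - sqrt (pi / c)\<bar> \<le> 180 * sqrt 2 * sqrt pi * c"
proof -
  obtain E where E: "\<And>y. (E has_real_derivative exp (- y\<^sup>2)) (at y)"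
    and Et: "(E \<longlongrightarrow> sqrt pi / 2) at_top" and Eb: "(E \<longlongrightarrow> - sqrt pi / 2) at_bot"
    using gauss_primitive by blast
  define f where "f x = exp (- c * (x + a)\<^sup>2)" for x
  define f1 where "f1 x = - 2 * c * (x + a) * f x" for x
  define f2 where "f2 x = (4 * c\<^sup>2 * (x + a)\<^sup>2 - 2 * c) * f x" for x
  define f3 where "f3 x = (12 * c\<^sup>2 * (x + a) - 8 * c ^ 3 * (x + a) ^ 3) * f x" for x
  define F where "F x = E (sqrt c * (x + a)) / sqrt c" for x
  \<comment> \<open>\<open>g\<close> is a Gaussian of half the rate that dominates the third
    derivative. Its total integral \<open>K * sqrt (2 * pi / c)\<close> is the error constant in the
    claim.\<close>
  define K where "K = 180 * (c * sqrt c)"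
  define G where "G x = K * (E (sqrt (c / 2) * (x + a)) / sqrt (c / 2))" for x
  define g where "g x = K * exp (- (c / 2) * (x + a)\<^sup>2)" for x
  have DF: "((\<lambda>x. E (sqrt d * (x + a)) / sqrt d) has_real_derivative exp (- d * (x + a)\<^sup>2)) (at x)"
    if d: "d > 0" for d x
  proof -
    have "((\<lambda>x. E (sqrt d * (x + a))) has_real_derivative exp (- (sqrt d * (x + a))\<^sup>2) * sqrt d) (at x)"
      by (rule DERIV_chain2[OF E]) (auto intro!: derivative_eq_intros)
    from DERIV_cdivide[OF this, of "sqrt d"] show ?thesis
      using d by (simp add: power_mult_distrib)
  qed
  have D0: "(F has_real_derivative f x) (at x)" for x
    unfolding F_def f_def using DF[OF c] .
  have D1: "(f has_real_derivative f1 x) (at x)" for x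
    unfolding f_def f1_def by (auto intro!: derivative_eq_intros)
  have D2: "(f1 has_real_derivative f2 x) (at x)" for x
    unfolding f1_def f2_def
    by (rule derivative_eq_intros D1 refl)+ (simp add: f1_def algebra_simps power2_eq_square)
  have D3: "(f2 has_real_derivative f3 x) (at x)" for x
    unfolding f2_def f3_def
    by (rule derivative_eq_intros D1 refl)+ (simp add: f1_def algebra_simps power2_eq_square power3_eq_cube)
  have DG: "(G has_real_derivative g x) (at x)" for x
    unfolding G_def g_def by (rule DERIV_cmult) (rule DF, use c in simp)
  have bound: "\<bar>f3 x\<bar> \<le> g x" for x
  proof -
    define u where "u = sqrt c * (x + a)"
    have u2: "u\<^sup>2 = c * (x + a)\<^sup>2" using c by (simp add: u_def power_mult_distrib)
    obtain s where s: "sqrt c = s" "c = s * s"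
      by (rule that[of "sqrt c"]) (use c in simp_all)
    have eq: "12 * c\<^sup>2 * (x + a) - 8 * c ^ 3 * (x + a) ^ 3 = c * sqrt c * (12 * u - 8 * u ^ 3)"
      unfolding u_def s(1) unfolding s(2)
      by (simp add: power_mult_distrib right_diff_distrib power2_eq_square power3_eq_cube)
    have "1 + u\<^sup>2 / 2 + (u\<^sup>2 / 2)\<^sup>2 / 2 \<le> exp (u\<^sup>2 / 2)"
      by (rule exp_lower_Taylor_quadratic) simp
    then have ex: "1 + u\<^sup>2 / 2 + u ^ 4 / 8 \<le> exp (u\<^sup>2 / 2)"
      by (simp add: power_divide)
    have u1: "\<bar>u\<bar> \<le> 1 + u ^ 2"
      using zero_le_power2[of "\<bar>u\<bar> - 1"] by (simp add: power2_eq_square algebra_simps)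
    have "\<bar>u ^ 3\<bar> \<le> u ^ 2 + u ^ 4"
    proof -
      have "\<bar>u ^ 3\<bar> = u\<^sup>2 * \<bar>u\<bar>" by (simp add: power3_eq_cube power2_eq_square abs_mult)
      also have "\<dots> \<le> u\<^sup>2 * (1 + u\<^sup>2)" using u1 by (intro mult_left_mono) auto
      finally show ?thesis by (simp add: algebra_simps power_numeral_reduce)
    qed
    \<comment> \<open>By the two bounds above the left side is at most 12 + 20 u^2 + 8 u^4.
      Comparing coefficients, a factor 64 would already do; 180 is a generous choice.\<close>
    with u1 have "\<bar>12 * u - 8 * u ^ 3\<bar> \<le> 180 * (1 + u\<^sup>2 / 2 + u ^ 4 / 8)"
      using zero_le_power2[of u] zero_le_power2[of "u\<^sup>2"] by (simp add: abs_le_iff)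
    also have "\<dots> \<le> 180 * exp (u\<^sup>2 / 2)" using ex by simp
    finally have le: "\<bar>12 * u - 8 * u ^ 3\<bar> \<le> 180 * exp (u\<^sup>2 / 2)" .
    have "\<bar>f3 x\<bar> = c * sqrt c * \<bar>12 * u - 8 * u ^ 3\<bar> * exp (- u\<^sup>2)"
      using c unfolding f3_def eq f_def by (simp add: abs_mult u2)
    also have "\<dots> \<le> c * sqrt c * (180 * exp (u\<^sup>2 / 2)) * exp (- u\<^sup>2)"
      using c le by (intro mult_right_mono mult_left_mono) auto
    also have "\<dots> = 180 * (c * sqrt c) * exp (- (u\<^sup>2 / 2))"
      by (simp flip: exp_add)
    also have "\<dots> = g x" by (simp add: g_def K_def u2)
    finally show ?thesis .
  qed
  have EM: "\<bar>(f x + f (x + 1)) / 2 - (f1 (x + 1) - f1 x) / 12 - (F (x + 1) - F x)\<bar> \<le> G (x + 1) - G x" for x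
    by (rule euler_maclaurin_unit_interval[OF D0 D1 D2 D3 DG bound])
  define S where "S N = (\<Sum>n\<in>{- int N..<int N}. f (of_int n))" for N
  define D where "D N = S N + (f (real N) - f (- real N)) / 2 - (f1 (real N) - f1 (- real N)) / 12
      - (F (real N) - F (- real N))" for N
  have G_lim: "((\<lambda>x. G x) \<longlongrightarrow> K * ((sqrt pi / 2) / sqrt (c / 2))) at_top"
    "((\<lambda>x. G x) \<longlongrightarrow> K * ((- sqrt pi / 2) / sqrt (c / 2))) at_bot"
  proof -
    have l: "filterlim (\<lambda>x. sqrt (c / 2) * (x + a)) at_top at_top"
      "filterlim (\<lambda>x. sqrt (c / 2) * (x + a)) at_bot at_bot"
      using c by real_asymp+
    show "((\<lambda>x. G x) \<longlongrightarrow> K * ((sqrt pi / 2) / sqrt (c / 2))) at_top"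
      unfolding G_def by (intro tendsto_intros filterlim_compose[OF Et l(1)]) (use c in auto)
    show "((\<lambda>x. G x) \<longlongrightarrow> K * ((- sqrt pi / 2) / sqrt (c / 2))) at_bot"
      unfolding G_def by (intro tendsto_intros filterlim_compose[OF Eb l(2)]) (use c in auto)
  qed
  have Gmono: "mono G"
  proof (rule monoI)
    fix x y :: real assume "x \<le> y"
    have "0 \<le> g t" for t using c by (simp add: g_def K_def)
    with DG have "\<exists>y. (G has_real_derivative y) (at t) \<and> 0 \<le> y" for t by blast
    with \<open>x \<le> y\<close> show "G x \<le> G y" by (rule DERIV_nonneg_imp_nondecreasing)
  qed
  have Gle: "G x \<le> K * ((sqrt pi / 2) / sqrt (c / 2))" "K * ((- sqrt pi / 2) / sqrt (c / 2)) \<le> G x" for x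
  proof -
    show "G x \<le> K * ((sqrt pi / 2) / sqrt (c / 2))"
      by (rule tendsto_lowerbound[OF G_lim(1)])
        (auto intro!: eventually_mono[OF eventually_ge_at_top[of x]] monoD[OF Gmono])
    show "K * ((- sqrt pi / 2) / sqrt (c / 2)) \<le> G x"
      by (rule tendsto_upperbound[OF G_lim(2)])
        (auto intro!: eventually_mono[OF eventually_le_at_bot[of x]] monoD[OF Gmono])
  qed
  have Keq: "K * ((sqrt pi / 2) / sqrt (c / 2)) - K * ((- sqrt pi / 2) / sqrt (c / 2)) = 180 * sqrt 2 * sqrt pi * c"
    using c by (simp add: K_def real_sqrt_divide field_simps)
  have DN: "\<bar>D N\<bar> \<le> 180 * sqrt 2 * sqrt pi * c" for N
  proof -
    have "D N = (\<Sum>n\<in>{- int N..<int N}. (f (of_int n) + f (of_int n + 1)) / 2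
        - (f1 (of_int n + 1) - f1 (of_int n)) / 12 - (F (of_int n + 1) - F (of_int n)))"
      (is "_ = sum ?h _")
    proof -
      have "?h = (\<lambda>n. f (of_int n) + (f (of_int (n + 1)) / 2 - f1 (of_int (n + 1)) / 12 - F (of_int (n + 1))
          - (f (of_int n) / 2 - f1 (of_int n) / 12 - F (of_int n))))"
        by (auto simp: field_simps)
      then show ?thesis
        using sum_int_telescope[of "\<lambda>n. f (of_int n) / 2 - f1 (of_int n) / 12 - F (of_int n)" N]
        by (simp only: sum.distrib) (simp add: D_def S_def field_simps)
    qed
    also have "\<bar>sum ?h {- int N..<int N}\<bar> \<le> (\<Sum>n\<in>{- int N..<int N}. G (of_int n + 1) - G (of_int n))"
      by (rule order_trans[OF sum_abs sum_mono]) (rule EM)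
    also have "\<dots> = G (real N) - G (- real N)"
      using sum_int_telescope[of "\<lambda>n. G (of_int n)" N] by simp
    also have "\<dots> \<le> 180 * sqrt 2 * sqrt pi * c"
      using Gle(1)[of "real N"] Gle(2)[of "- real N"] unfolding Keq[symmetric] by linarith
    finally show ?thesis by simp
  qed
  have lims: "(\<lambda>N. (f (real N) - f (- real N)) / 2 - (f1 (real N) - f1 (- real N)) / 12
      - (F (real N) - F (- real N))) \<longlonglongrightarrow> (0 - 0) / 2 - (0 - 0) / 12 - ((sqrt pi / 2) / sqrt c - (- sqrt pi / 2) / sqrt c)"
  proof (intro tendsto_diff tendsto_divide tendsto_const)
    show "(\<lambda>N. f (real N)) \<longlonglongrightarrow> 0" "(\<lambda>N. f (- real N)) \<longlonglongrightarrow> 0"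
      "(\<lambda>N. f1 (real N)) \<longlonglongrightarrow> 0" "(\<lambda>N. f1 (- real N)) \<longlonglongrightarrow> 0"
      unfolding f_def f1_def using c by real_asymp+
    have "filterlim (\<lambda>N. sqrt c * (real N + a)) at_top sequentially"
      "filterlim (\<lambda>N. sqrt c * (- real N + a)) at_bot sequentially"
      using c by real_asymp+
    note l = this
    show "(\<lambda>N. F (real N)) \<longlonglongrightarrow> sqrt pi / 2 / sqrt c"
      unfolding F_def by (intro tendsto_intros filterlim_compose[OF Et l(1)]) (use c in auto)
    show "(\<lambda>N. F (- real N)) \<longlonglongrightarrow> - sqrt pi / 2 / sqrt c"
      unfolding F_def by (intro tendsto_intros filterlim_compose[OF Eb l(2)]) (use c in auto)
  qed (use c in auto)
  have lims': "(\<lambda>N. D N - S N) \<longlonglongrightarrow> - sqrt (pi / c)"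
    using lims c by (simp add: D_def real_sqrt_divide algebra_simps)
  obtain B where B: "\<And>N. \<bar>D N - S N\<bar> \<le> B"
    using convergent_imp_Bseq[OF convergentI[OF lims']] unfolding Bseq_def by auto
  have inc: "incseq S"
    unfolding S_def by (intro monoI sum_mono2) (auto simp: f_def)
  have "S N \<le> 180 * sqrt 2 * sqrt pi * c + B" for N
    using DN[of N] B[of N] by linarith
  then obtain L where L: "S \<longlonglongrightarrow> L" using incseq_convergent[OF inc] by metis
  have "(\<lambda>N. D N - S N + S N) \<longlonglongrightarrow> - sqrt (pi / c) + L"
    by (intro tendsto_add lims' L)
  then have DL: "D \<longlonglongrightarrow> L - sqrt (pi / c)" by simp
  have "\<bar>L - sqrt (pi / c)\<bar> \<le> 180 * sqrt 2 * sqrt pi * c"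
    by (rule tendsto_upperbound[OF tendsto_rabs[OF DL]]) (auto simp: DN)
  moreover have hs: "((\<lambda>n::int. exp (- c * (of_int n + a)\<^sup>2)) has_sum L) UNIV"
    by (rule has_sum_int_symmetric) (use L in \<open>auto simp: S_def[abs_def] f_def\<close>)
  ultimately show "\<bar>(\<Sum>\<^sub>\<infinity>n::int. exp (- c * (of_int n + a)\<^sup>2)) - sqrt (pi / c)\<bar> \<le> 180 * sqrt 2 * sqrt pi * c"
    by (simp add: infsumI)
  show "(\<lambda>n::int. exp (- c * (of_int n + a)\<^sup>2)) summable_on UNIV"
    using hs by (auto simp: summable_on_def)
qed

section \<open>Binary theta functions and the hyperbolic kernel\<close>

text \<open>Completing the square in y makes every row a shifted Gaussian sum of rate \<epsilon> c,
  weighted by a Gaussian in x of rate \<epsilon> D / (4 c). Uniformity in the shift lets the two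
  one-variable estimates be multiplied. Row errors O(\<epsilon>) meet weights of total
  O(\<epsilon>^(-1/2)), so the whole error is O(\<epsilon>^(1/2)).\<close>

theorem binary_form_theta:
  fixes a b c D :: real
  assumes c: "c > 0" and D: "D > 0" "4 * a * c - b\<^sup>2 = D"
  defines "q \<equiv> (\<lambda>(x::int, y::int). a * (of_int x)\<^sup>2 + b * of_int x * of_int y + c * (of_int y)\<^sup>2)"
  shows "\<epsilon> > 0 \<Longrightarrow> (\<lambda>z. exp (- \<epsilon> * q z)) summable_on UNIV"
    and "((\<lambda>\<epsilon>. (\<Sum>\<^sub>\<infinity>z. exp (- \<epsilon> * q z)) - 2 * pi / (\<epsilon> * sqrt D)) \<longlongrightarrow> 0) (at_right 0)"
proof -
  define K where "K = 180 * sqrt 2 * sqrt pi"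
  have K: "K \<ge> 0" by (simp add: K_def)
  define w where "w \<epsilon> x = exp (- (\<epsilon> * D / (4 * c)) * (of_int x)\<^sup>2)" for \<epsilon> and x :: int
  define s where "s \<epsilon> x y = exp (- (\<epsilon> * c) * (of_int y + b * of_int x / (2 * c))\<^sup>2)" for \<epsilon> and x y :: int
  have qe: "exp (- \<epsilon> * q (x, y)) = w \<epsilon> x * s \<epsilon> x y" for \<epsilon> x y
  proof -
    have "q (x, y) = (4 * a * c - b\<^sup>2) / (4 * c) * (of_int x)\<^sup>2 + c * (of_int y + b * of_int x / (2 * c))\<^sup>2"
      using c by (simp add: q_def field_simps power2_eq_square)
    then show ?thesis
      unfolding w_def s_def D(2) by (simp add: algebra_simps flip: exp_add)
  qed
  have ssum: "s \<epsilon> x summable_on UNIV" and sb: "\<bar>infsum (s \<epsilon> x) UNIV - sqrt (pi / (\<epsilon> * c))\<bar> \<le> K * (\<epsilon> * c)"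
    if "\<epsilon> > 0" for \<epsilon> x
    using gaussian_int_sum[of "\<epsilon> * c" "b * of_int x / (2 * c)"] that c
    unfolding s_def[abs_def] K_def by simp_all
  have wsum: "w \<epsilon> summable_on UNIV"
    and wb: "\<bar>infsum (w \<epsilon>) UNIV - sqrt (pi / (\<epsilon> * D / (4 * c)))\<bar> \<le> K * (\<epsilon> * D / (4 * c))"
    if "\<epsilon> > 0" for \<epsilon>
    using gaussian_int_sum[of "\<epsilon> * D / (4 * c)" 0] that c D(1)
    unfolding w_def[abs_def] K_def by simp_all
  have inner: "((\<lambda>y. exp (- \<epsilon> * q (x, y))) has_sum w \<epsilon> x * infsum (s \<epsilon> x) UNIV) UNIV" if "\<epsilon> > 0" for \<epsilon> x
    unfolding qe by (intro has_sum_cmult_right has_sum_infsum ssum that)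
  have snn: "0 \<le> infsum (s \<epsilon> x) UNIV" for \<epsilon> x
    by (rule infsum_nonneg) (simp add: s_def)
  have outer: "(\<lambda>x. w \<epsilon> x * infsum (s \<epsilon> x) UNIV) summable_on UNIV" if e: "\<epsilon> > 0" for \<epsilon>
  proof (rule summable_on_comparison_test[where f = "\<lambda>x. w \<epsilon> x * (sqrt (pi / (\<epsilon> * c)) + K * (\<epsilon> * c))"])
    show "(\<lambda>x. w \<epsilon> x * (sqrt (pi / (\<epsilon> * c)) + K * (\<epsilon> * c))) summable_on UNIV"
      by (intro summable_on_cmult_left wsum e)
    show "w \<epsilon> x * infsum (s \<epsilon> x) UNIV \<le> w \<epsilon> x * (sqrt (pi / (\<epsilon> * c)) + K * (\<epsilon> * c))" for x
      using sb[OF e, of x] by (intro mult_left_mono) (auto simp: w_def)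
    show "0 \<le> w \<epsilon> x * infsum (s \<epsilon> x) UNIV" for x
      by (simp add: snn w_def)
  qed
  have sig: "(\<lambda>z. exp (- \<epsilon> * q z)) summable_on (SIGMA x:UNIV. UNIV)" if e: "\<epsilon> > 0" for \<epsilon>
    by (rule summable_on_SigmaI[OF inner[OF e] outer[OF e]]) simp
  show summ: "(\<lambda>z. exp (- \<epsilon> * q z)) summable_on UNIV" if "\<epsilon> > 0" for \<epsilon>
    using sig[OF that] by simp
  have eq: "(\<Sum>\<^sub>\<infinity>z. exp (- \<epsilon> * q z)) = (\<Sum>\<^sub>\<infinity>x. w \<epsilon> x * infsum (s \<epsilon> x) UNIV)" if e: "\<epsilon> > 0" for \<epsilon>
    using has_sum_SigmaI[OF inner[OF e] has_sum_infsum[OF outer[OF e]] sig[OF e]]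
    by (simp add: infsumI)
  have bound: "\<bar>(\<Sum>\<^sub>\<infinity>z. exp (- \<epsilon> * q z)) - 2 * pi / (\<epsilon> * sqrt D)\<bar>
     \<le> K * (\<epsilon> * c) * (sqrt (pi / (\<epsilon> * D / (4 * c))) + K * (\<epsilon> * D / (4 * c)))
        + sqrt (pi / (\<epsilon> * c)) * (K * (\<epsilon> * D / (4 * c)))" if e: "\<epsilon> > 0" for \<epsilon>
  proof -
    define r where "r = sqrt (pi / (\<epsilon> * c))"
    define W where "W = infsum (w \<epsilon>) UNIV"
    define T where "T = (\<Sum>\<^sub>\<infinity>x. w \<epsilon> x * infsum (s \<epsilon> x) UNIV)"
    have W: "(w \<epsilon> has_sum W) UNIV" unfolding W_def by (rule has_sum_infsum[OF wsum[OF e]])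
    have T: "((\<lambda>x. w \<epsilon> x * infsum (s \<epsilon> x) UNIV) has_sum T) UNIV"
      unfolding T_def by (rule has_sum_infsum[OF outer[OF e]])
    have "T \<le> W * (r + K * (\<epsilon> * c))"
    proof (rule has_sum_mono[OF T has_sum_cmult_left[OF W]])
      fix x
      have "infsum (s \<epsilon> x) UNIV \<le> r + K * (\<epsilon> * c)"
        using sb[OF e, of x] unfolding r_def by linarith
      then show "w \<epsilon> x * infsum (s \<epsilon> x) UNIV \<le> w \<epsilon> x * (r + K * (\<epsilon> * c))"
        by (intro mult_left_mono) (auto simp: w_def)
    qed
    moreover have "W * (r - K * (\<epsilon> * c)) \<le> T"
    proof (rule has_sum_mono[OF has_sum_cmult_left[OF W] T])
      fix x
      have "r - K * (\<epsilon> * c) \<le> infsum (s \<epsilon> x) UNIV"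
        using sb[OF e, of x] unfolding r_def by linarith
      then show "w \<epsilon> x * (r - K * (\<epsilon> * c)) \<le> w \<epsilon> x * infsum (s \<epsilon> x) UNIV"
        by (intro mult_left_mono) (auto simp: w_def)
    qed
    ultimately have 1: "\<bar>T - W * r\<bar> \<le> K * (\<epsilon> * c) * W"
      by (simp add: abs_le_iff algebra_simps)
    have "\<bar>W * r - sqrt (pi / (\<epsilon> * D / (4 * c))) * r\<bar> \<le> K * (\<epsilon> * D / (4 * c)) * r"
      using mult_right_mono[OF wb[OF e], of r] e c
      by (simp add: W_def r_def abs_mult flip: left_diff_distrib)
    moreover have "sqrt (pi / (\<epsilon> * D / (4 * c))) * r = 2 * pi / (\<epsilon> * sqrt D)"
    proof -
      have "sqrt (pi / (\<epsilon> * D / (4 * c))) * r = sqrt ((2 * pi / \<epsilon>)\<^sup>2 / D)"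
        unfolding r_def real_sqrt_mult[symmetric] using c e D(1)
        by (intro arg_cong[where f = sqrt]) (simp add: field_simps power2_eq_square)
      also have "\<dots> = 2 * pi / (\<epsilon> * sqrt D)"
        using e by (simp add: real_sqrt_divide)
      finally show ?thesis .
    qed
    ultimately have 2: "\<bar>W * r - 2 * pi / (\<epsilon> * sqrt D)\<bar> \<le> r * (K * (\<epsilon> * D / (4 * c)))"
      by (simp add: mult.commute)
    have "W \<le> sqrt (pi / (\<epsilon> * D / (4 * c))) + K * (\<epsilon> * D / (4 * c))"
      using wb[OF e] by (simp add: W_def abs_le_iff)
    then have 3: "K * (\<epsilon> * c) * W \<le> K * (\<epsilon> * c) * (sqrt (pi / (\<epsilon> * D / (4 * c))) + K * (\<epsilon> * D / (4 * c)))"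
      using K e c by (intro mult_left_mono) auto
    show ?thesis
      unfolding eq[OF e] T_def[symmetric] r_def[symmetric] using 1 2 3 by linarith
  qed
  show "((\<lambda>\<epsilon>. (\<Sum>\<^sub>\<infinity>z. exp (- \<epsilon> * q z)) - 2 * pi / (\<epsilon> * sqrt D)) \<longlongrightarrow> 0) (at_right 0)"
  proof (rule Lim_null_comparison)
    show "\<forall>\<^sub>F \<epsilon> in at_right 0. norm ((\<Sum>\<^sub>\<infinity>z. exp (- \<epsilon> * q z)) - 2 * pi / (\<epsilon> * sqrt D))
      \<le> K * (\<epsilon> * c) * (sqrt (pi / (\<epsilon> * D / (4 * c))) + K * (\<epsilon> * D / (4 * c)))
        + sqrt (pi / (\<epsilon> * c)) * (K * (\<epsilon> * D / (4 * c)))"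
      using bound by (auto intro!: eventually_mono[OF eventually_at_right_less])
    show "((\<lambda>\<epsilon>. K * (\<epsilon> * c) * (sqrt (pi / (\<epsilon> * D / (4 * c))) + K * (\<epsilon> * D / (4 * c)))
        + sqrt (pi / (\<epsilon> * c)) * (K * (\<epsilon> * D / (4 * c)))) \<longlongrightarrow> 0) (at_right 0)"
      using c D(1) by real_asymp
  qed
qed

section \<open>The hyperbolic kernel and its Riemann sums\<close>

abbreviation kernel :: "real \<Rightarrow> real \<Rightarrow> real" where "kernel t u \<equiv> sin t / (cosh u - cos t)"

text \<open>Imaginary part of the geometric series 2 (z + z^2 + ...) at z = exp (-u) cis t;
  \<open>kernel\<close> is the conjugate Poisson kernel at radius exp (-u).\<close>

lemma sums_exp_sin:
  fixes u t :: real
  assumes u: "u > 0"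
  shows "(\<lambda>d. 2 * exp (- u * real (Suc d)) * sin (real (Suc d) * t)) sums (kernel t u)"
proof -
  define q where "q = exp (- u)"
  have q: "0 < q" "q < 1" using u by (auto simp: q_def)
  define z where "z = complex_of_real q * cis t"
  have nz: "norm z < 1" using q by (simp add: z_def norm_mult)
  have "(\<lambda>d. z * z ^ d) sums (z * (1 / (1 - z)))"
    by (intro sums_mult geometric_sums nz)
  from sums_Im[OF sums_mult[OF this, of 2]]
  have "(\<lambda>d. Im (2 * (z * z ^ d))) sums Im (2 * (z * (1 / (1 - z))))" .
  moreover have "Im (2 * (z * z ^ d)) = 2 * exp (- u * real (Suc d)) * sin (real (Suc d) * t)" for d
  proof -
    have "z * z ^ d = z ^ Suc d" by simp
    also have "z ^ Suc d = complex_of_real (q ^ Suc d) * cis (real (Suc d) * t)"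
      by (simp only: z_def power_mult_distrib Complex.DeMoivre of_real_power)
    finally have "z * z ^ d = complex_of_real (q ^ Suc d) * cis (real (Suc d) * t)" .
    moreover have "q ^ Suc d = exp (- u * real (Suc d))"
      unfolding q_def exp_of_nat_mult[symmetric] by (simp add: mult.commute)
    ultimately show ?thesis by simp
  qed
  moreover have "Im (2 * (z * (1 / (1 - z)))) = kernel t u"
  proof -
    have n: "(1 - q * cos t)\<^sup>2 + (q * sin t)\<^sup>2 = 1 - 2 * q * cos t + q\<^sup>2"
    proof -
      have "(1 - q * cos t)\<^sup>2 + (q * sin t)\<^sup>2 = 1 - 2 * q * cos t + q\<^sup>2 * ((sin t)\<^sup>2 + (cos t)\<^sup>2)"
        by (simp add: power2_eq_square algebra_simps del: sin_cos_squared_add sin_cos_squared_add2 sin_cos_squared_add3)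
      then show ?thesis by simp
    qed
    have "Im (2 * (z * (1 / (1 - z)))) = 2 * q * sin t / ((1 - q * cos t)\<^sup>2 + (q * sin t)\<^sup>2)"
      by (simp add: z_def Im_divide Re_divide field_simps power2_eq_square)
    also have "\<dots> = 2 * q * sin t / (1 - 2 * q * cos t + q\<^sup>2)" by (simp only: n)
    also have "1 - 2 * q * cos t + q\<^sup>2 = 2 * q * (cosh u - cos t)"
      using q by (simp add: cosh_def q_def exp_minus field_simps power2_eq_square)
    also have "2 * q * sin t / (2 * q * (cosh u - cos t)) = kernel t u"
      using q by simp
    finally show ?thesis .
  qed
  ultimately show ?thesis by simp
qed


text \<open>The mean value theorem, applied to the error as a function of the step, suffices; the
  sharp factor 1/12 is not sought. Bounding \<open>f2\<close> only to the right of \<open>x\<close>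
  allows an exponentially decaying \<open>M\<close> on successive intervals.\<close>

lemma trapezoid_error:
  fixes F f f1 f2 :: "real \<Rightarrow> real"
  assumes F: "\<And>t. (F has_real_derivative f t) (at t)"
    and f: "\<And>t. (f has_real_derivative f1 t) (at t)"
    and f1: "\<And>t. (f1 has_real_derivative f2 t) (at t)"
    and bound: "\<And>t. t \<ge> x \<Longrightarrow> \<bar>f2 t\<bar> \<le> M" and h: "h > 0"
  shows "\<bar>F (x + h) - F x - h * (f x + f (x + h)) / 2\<bar> \<le> h ^ 3 * M"
proof -
  have shift: "((\<lambda>t. u (x + t)) has_real_derivative u' (x + t)) (at t)"
    if "\<And>t. (u has_real_derivative u' t) (at t)" for u u' :: "real \<Rightarrow> real" and t
    by (rule DERIV_chain2[OF that, of "\<lambda>t. x + t" 1 t UNIV, simplified]) (auto intro!: derivative_eq_intros)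
  have M: "M \<ge> 0" using bound[of x] by simp
  define P where "P t = F (x + t) - F x - t * (f x + f (x + t)) / 2" for t
  have P: "(P has_real_derivative (f (x + t) - f x - t * f1 (x + t)) / 2) (at t)" for t
  proof -
    have "((\<lambda>t. F (x + t) - F x - t * (f x + f (x + t)) / 2) has_real_derivative
       f (x + t) - 0 - (1 * (f x + f (x + t)) + (0 + f1 (x + t)) * t) / 2) (at t)"
      by (intro DERIV_diff DERIV_cdivide DERIV_mult DERIV_add DERIV_ident DERIV_const shift[OF F] shift[OF f])
    then show ?thesis unfolding P_def by (rule DERIV_cong) (simp add: field_simps)
  qed
  have Pb: "\<bar>(f (x + t) - f x - t * f1 (x + t)) / 2\<bar> \<le> h ^ 2 * M" if t: "0 < t" "t < h" for t
  proof -
    obtain z where z: "x < z" "z < x + t" "f (x + t) - f x = (x + t - x) * f1 z"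
      using MVT2[of x "x + t" f f1] f t by auto
    obtain y where y: "z < y" "y < x + t" "f1 (x + t) - f1 z = (x + t - z) * f2 y"
      using MVT2[of z "x + t" f1 f2] f1 z by auto
    have "f (x + t) - f x - t * f1 (x + t) = - t * (f1 (x + t) - f1 z)"
      using z(3) by (simp add: algebra_simps)
    also have "\<bar>\<dots>\<bar> = t * ((x + t - z) * \<bar>f2 y\<bar>)"
      using t z unfolding y(3) by (simp add: abs_mult)
    also have "\<dots> \<le> h * (h * M)"
      using t z y bound[of y] M by (intro mult_mono) auto
    finally have "\<bar>f (x + t) - f x - t * f1 (x + t)\<bar> \<le> h ^ 2 * M"
      by (simp add: power2_eq_square mult.assoc)
    moreover have "0 \<le> h ^ 2 * M" using M by simp
    ultimately show ?thesis by simp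
  qed
  obtain z where z: "0 < z" "z < h" "P h - P 0 = (h - 0) * ((f (x + z) - f x - z * f1 (x + z)) / 2)"
    using MVT2[of 0 h P "\<lambda>t. (f (x + t) - f x - t * f1 (x + t)) / 2"] P h by auto
  have "P h = h * ((f (x + z) - f x - z * f1 (x + z)) / 2)"
    using z(3) by (simp add: P_def)
  then have "\<bar>P h\<bar> = h * \<bar>(f (x + z) - f x - z * f1 (x + z)) / 2\<bar>"
    using h by (simp only: abs_mult abs_of_pos)
  also have "\<dots> \<le> h * (h ^ 2 * M)"
    using Pb[OF z(1,2)] h by (intro mult_left_mono) auto
  finally show ?thesis by (simp add: P_def power_numeral_reduce mult.assoc)
qed

text \<open>With s = sin (t/2), c = cos (t/2) and S = sinh (u/2), half-argument formulas turn both
  sides into s c / (S^2 + s^2). Over the half-line the antiderivative runs from 0 to pi - t, the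
  source of the 1/h term below.\<close>

lemma tan_half_tanh_deriv:
  fixes t :: real
  assumes t: "0 < t" "t < 2 * pi"
  shows "((\<lambda>u. 2 * arctan (cot (t / 2) * tanh (u / 2))) has_real_derivative kernel t u) (at u)"
proof -
  define s c S C where "s = sin (t / 2)" and "c = cos (t / 2)" and "S = sinh (u / 2)" and "C = cosh (u / 2)"
  have s: "s > 0" unfolding s_def using t by (intro sin_gt_zero) auto
  have C: "C > 0" unfolding C_def by simp
  have sc: "c\<^sup>2 = 1 - s\<^sup>2" by (simp add: s_def c_def cos_squared_eq)
  have SC: "C\<^sup>2 = 1 + S\<^sup>2" using cosh_square_eq[of "u / 2"] by (simp add: S_def C_def)
  have sint: "sin t = 2 * s * c" and cost: "cos t = 1 - 2 * s\<^sup>2"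
    using sin_double[of "t / 2"] cos_double_sin[of "t / 2"] by (simp_all add: s_def c_def)
  have coshu: "cosh u = 2 * S\<^sup>2 + 1"
    using cosh_double[of "u / 2"] SC by (simp add: S_def C_def)
  have "((\<lambda>u. 2 * arctan (cot (t / 2) * tanh (u / 2))) has_real_derivative
      2 * (inverse (1 + (cot (t / 2) * tanh (u / 2))\<^sup>2) * (cot (t / 2) * ((1 - (tanh (u / 2))\<^sup>2) * (1 / 2))))) (at u)"
    by (auto intro!: derivative_eq_intros simp: field_simps)
  also have cts: "cot (t / 2) = c / s" by (simp add: cot_def s_def c_def)
  also have "tanh (u / 2) = S / C" by (simp add: tanh_def S_def C_def)
  also have "2 * (inverse (1 + (c / s * (S / C))\<^sup>2) * (c / s * ((1 - (S / C)\<^sup>2) * (1 / 2))))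
      = s * c * (C\<^sup>2 - S\<^sup>2) / (s\<^sup>2 * C\<^sup>2 + c\<^sup>2 * S\<^sup>2)"
  proof -
    have "s\<^sup>2 * C\<^sup>2 + c\<^sup>2 * S\<^sup>2 > 0" using s C by (intro add_pos_nonneg) auto
    moreover have "1 + (c / s * (S / C))\<^sup>2 = (s\<^sup>2 * C\<^sup>2 + c\<^sup>2 * S\<^sup>2) / (s\<^sup>2 * C\<^sup>2)"
      using s C by (simp add: field_simps)
    moreover have "1 - (S / C)\<^sup>2 = (C\<^sup>2 - S\<^sup>2) / C\<^sup>2"
      using C by (simp add: field_simps)
    moreover have "2 * (inverse (X / (s\<^sup>2 * C\<^sup>2)) * (c / s * (Y / C\<^sup>2 * (1 / 2)))) = s * c * Y / X"
      if "X > 0" for X Y :: real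
      using s C that by (simp add: field_simps power2_eq_square)
    ultimately show ?thesis by (simp only:)
  qed
  also have "s * c * (C\<^sup>2 - S\<^sup>2) = s * c" by (simp add: SC)
  also have "s\<^sup>2 * C\<^sup>2 + c\<^sup>2 * S\<^sup>2 = S\<^sup>2 + s\<^sup>2" by (simp add: SC sc algebra_simps)
  also have "s * c / (S\<^sup>2 + s\<^sup>2) = kernel t u"
  proof -
    have "cosh u - cos t = 2 * (S\<^sup>2 + s\<^sup>2)" "sin t = 2 * (s * c)"
      unfolding sint cost coshu by simp_all
    then show ?thesis by (simp only: mult_divide_mult_cancel_left_if) simp
  qed
  finally show ?thesis by (simp only: cts)
qed

text \<open>Trapezoidal rule on the half-line: the integral pi - t over h, minus half the value cot
  (t/2) at 0. The local errors h^3 M exp (- h m) add up to O(h^2), hence O(h) after division by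
  h.\<close>

theorem hyperbolic_kernel_sum:
  fixes t :: real
  assumes t: "0 < t" "t < 2 * pi"
  shows "h > 0 \<Longrightarrow> summable (\<lambda>m. kernel t (h * real (Suc m)))"
    and "((\<lambda>h. (\<Sum>m. kernel t (h * real (Suc m))) - (pi - t) / h) \<longlongrightarrow> - cot (t / 2) / 2) (at_right 0)"
proof -
  define f where "f u = kernel t u" for u
  define F where "F u = 2 * arctan (cot (t / 2) * tanh (u / 2))" for u
  define f1 where "f1 u = - (sin t * sinh u) / (cosh u - cos t)\<^sup>2" for u
  define f2 where "f2 u = sin t * (2 * (sinh u)\<^sup>2 / (cosh u - cos t) ^ 3 - cosh u / (cosh u - cos t)\<^sup>2)" for u
  have "sin (t / 2) > 0" using t by (intro sin_gt_zero) auto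
  then have ct: "cos t < 1" using cos_double_sin[of "t / 2"] by simp
  \<comment> \<open>Keeps the denominator comparable with \<open>cosh u\<close>: it is at least (1 -
    cos t) cosh u when cos t is nonnegative, and at least cosh u otherwise.\<close>
  define \<nu> where "\<nu> = min 1 (1 - cos t)"
  have \<nu>: "\<nu> > 0" "\<nu> \<le> 1" using ct by (auto simp: \<nu>_def)
  have dlow: "\<nu> * cosh u \<le> cosh u - cos t" for u
  proof -
    have 1: "cosh u \<ge> 1" by (rule cosh_real_ge_1)
    show ?thesis
    proof (cases "cos t \<ge> 0")
      case True
      then have "\<nu> = 1 - cos t" by (simp add: \<nu>_def)
      show ?thesis unfolding \<open>\<nu> = 1 - cos t\<close> using mult_left_mono[OF 1 True] by (simp add: algebra_simps)
    next
      case False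
      then have "\<nu> = 1" by (simp add: \<nu>_def)
      then show ?thesis using False by simp
    qed
  qed
  have dpos: "cosh u - cos t > 0" for u
    using dlow[of u] \<nu> cosh_real_pos[of u] by (meson less_le_trans mult_pos_pos)
  have D0: "(F has_real_derivative f u) (at u)" for u
    unfolding F_def f_def by (rule tan_half_tanh_deriv[OF t])
  have D1: "(f has_real_derivative f1 u) (at u)" for u
    unfolding f_def f1_def using dpos[of u]
    by (auto intro!: derivative_eq_intros simp: field_simps power2_eq_square)
  have D2: "(f1 has_real_derivative f2 u) (at u)" for u
  proof -
    have "((\<lambda>u. - (sin t * sinh u) / (cosh u - cos t)\<^sup>2) has_real_derivative
       (- (sin t * cosh u) * (cosh u - cos t)\<^sup>2 - - (sin t * sinh u) * (2 * (cosh u - cos t) * sinh u))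
         / ((cosh u - cos t)\<^sup>2 * (cosh u - cos t)\<^sup>2)) (at u)" (is ?deriv)
    proof (rule DERIV_divide)
      show "((\<lambda>u. - (sin t * sinh u)) has_real_derivative - (sin t * cosh u)) (at u)"
        by (auto intro!: derivative_eq_intros)
      show "((\<lambda>u. (cosh u - cos t)\<^sup>2) has_real_derivative 2 * (cosh u - cos t) * sinh u) (at u)"
        by (auto intro!: derivative_eq_intros)
    qed (use dpos[of u] in auto)
    have "(- (a * C) * d\<^sup>2 - - (a * S) * (2 * d * S)) / (d\<^sup>2 * d\<^sup>2)
        = a * (2 * S\<^sup>2 / d ^ 3 - C / d\<^sup>2)" if "d \<noteq> 0" for a C S d :: real
      using that by (simp add: field_simps power2_eq_square power3_eq_cube)
    note aux = this
    have "cosh u - cos t \<noteq> 0" using dpos[of u] by simp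
    from aux[OF this, of "sin t" "cosh u" "sinh u"]
    have "(- (sin t * cosh u) * (cosh u - cos t)\<^sup>2 - - (sin t * sinh u) * (2 * (cosh u - cos t) * sinh u))
         / ((cosh u - cos t)\<^sup>2 * (cosh u - cos t)\<^sup>2) = f2 u"
      unfolding f2_def .
    with \<open>?deriv\<close> show ?thesis unfolding f1_def by (rule DERIV_cong)
  qed
  have cosh_exp: "1 / cosh u \<le> 2 * exp (- u)" for u :: real
  proof -
    have "exp u / 2 \<le> cosh u" by (simp add: cosh_def)
    then have "1 / cosh u \<le> 1 / (exp u / 2)" by (intro divide_left_mono) auto
    then show ?thesis by (simp add: exp_minus field_simps)
  qed
  define M where "M = 6 / \<nu> ^ 3"
  have fb: "\<bar>f u\<bar> \<le> 2 / \<nu> * exp (- u)" for u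
  proof -
    have "\<bar>f u\<bar> = \<bar>sin t\<bar> / (cosh u - cos t)" using dpos[of u] by (simp add: f_def)
    also have "\<dots> \<le> 1 / (\<nu> * cosh u)"
      using dlow[of u] \<nu> cosh_real_pos[of u] by (intro frac_le) auto
    also have "\<dots> \<le> 1 / \<nu> * (2 * exp (- u))"
      using mult_left_mono[OF cosh_exp[of u], of "1 / \<nu>"] \<nu> by simp
    finally show ?thesis by simp
  qed
  have f2b: "\<bar>f2 u\<bar> \<le> M * exp (- u)" for u
  proof -
    define C d where "C = cosh u" and "d = cosh u - cos t"
    have C: "C > 0" by (simp add: C_def)
    have d: "\<nu> * C \<le> d" "0 < d" using dlow dpos by (auto simp: C_def d_def)
    have "\<bar>f2 u\<bar> \<le> 1 * \<bar>2 * (sinh u)\<^sup>2 / d ^ 3 - C / d\<^sup>2\<bar>"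
      unfolding f2_def C_def d_def abs_mult by (intro mult_right_mono) auto
    also have "\<dots> \<le> 2 * (sinh u)\<^sup>2 / d ^ 3 + C / d\<^sup>2"
      using d C abs_triangle_ineq4[of "2 * (sinh u)\<^sup>2 / d ^ 3" "C / d\<^sup>2"] by simp
    also have "\<dots> \<le> 2 * C\<^sup>2 / (\<nu> * C) ^ 3 + C / (\<nu> * C)\<^sup>2"
    proof (intro add_mono frac_le power_mono)
      show "2 * (sinh u)\<^sup>2 \<le> 2 * C\<^sup>2" by (simp add: C_def cosh_square_eq)
    qed (use C d \<nu> in auto)
    also have "\<dots> = 2 / \<nu> ^ 3 * (1 / C) + 1 / \<nu> ^ 2 * (1 / C)"
      using C by (simp add: power_mult_distrib field_simps power2_eq_square power3_eq_cube)
    also have "\<dots> \<le> 2 / \<nu> ^ 3 * (1 / C) + 1 / \<nu> ^ 3 * (1 / C)"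
      using \<nu> C by (intro add_left_mono mult_right_mono divide_left_mono power_decreasing) auto
    also have "\<dots> = 3 / \<nu> ^ 3 * (1 / C)" by (simp add: field_simps)
    also have "\<dots> \<le> 3 / \<nu> ^ 3 * (2 * exp (- u))"
      using \<nu> cosh_exp[of u] by (intro mult_left_mono) (auto simp: C_def)
    finally show ?thesis by (simp add: M_def)
  qed
  have M: "M \<ge> 0" using \<nu> by (simp add: M_def)
  have geo: "summable (\<lambda>m. exp (- h) ^ m)" and geo_sum: "(\<Sum>m. exp (- h) ^ m) = 1 / (1 - exp (- h))"
    if "h > 0" for h :: real
    using that summable_geometric[of "exp (- h)"] suminf_geometric[of "exp (- h)"] by simp_all
  have ex: "exp (- (h * real m)) = exp (- h) ^ m" for h m
    by (simp add: exp_of_nat_mult[symmetric] mult.commute)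
  have summ: "summable (\<lambda>m. f (h * real m))" if h: "h > 0" for h
  proof (rule summable_comparison_test'[of "\<lambda>m. 2 / \<nu> * exp (- h) ^ m" 0])
    show "summable (\<lambda>m. 2 / \<nu> * exp (- h) ^ m)" by (intro summable_mult geo h)
    show "norm (f (h * real m)) \<le> 2 / \<nu> * exp (- h) ^ m" for m
      using fb[of "h * real m"] by (simp only: ex real_norm_def)
  qed
  have summ': "summable (\<lambda>m. f (h * real (Suc m)))" if h: "h > 0" for h
    using summ[OF h] summable_Suc_iff[of "\<lambda>m. f (h * real m)"] by simp
  from summ' show "h > 0 \<Longrightarrow> summable (\<lambda>m. kernel t (h * real (Suc m)))"
    by (simp add: f_def)
  have f0: "f 0 = cot (t / 2)"
  proof -
    have "sin t = 2 * sin (t / 2) * cos (t / 2)" "cos t = 1 - 2 * (sin (t / 2))\<^sup>2"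
      using sin_double[of "t / 2"] cos_double_sin[of "t / 2"] by simp_all
    then show ?thesis
      using \<open>sin (t / 2) > 0\<close> by (simp add: f_def cot_def power2_eq_square)
  qed
  have Finf: "2 * arctan (cot (t / 2) * 1) = pi - t"
  proof -
    have "cot (t / 2) = tan (pi / 2 - t / 2)"
      by (simp add: cot_def tan_def sin_diff cos_diff)
    moreover have "arctan (tan (pi / 2 - t / 2)) = pi / 2 - t / 2"
      by (rule arctan_tan) (use t in auto)
    ultimately show ?thesis by simp
  qed
  have main: "\<bar>(\<Sum>m. f (h * real (Suc m))) + f 0 / 2 - (pi - t) / h\<bar> \<le> h\<^sup>2 * M / (1 - exp (- h))"
    if h: "h > 0" for h
  proof -
    define S where "S = (\<Sum>m. f (h * real (Suc m)))"
    define e where "e m = F (h * real (Suc m)) - F (h * real m) - h * (f (h * real m) + f (h * real (Suc m))) / 2" for m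
    have S: "(\<lambda>m. f (h * real (Suc m))) sums S"
      unfolding S_def by (rule summable_sums[OF summ'[OF h]])
    then have S': "(\<lambda>m. f (h * real m)) sums (S + f 0)"
      using sums_Suc_iff[of "\<lambda>m. f (h * real m)" S] by simp
    have "(\<lambda>m. F (h * real m)) \<longlonglongrightarrow> 2 * arctan (cot (t / 2) * 1)"
      unfolding F_def
    proof (intro tendsto_intros)
      show "(\<lambda>m. tanh (h * real m / 2)) \<longlonglongrightarrow> 1"
        by (rule filterlim_compose[OF tanh_real_at_top]) (use h in real_asymp)
    qed
    then have tel: "(\<lambda>m. F (h * real (Suc m)) - F (h * real m)) sums (pi - t - F 0)"
      unfolding Finf using telescope_sums[of "\<lambda>m. F (h * real m)"] by simp
    have "e sums (pi - t - F 0 - h * (S + f 0 + S) / 2)"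
      unfolding e_def by (rule sums_diff[OF tel sums_divide[OF sums_mult[OF sums_add[OF S' S]]]])
    moreover have "pi - t - F 0 - h * (S + f 0 + S) / 2 = pi - t - h * (S + f 0 / 2)"
      by (simp add: F_def field_simps)
    ultimately have es: "e sums (pi - t - h * (S + f 0 / 2))" by (simp only:)
    have eb: "\<bar>e m\<bar> \<le> h ^ 3 * M * exp (- h) ^ m" for m
    proof -
      have "\<bar>F (h * real m + h) - F (h * real m) - h * (f (h * real m) + f (h * real m + h)) / 2\<bar>
          \<le> h ^ 3 * (M * exp (- (h * real m)))"
      proof (rule trapezoid_error[OF D0 D1 D2 _ h])
        fix v assume "h * real m \<le> v"
        then have "M * exp (- v) \<le> M * exp (- (h * real m))"
          using M by (intro mult_left_mono) auto
        with f2b[of v] show "\<bar>f2 v\<bar> \<le> M * exp (- (h * real m))" by linarith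
      qed
      then show ?thesis by (simp add: e_def ex algebra_simps)
    qed
    have "norm (suminf e) \<le> (\<Sum>m. h ^ 3 * M * exp (- h) ^ m)"
      by (rule norm_suminf_le) (use eb in \<open>auto intro!: summable_mult geo h\<close>)
    also have "\<dots> = h ^ 3 * M / (1 - exp (- h))"
      using geo_sum[OF h] suminf_mult[OF geo[OF h], of "h ^ 3 * M"] by simp
    finally have "\<bar>pi - t - h * (S + f 0 / 2)\<bar> \<le> h ^ 3 * M / (1 - exp (- h))"
      using es by (simp add: sums_iff)
    then have "\<bar>pi - t - h * (S + f 0 / 2)\<bar> / h \<le> h ^ 3 * M / (1 - exp (- h)) / h"
      using h by (intro divide_right_mono) auto
    moreover have "\<bar>pi - t - h * (S + f 0 / 2)\<bar> / h = \<bar>S + f 0 / 2 - (pi - t) / h\<bar>"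
    proof -
      have "S + f 0 / 2 - (pi - t) / h = - (pi - t - h * (S + f 0 / 2)) / h"
        using h by (simp add: field_simps)
      then show ?thesis using h by (simp only: abs_divide abs_minus_cancel)
    qed
    moreover have "h ^ 3 * M / (1 - exp (- h)) / h = h\<^sup>2 * M / (1 - exp (- h))"
      using h by (simp add: power2_eq_square power3_eq_cube)
    ultimately show ?thesis unfolding S_def by simp
  qed
  have "((\<lambda>h. (\<Sum>m. f (h * real (Suc m))) + f 0 / 2 - (pi - t) / h) \<longlongrightarrow> 0) (at_right 0)"
  proof (rule Lim_null_comparison)
    show "\<forall>\<^sub>F h in at_right 0. norm ((\<Sum>m. f (h * real (Suc m))) + f 0 / 2 - (pi - t) / h)
        \<le> h\<^sup>2 * M / (1 - exp (- h))"
      using main by (auto intro!: eventually_mono[OF eventually_at_right_less])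
    show "((\<lambda>h. h\<^sup>2 * M / (1 - exp (- h))) \<longlongrightarrow> 0) (at_right 0)" by real_asymp
  qed
  from tendsto_add[OF this tendsto_const[of "- f 0 / 2"]]
  show "((\<lambda>h. (\<Sum>m. kernel t (h * real (Suc m))) - (pi - t) / h) \<longlongrightarrow> - cot (t / 2) / 2) (at_right 0)"
    unfolding f0 by (simp add: f_def algebra_simps)
qed

section \<open>Real primitive characters\<close>

text \<open>Values in {-1, 0, 1} are integers, so the character can be studied by congruences modulo
  primes. \<open>c_primitive\<close> expresses primitivity as nontriviality on the units congruent
  to 1 modulo d, the form that separability of the Gauss sum and squarefreeness of k
  require.\<close>

locale odd_real_primitive_character =
  fixes k :: nat and c :: "int \<Rightarrow> int"
  assumes k_ge: "k \<ge> 7" and k_odd: "odd k"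
    and c_mult: "c (m * n) = c m * c n"
    and c_periodic: "c (n + int k) = c n"
    and c_eq_0_iff: "c n = 0 \<longleftrightarrow> \<not> coprime n (int k)"
    and c_values: "c n = -1 \<or> c n = 0 \<or> c n = 1"
    and c_minus: "c (- n) = - c n"
    and c_primitive: "d dvd k \<Longrightarrow> d < k \<Longrightarrow> \<exists>n. [n = 1] (mod int d) \<and> c n = -1"

lemma periodic_cong:
  fixes f :: "int \<Rightarrow> 'a"
  assumes per: "\<And>n. f (n + int k) = f n" and "[m = n] (mod int k)"
  shows "f m = f n"
proof -
  have 1: "f (n + int k * int t) = f n" for n t
  proof (induction t)
    case (Suc t)
    have "n + int k * int (Suc t) = (n + int k * int t) + int k" by (simp add: algebra_simps)
    then show ?case using Suc per[of "n + int k * int t"] by (simp only:)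
  qed simp
  have 2: "f (n + int k * t) = f n" for n t
  proof (cases "t \<ge> 0")
    case True then show ?thesis using 1[of n "nat t"] by simp
  next
    case False
    then show ?thesis using 1[of "n + int k * t" "nat (- t)"] by simp
  qed
  from assms(2) obtain t where "m = n + int k * t"
    by (metis cong_iff_lin cong_sym)
  then show ?thesis using 2 by simp
qed

text \<open>Add to n the multiple d T, with T the product of the primes of k not dividing n: every
  prime of k then divides exactly one of the two summands.\<close>

lemma coprime_lift:
  fixes n d k :: int
  assumes "coprime n d" "k \<noteq> 0"
  shows "\<exists>m. [m = n] (mod d) \<and> coprime m k"
proof -
  define T where "T = \<Prod>{p \<in> prime_factors k. \<not> p dvd n}"
  have "coprime (n + d * T) k"
  proof (rule ccontr)
    assume "\<not> coprime (n + d * T) k"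
    then have "\<not> is_unit (gcd (n + d * T) k)" "gcd (n + d * T) k \<noteq> 0"
      using assms(2) by (auto simp: coprime_iff_gcd_eq_1)
    then obtain q where q: "prime q" "q dvd n + d * T" "q dvd k"
      using prime_divisor_exists[of "gcd (n + d * T) k"] by auto
    have qk: "q \<in> prime_factors k" using q assms(2) by (simp add: prime_factors_dvd)
    show False
    proof (cases "q dvd n")
      case True
      then have "q dvd d * T" using q(2) by (simp add: dvd_add_right_iff)
      then have "q dvd T" using True assms(1) q(1) by (metis coprime_common_divisor not_prime_unit prime_dvd_mult_iff)
      then obtain p where p: "p \<in> prime_factors k" "\<not> p dvd n" "q dvd p"
        unfolding T_def using prime_dvd_prod_iff[OF _ q(1), of "{p \<in> prime_factors k. \<not> p dvd n}" "\<lambda>p. p"] by auto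
      then have "q = p" using q(1) by (simp add: primes_dvd_imp_eq in_prime_factors_iff)
      then show False using p True by simp
    next
      case False
      then have "q dvd T" unfolding T_def using qk by (intro dvd_prodI) auto
      then show False using q(2) False by (simp add: dvd_add_left_iff)
    qed
  qed
  moreover have "[n + d * T = n] (mod d)" by (simp add: cong_def)
  ultimately show ?thesis by blast
qed

lemma dirichlet_character_properties:
  assumes k: "k > 0" and chi: "dirichlet_character k \<chi>"
  shows "\<chi> 1 = 1" and "\<chi> n = 0 \<longleftrightarrow> \<not> coprime n (int k)"
    and "[m = n] (mod int k) \<Longrightarrow> \<chi> m = \<chi> n" and "\<chi> (m * n) = \<chi> m * \<chi> n"
proof -
  have mult: "\<chi> (m * n) = \<chi> m * \<chi> n" for m n using chi unfolding dirichlet_character_def by blast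
  then show "\<chi> (m * n) = \<chi> m * \<chi> n" .
  obtain x where x: "\<chi> x \<noteq> 0" using chi unfolding dirichlet_character_def by blast
  then show one: "\<chi> 1 = 1" using mult[of x 1] by simp
  have "\<chi> (n + int k) = \<chi> n" for n using chi unfolding dirichlet_character_def by blast
  from periodic_cong[of \<chi>, OF this] have cong: "[m = n] (mod int k) \<Longrightarrow> \<chi> m = \<chi> n" for m n .
  then show "[m = n] (mod int k) \<Longrightarrow> \<chi> m = \<chi> n" .
  show "\<chi> n = 0 \<longleftrightarrow> \<not> coprime n (int k)"
  proof
    assume "\<chi> n = 0"
    show "\<not> coprime n (int k)"
    proof
      assume "coprime n (int k)"
      then obtain m where "[n * m = 1] (mod int k)" using cong_solve_coprime_int by blast
      from cong[OF this] have "\<chi> n * \<chi> m = 1" by (simp add: mult one)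
      with \<open>\<chi> n = 0\<close> show False by simp
    qed
  next
    assume "\<not> coprime n (int k)"
    moreover have "gcd n (int k) > 0" using k by simp
    ultimately have "gcd n (int k) > 1" unfolding coprime_iff_gcd_eq_1 by linarith
    then show "\<chi> n = 0" using chi unfolding dirichlet_character_def by blast
  qed
qed

text \<open>Otherwise \<chi> on units depends only on the residue modulo d. Evaluating it at a lift
  coprime to k then defines a character modulo d that induces \<chi>.\<close>

lemma primitive_character_nontrivial_on_kernel:
  assumes k: "k > 0" and prim: "primitive_character k \<chi>" and d: "d dvd k" "d < k"
  shows "\<exists>n. [n = 1] (mod int d) \<and> \<chi> n \<noteq> 0 \<and> \<chi> n \<noteq> 1"
proof (rule ccontr)
  assume "\<not> ?thesis"
  then have triv: "\<chi> n = 1" if "[n = 1] (mod int d)" "\<chi> n \<noteq> 0" for n using that by blast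
  have chi: "dirichlet_character k \<chi>" using prim by (simp add: primitive_character_def)
  note P = dirichlet_character_properties[OF k chi]
  have dk: "int d dvd int k" using d by simp
  have well: "\<chi> m = \<chi> m'" if m: "coprime m (int k)" "coprime m' (int k)" "[m = m'] (mod int d)" for m m'
  proof -
    obtain v where v: "[m * v = 1] (mod int k)" using cong_solve_coprime_int m(1) by blast
    have "coprime v (int k)" using v by (metis cong_imp_coprime cong_sym coprime_1_left coprime_mult_left_iff)
    then have nz: "\<chi> (m' * v) \<noteq> 0" using m P(2) by (simp add: P(4))
    have "[m' * v = m * v] (mod int d)" using m(3) cong_scalar_right cong_sym by blast
    moreover have "[m * v = 1] (mod int d)" using v dk cong_dvd_modulus by blast
    ultimately have "\<chi> (m' * v) = 1" using triv nz cong_trans by blast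
    moreover have "\<chi> (m * v) = 1" using P(3)[OF v] P(1) by simp
    ultimately have "\<chi> m' * \<chi> v = \<chi> m * \<chi> v" by (simp add: P(4))
    then show ?thesis using nz by (simp add: P(4))
  qed
  define rep where "rep n = (SOME m. [m = n] (mod int d) \<and> coprime m (int k))" for n
  have rep: "[rep n = n] (mod int d)" "coprime (rep n) (int k)" if "coprime n (int d)" for n
    using someI_ex[OF coprime_lift[OF that, of "int k"]] k unfolding rep_def by auto
  define \<psi> where "\<psi> n = (if coprime n (int d) then \<chi> (rep n) else 0)" for n
  have psi: "\<psi> n = \<chi> m" if "coprime n (int d)" "[m = n] (mod int d)" "coprime m (int k)" for n m
    unfolding \<psi>_def using that rep[OF that(1)] well[of "rep n" m] by (simp add: cong_def)
  have "dirichlet_character d \<psi>"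
    unfolding dirichlet_character_def
  proof (intro conjI allI impI)
    have "\<psi> 1 = 1" using psi[of 1 1] P(1) by simp
    then show "\<exists>n. \<psi> n \<noteq> 0" by (intro exI[of _ 1]) simp
  next
    fix m n
    show "\<psi> (m * n) = \<psi> m * \<psi> n"
    proof (cases "coprime m (int d) \<and> coprime n (int d)")
      case True
      then have "\<psi> (m * n) = \<chi> (rep m * rep n)"
        using rep[of m] rep[of n] by (intro psi) (auto intro: cong_mult)
      then show ?thesis using True by (simp add: \<psi>_def P(4))
    next
      case False then show ?thesis by (auto simp: \<psi>_def)
    qed
  next
    fix n
    have cp: "coprime (n + int d) (int d) \<longleftrightarrow> coprime n (int d)"
      by (simp add: coprime_iff_gcd_eq_1)
    show "\<psi> (n + int d) = \<psi> n"
    proof (cases "coprime n (int d)")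
      case True
      then have "\<psi> (n + int d) = \<chi> (rep n)"
        using rep[OF True] True cp by (intro psi) (auto simp: cong_def)
      then show ?thesis using True by (simp add: \<psi>_def)
    next
      case False then show ?thesis by (simp add: \<psi>_def cp)
    qed
  next
    fix n assume "gcd n (int d) > 1"
    then show "\<psi> n = 0" by (auto simp: \<psi>_def)
  qed
  moreover have "induced_character k \<chi> \<psi>"
    unfolding induced_character_def
  proof
    fix n
    show "\<chi> n = (if coprime n (int k) then \<psi> n else 0)"
    proof (cases "coprime n (int k)")
      case True
      then have "coprime n (int d)" using dk by (meson coprime_divisors dvd_refl)
      with True show ?thesis using psi[of n n] by simp
    next
      case False then show ?thesis using P(2) by simp
    qed
  qed
  ultimately show False using prim d unfolding primitive_character_def by blast
qed

text \<open>Euler's theorem makes every nonzero value a root of unity, and the only real ones are 1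
  and -1.\<close>

lemma real_primitive_character_int:
  assumes "k \<ge> 7" "odd k" and chi: "dirichlet_character k \<chi>" and real: "real_character \<chi>"
    and prim: "primitive_character k \<chi>" and odd: "odd_character \<chi>"
  obtains c where "odd_real_primitive_character k c" "\<chi> = (\<lambda>n. of_int (c n))"
proof -
  have k: "k > 0" using assms(1) by simp
  note P = dirichlet_character_properties[OF k chi]
  have vals: "\<chi> n = -1 \<or> \<chi> n = 0 \<or> \<chi> n = 1" for n
  proof (cases "coprime n (int k)")
    case True
    define r where "r = Re (\<chi> n)"
    have r: "\<chi> n = of_real r" using real unfolding real_character_def r_def by (metis Re_complex_of_real Reals_cases)
    have pow: "\<chi> (n ^ t) = \<chi> n ^ t" for t by (induction t) (simp_all add: P(1,4))
    have "[n ^ totient (nat (int k)) = 1] (mod int k)"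
      using assms(1) True by (intro residues.euler_theorem) (auto simp: residues_def)
    then have "[n ^ totient k = 1] (mod int k)" by simp
    from P(3)[OF this] have "\<chi> n ^ totient k = 1" by (simp add: pow P(1))
    then have "r ^ totient k = 1" unfolding r by (metis of_real_eq_1_iff of_real_power)
    then have "\<bar>r\<bar> ^ totient k = 1" by (simp flip: power_abs)
    then have "\<bar>r\<bar> = 1" using k by (metis abs_ge_zero power_eq_1_iff totient_gt_0_iff abs_abs real_norm_def less_numeral_extra(3))
    then show ?thesis unfolding r by (auto simp: abs_if split: if_splits)
  next
    case False then show ?thesis using P(2) by simp
  qed
  define c where "c n = (if \<chi> n = 1 then 1 else if \<chi> n = 0 then 0 else - 1 :: int)" for n
  have c: "\<chi> n = of_int (c n)" for n using vals[of n] by (auto simp: c_def)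
  have ceq: "c n = x \<longleftrightarrow> \<chi> n = of_int x" for n x unfolding c by simp
  have "odd_real_primitive_character k c"
  proof
    show "k \<ge> 7" "odd k" by fact+
    fix m n :: int and d :: nat
    have "(of_int (c (m * n)) :: complex) = of_int (c m * c n)" using P(4)[of m n] by (simp add: c)
    then show "c (m * n) = c m * c n" by (simp only: of_int_eq_iff)
    show "c (n + int k) = c n" using P(3)[of "n + int k" n] by (simp add: c_def cong_def)
    show "c n = 0 \<longleftrightarrow> \<not> coprime n (int k)" using P(2) by (simp add: ceq)
    show "c n = -1 \<or> c n = 0 \<or> c n = 1" by (auto simp: c_def)
    have "(of_int (c (- n)) :: complex) = of_int (- c n)" using odd by (simp add: odd_character_def flip: c)
    then show "c (- n) = - c n" by (simp only: of_int_eq_iff)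
    assume "d dvd k" "d < k"
    from primitive_character_nontrivial_on_kernel[OF k prim this]
    show "\<exists>n. [n = 1] (mod int d) \<and> c n = -1"
      using vals unfolding ceq by fastforce
  qed
  then show thesis using that c by blast
qed

section \<open>Gauss sums\<close>

lemma sum_periodic_mult:
  fixes f :: "int \<Rightarrow> 'a::comm_monoid_add"
  assumes per: "\<And>m n. [m = n] (mod k) \<Longrightarrow> f m = f n" and "coprime u k" "k > 0"
  shows "(\<Sum>j\<in>{0..<k}. f (u * j)) = (\<Sum>j\<in>{0..<k}. f j)"
proof -
  have r: "{0..<k} = insert 0 {1..<k}" using assms(3) by auto
  have "(\<Sum>j\<in>{1..<k}. f (u * j)) = (\<Sum>j\<in>{1..<k}. f (u * j mod k))"
    by (intro sum.cong per refl) (simp add: cong_def)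
  also have "\<dots> = (\<Sum>j\<in>{1..<k}. f j)"
    by (rule sum.reindex_bij_betw[OF bij_betw_int_remainders_mult[OF assms(2)]])
  finally show ?thesis unfolding r by simp
qed

text \<open>Stated for an arbitrary commutative ring so that it applies to integer polynomials.
  After evaluation at i or at a root of unity, the quotient is still an integer combination of
  powers of that point.\<close>

lemma prime_dvd_freshman_sum:
  fixes f :: "'b \<Rightarrow> 'a::comm_ring_1"
  assumes p: "prime p"
  shows "of_nat p dvd sum f A ^ p - (\<Sum>i\<in>A. f i ^ p)"
proof (induction A rule: infinite_finite_induct)
  case (insert a A)
  define x y where "x = f a" and "y = sum f A"
  have p0: "p > 0" using p by (simp add: prime_gt_0_nat)
  have "(x + y) ^ p = (\<Sum>i\<le>p. of_nat (p choose i) * x ^ i * y ^ (p - i))"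
    by (rule binomial_ring)
  also have "\<dots> = x ^ p + y ^ p + (\<Sum>i\<in>{1..<p}. of_nat (p choose i) * x ^ i * y ^ (p - i))"
  proof -
    have "{..p} = insert 0 (insert p {1..<p})" using p0 by auto
    then show ?thesis using p0 by (simp add: algebra_simps)
  qed
  finally have eq: "(x + y) ^ p - (x ^ p + y ^ p) = (\<Sum>i\<in>{1..<p}. of_nat (p choose i) * x ^ i * y ^ (p - i))"
    by simp
  have "of_nat p dvd (x + y) ^ p - (x ^ p + y ^ p)"
    unfolding eq
  proof (intro dvd_sum dvd_mult2)
    fix i assume i: "i \<in> {1..<p}"
    have "p dvd (p choose i)" by (rule dvd_choose_prime) (use i p in auto)
    then show "(of_nat p :: 'a) dvd of_nat (p choose i)" by auto
  qed
  moreover have "of_nat p dvd y ^ p - (\<Sum>i\<in>A. f i ^ p)" using insert.IH by (simp add: y_def)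
  ultimately have "of_nat p dvd ((x + y) ^ p - (x ^ p + y ^ p)) + (y ^ p - (\<Sum>i\<in>A. f i ^ p))"
    by (rule dvd_add)
  then show ?case using insert.hyps by (simp add: x_def y_def algebra_simps)
qed (use p in \<open>auto simp: power_0_left dest: prime_gt_0_nat\<close>)

section \<open>Evaluation of integer polynomials and the quadratic character of 2\<close>

definition ipoly :: "int poly \<Rightarrow> 'a::comm_ring_1 \<Rightarrow> 'a" where
  "ipoly p z = poly (map_poly of_int p) z"

lemma ipoly_altdef: "ipoly p z = (\<Sum>i\<le>degree p. of_int (coeff p i) * z ^ i)"
  for z :: "'a::{comm_ring_1,ring_char_0}"
  by (simp add: ipoly_def poly_altdef degree_map_poly coeff_map_poly)

lemma ipoly_hom [simp]:
  fixes z :: "'a::{comm_ring_1}"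
  shows "ipoly (p + q) z = ipoly p z + ipoly q z" "ipoly (p * q) z = ipoly p z * ipoly q z"
    "ipoly (p - q) z = ipoly p z - ipoly q z"
    "ipoly 1 z = 1" "ipoly (p ^ n) z = ipoly p z ^ n" "ipoly (monom a n) z = of_int a * z ^ n"
    "ipoly (sum f A) z = (\<Sum>x\<in>A. ipoly (f x) z)" "ipoly (of_nat m) z = of_nat m"
proof -
  show add: "ipoly (p + q) z = ipoly p z + ipoly q z" for p q :: "int poly"
    unfolding ipoly_def poly_add[symmetric] by (rule arg_cong2[where f = poly]) (auto simp: poly_eq_iff coeff_map_poly)
  show "ipoly (p - q) z = ipoly p z - ipoly q z" for p q :: "int poly"
    unfolding ipoly_def poly_diff[symmetric] by (rule arg_cong2[where f = poly]) (auto simp: poly_eq_iff coeff_map_poly)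
  show mult: "ipoly (p * q) z = ipoly p z * ipoly q z" for p q :: "int poly"
    unfolding ipoly_def poly_mult[symmetric] by (rule arg_cong2[where f = poly]) (auto simp: poly_eq_iff coeff_map_poly coeff_mult)
  show one: "ipoly 1 z = 1" by (simp add: ipoly_def)
  show "ipoly (p ^ n) z = ipoly p z ^ n" by (induction n) (simp_all add: one mult)
  show "ipoly (monom a n) z = of_int a * z ^ n" by (simp add: ipoly_def map_poly_monom poly_monom)
  have zero: "ipoly 0 z = 0" by (simp add: ipoly_def)
  show "ipoly (sum f A) z = (\<Sum>x\<in>A. ipoly (f x) z)"
    by (induction A rule: infinite_finite_induct) (simp_all add: zero add)
  show "ipoly (of_nat m) z = of_nat m"
    by (induction m) (simp_all add: zero one add)
qed

text \<open>Read off from \<open>(1 + i)^p = (2i)^((p-1)/2) (1 + i)\<close> modulo \<open>p\<close>.\<close>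

lemma two_power_half_prime:
  fixes p :: nat
  assumes p: "prime p" "odd p"
  shows "int p dvd 2 ^ ((p - 1) div 2) - (if p mod 8 = 1 \<or> p mod 8 = 7 then 1 else -1)"
proof -
  define m where "m = (p - 1) div 2"
  have pm: "p = 2 * m + 1" using p(2) unfolding m_def by (auto elim!: oddE)
  have "of_nat p dvd (\<Sum>i\<in>{0,1}. monom (1::int) i) ^ p - (\<Sum>i\<in>{0,1}. monom (1::int) i ^ p)"
    by (rule prime_dvd_freshman_sum[OF p(1)])
  then obtain Q where Q: "(\<Sum>i\<in>{0,1}. monom (1::int) i) ^ p - (\<Sum>i\<in>{0,1}. monom (1::int) i ^ p) = of_nat p * Q"
    by (auto elim: dvdE)
  \<comment> \<open>Powers of i are Gaussian integers, hence so is the value of the quotient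
    polynomial. Comparing real or imaginary parts below then gives divisibility in the
    integers.\<close>
  obtain a b where ab: "ipoly Q \<i> = of_int a + of_int b * \<i>"
  proof -
    have "\<exists>a b. \<i> ^ n = of_int a + of_int b * \<i>" for n
    proof (induction n)
      case 0 show ?case by (rule exI[of _ 1], rule exI[of _ 0]) simp
    next
      case (Suc n)
      then obtain a b where "\<i> ^ n = of_int a + of_int b * \<i>" by blast
      then have "\<i> ^ Suc n = of_int (- b) + of_int a * \<i>" by (simp add: algebra_simps)
      then show ?case by blast
    qed
    then obtain A B where AB: "\<i> ^ n = of_int (A n) + of_int (B n) * \<i>" for n by metis
    have "ipoly Q \<i> = of_int (\<Sum>i\<le>degree Q. coeff Q i * A i) + of_int (\<Sum>i\<le>degree Q. coeff Q i * B i) * \<i>"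
      unfolding ipoly_altdef AB by (simp add: algebra_simps sum.distrib sum_distrib_left sum_distrib_right)
    then show thesis by (rule that)
  qed
  have "(1 + \<i>) ^ p - (1 + \<i> ^ p) = of_nat p * (of_int a + of_int b * \<i>)"
    using arg_cong[OF Q, of "\<lambda>P. ipoly P \<i>"] by (simp add: ab)
  moreover have "(1 + \<i>) ^ p = of_int (2 ^ m) * \<i> ^ m * (1 + \<i>)"
  proof -
    have "(1 + \<i>)\<^sup>2 = 2 * \<i>" by (simp add: power2_eq_square algebra_simps)
    then have "((1 + \<i>)\<^sup>2) ^ m * (1 + \<i>) = of_int (2 ^ m) * \<i> ^ m * (1 + \<i>)"
      by (simp add: power_mult_distrib)
    then show ?thesis unfolding pm power_add power_mult power_one_right .
  qed
  ultimately have eq: "of_int (2 ^ m) * \<i> ^ m * (1 + \<i>) - (1 + \<i> ^ p) = of_nat p * (of_int a + of_int b * \<i>)"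
    by simp
  have i4: "\<i> ^ (4 * t + r) = \<i> ^ r" for t r
  proof -
    have "\<i> ^ 4 = 1" by (simp add: power_numeral_reduce)
    then show ?thesis by (simp add: power_add power_mult)
  qed
  define t where "t = m div 4"
  have "m mod 4 < 4" by simp
  then consider "m = 4 * t" | "m = 4 * t + 1" | "m = 4 * t + 2" | "m = 4 * t + 3"
    unfolding t_def by linarith
  then show ?thesis
  proof cases
    case 1
    then have "p = 4 * (2 * t) + 1" "p mod 8 = 1" by (simp_all add: pm)
    then have "\<i> ^ m = 1" "\<i> ^ p = \<i>" using i4[of t 0] i4[of "2 * t" 1] 1 by simp_all
    with eq have "of_int (2 ^ m - 1) * (1 + \<i>) = (of_int (int p * a) + of_int (int p * b) * \<i> :: complex)"
      by (simp add: algebra_simps)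
    from arg_cong[OF this, of Re] have "2 ^ m - 1 = int p * a" by (simp flip: of_int_mult of_int_diff of_int_power del: of_int_mult of_int_power)
    then show ?thesis using \<open>p mod 8 = 1\<close> by (simp add: m_def)
  next
    case 2
    then have "p = 4 * (2 * t) + 3" "p mod 8 = 3" by (simp_all add: pm)
    then have "\<i> ^ m = \<i>" "\<i> ^ p = - \<i>" using i4[of t 1] i4[of "2 * t" 3] 2 by (simp_all add: power3_eq_cube)
    with eq have "of_int (2 ^ m + 1) * (\<i> - 1) = (of_int (int p * a) + of_int (int p * b) * \<i> :: complex)"
      by (simp add: algebra_simps)
    from arg_cong[OF this, of Im] have "real_of_int (2 ^ m + 1) = of_int (int p * b)" by simp
    then have "2 ^ m + 1 = int p * b" by (simp only: of_int_eq_iff)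
    then show ?thesis using \<open>p mod 8 = 3\<close> by (simp add: m_def)
  next
    case 3
    then have "p = 4 * (2 * t + 1) + 1" "p mod 8 = 5" by (simp_all add: pm)
    then have "\<i> ^ m = -1" "\<i> ^ p = \<i>" using i4[of t 2] i4[of "2 * t + 1" 1] 3 by simp_all
    with eq have "of_int (2 ^ m + 1) * (- 1 - \<i>) = (of_int (int p * a) + of_int (int p * b) * \<i> :: complex)"
      by (simp add: algebra_simps)
    from arg_cong[OF this, of Re] have "real_of_int (2 ^ m + 1) = of_int (int p * (- a))" by simp
    then have "2 ^ m + 1 = int p * (- a)" by (simp only: of_int_eq_iff)
    then show ?thesis using \<open>p mod 8 = 5\<close> by (simp add: m_def)
  next
    case 4
    then have "p = 4 * (2 * t + 1) + 3" "p mod 8 = 7" by (simp_all add: pm)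
    then have "\<i> ^ m = - \<i>" "\<i> ^ p = - \<i>" using i4[of t 3] i4[of "2 * t + 1" 3] 4 by (simp_all add: power3_eq_cube)
    with eq have "of_int (2 ^ m - 1) * (1 - \<i>) = (of_int (int p * a) + of_int (int p * b) * \<i> :: complex)"
      by (simp add: algebra_simps)
    from arg_cong[OF this, of Re] have "real_of_int (2 ^ m - 1) = of_int (int p * a)" by simp
    then have "2 ^ m - 1 = int p * a" by (simp only: of_int_eq_iff)
    then show ?thesis using \<open>p mod 8 = 7\<close> by (simp add: m_def)
  qed
qed

section \<open>Additive characters and the Gauss sum modulo k\<close>

context odd_real_primitive_character
begin

lemma k_pos: "k > 0" using k_ge by simp

lemma c_cong: "[m = n] (mod int k) \<Longrightarrow> c m = c n"
  using periodic_cong[of c] c_periodic by blast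

lemma c_1: "c 1 = 1"
proof -
  have "c 1 \<noteq> 0" by (simp add: c_eq_0_iff)
  moreover have "c 1 = c 1 * c 1" using c_mult[of 1 1] by simp
  ultimately show ?thesis by simp
qed

lemma c_power: "c (n ^ m) = c n ^ m"
  by (induction m) (simp_all add: c_1 c_mult)

lemma c_square: "coprime n (int k) \<Longrightarrow> c n * c n = 1"
  using c_values[of n] c_eq_0_iff[of n] by auto

lemma c_odd_power: "odd m \<Longrightarrow> c n ^ m = c n"
  using c_values[of n] by (auto simp: power_0_left elim: oddE)

definition e :: "int \<Rightarrow> complex" where "e n = cis (2 * pi * of_int n / of_nat k)"

lemma e_add: "e (m + n) = e m * e n"
  by (simp add: e_def cis_mult add_divide_distrib distrib_left)

lemma e_0 [simp]: "e 0 = 1" by (simp add: e_def)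

lemma e_periodic: "e (n + int k) = e n"
proof -
  have "e (int k) = 1" using k_pos by (simp add: e_def)
  then show ?thesis by (simp add: e_add)
qed

lemma e_cong: "[m = n] (mod int k) \<Longrightarrow> e m = e n"
  using periodic_cong[of e] e_periodic by blast

lemma e_power: "e n ^ m = e (n * int m)"
  by (induction m) (simp_all add: e_add distrib_left)

lemma e_minus: "e (- n) = cnj (e n)"
  by (simp add: e_def cis_cnj)

lemma e_eq_1_iff: "e n = 1 \<longleftrightarrow> int k dvd n"
proof
  assume "e n = 1"
  then have "cos (2 * pi * of_int n / of_nat k) = 1" by (simp add: e_def complex_eq_iff)
  then obtain t :: int where "2 * pi * of_int n / of_nat k = of_int t * 2 * pi"
    using cos_one_2pi_int by blast
  then have "real_of_int n = of_int (int k * t)" using k_pos by (simp add: field_simps)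
  then have "n = int k * t" by (simp only: of_int_eq_iff)
  then show "int k dvd n" by simp
next
  assume "int k dvd n"
  then have "e n = e 0" by (intro e_cong) (simp add: cong_0_iff)
  then show "e n = 1" by simp
qed

lemma e_orthogonality: "(\<Sum>j\<in>{0..<int k}. e (n * j)) = (if int k dvd n then of_nat k else 0)"
proof (cases "int k dvd n")
  case True
  then have "e (n * j) = 1" for j by (simp add: e_eq_1_iff)
  then show ?thesis using True by simp
next
  case False
  have "(\<Sum>j\<in>{0..<int k}. e (n * j)) = (\<Sum>j<k. e (n * int j))"
    by (rule sum.reindex_bij_witness[of _ int nat]) auto
  also have "\<dots> = (\<Sum>j<k. e n ^ j)" by (simp add: e_power)
  also have "\<dots> = 0"
    using False geometric_sum[of "e n" k] e_cong[of "n * int k" 0] by (simp add: e_eq_1_iff e_power cong_0_iff)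
  finally show ?thesis using False by simp
qed

definition G :: complex where "G = (\<Sum>j\<in>{0..<int k}. of_int (c j) * e j)"

text \<open>For n coprime to k, substitute n j for j. Otherwise put d = k / gcd(n, k): primitivity
  gives a unit u = 1 modulo d with c u = -1. Replacing j by u j fixes n j modulo k but flips the
  sign, so the sum is its own negative.\<close>

theorem gauss_sum_separable: "(\<Sum>j\<in>{0..<int k}. of_int (c j) * e (n * j)) = of_int (c n) * G"
proof (cases "coprime n (int k)")
  case True
  have "(\<Sum>j\<in>{0..<int k}. of_int (c j) * e (n * j))
      = of_int (c n) * (\<Sum>j\<in>{0..<int k}. of_int (c (n * j)) * e (n * j))"
    using c_square[OF True] unfolding sum_distrib_left
    by (intro sum.cong) (simp_all add: c_mult flip: mult.assoc of_int_mult)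
  also have "(\<Sum>j\<in>{0..<int k}. of_int (c (n * j)) * e (n * j)) = G"
    unfolding G_def using True k_pos
    by (intro sum_periodic_mult[where f = "\<lambda>j. of_int (c j) * e j"]) (auto intro!: arg_cong2[where f = "(*)"] e_cong simp: c_cong)
  finally show ?thesis .
next
  case False
  define S where "S = (\<Sum>j\<in>{0..<int k}. of_int (c j) * e (n * j))"
  define g where "g = gcd n (int k)"
  have g: "g > 0" "g \<noteq> 1" "g dvd int k" "g dvd n" using False k_pos unfolding g_def by (auto simp: coprime_iff_gcd_eq_1)
  define d where "d = k div nat g"
  have gk: "nat g dvd k" using g by (metis int_dvd_int_iff int_nat_eq less_imp_le)
  have kd: "k = d * nat g" using gk unfolding d_def by simp
  have "d dvd k" "d < k" using kd k_pos g by auto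
  from c_primitive[OF this] obtain u where u: "[u = 1] (mod int d)" "c u = -1" by blast
  have cop: "coprime u (int k)" using u c_eq_0_iff[of u] by auto
  have nu: "[n * (u * j) = n * j] (mod int k)" for j
  proof -
    have "int d dvd u - 1" using u(1) by (simp add: cong_iff_dvd_diff)
    then have "int d * g dvd (u - 1) * n" using g by (intro mult_dvd_mono)
    then have "int k dvd (u - 1) * n * j" using g kd by simp
    then show ?thesis by (simp add: cong_iff_dvd_diff algebra_simps)
  qed
  have "S = (\<Sum>j\<in>{0..<int k}. of_int (c (u * j)) * e (n * (u * j)))"
    unfolding S_def using cop k_pos
    by (intro sum_periodic_mult[where f = "\<lambda>j. of_int (c j) * e (n * j)", symmetric])
      (auto intro!: arg_cong2[where f = "(*)"] e_cong cong_scalar_left simp: c_cong)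
  also have "\<dots> = (\<Sum>j\<in>{0..<int k}. - (of_int (c j) * e (n * j)))"
    using e_cong[OF nu] by (intro sum.cong) (simp_all add: c_mult u(2))
  also have "\<dots> = - S" by (simp add: S_def sum_negf)
  finally have "S = 0" by simp
  moreover have "c n = 0" using False c_eq_0_iff by simp
  ultimately show ?thesis by (simp add: S_def)
qed

text \<open>The sum of c(n) G e(-n) is computed twice. Separability at -1 and oddness give -G^2;
  expanding c(n) G as a sum over j, orthogonality leaves only j = 1, which contributes k.\<close>

theorem gauss_sum_square: "G\<^sup>2 = - of_nat k"
proof -
  have "(\<Sum>n\<in>{0..<int k}. of_int (c n) * G * e (- n)) = G * (\<Sum>n\<in>{0..<int k}. of_int (c n) * e (- 1 * n))"
    unfolding sum_distrib_left by (simp add: mult_ac)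
  also have "\<dots> = G * (of_int (c (- 1)) * G)" by (simp only: gauss_sum_separable)
  also have "\<dots> = - G\<^sup>2" by (simp add: c_minus c_1 power2_eq_square)
  finally have 1: "(\<Sum>n\<in>{0..<int k}. of_int (c n) * G * e (- n)) = - G\<^sup>2" .
  have "(\<Sum>n\<in>{0..<int k}. of_int (c n) * G * e (- n))
      = (\<Sum>n\<in>{0..<int k}. \<Sum>j\<in>{0..<int k}. of_int (c j) * e ((j - 1) * n))"
    unfolding gauss_sum_separable[symmetric] sum_distrib_right
    by (intro sum.cong refl) (simp add: algebra_simps flip: e_add)
  also have "\<dots> = (\<Sum>j\<in>{0..<int k}. of_int (c j) * (\<Sum>n\<in>{0..<int k}. e ((j - 1) * n)))"
    by (subst sum.swap) (simp add: sum_distrib_left)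
  also have "\<dots> = (\<Sum>j\<in>{0..<int k}. if j = 1 then of_nat k else 0)"
  proof (intro sum.cong refl)
    fix j assume j: "j \<in> {0..<int k}"
    have "int k dvd j - 1 \<longleftrightarrow> j = 1"
    proof
      assume "int k dvd j - 1"
      then have "[j = 1] (mod int k)" by (simp add: cong_iff_dvd_diff)
      then show "j = 1" using j k_ge by (auto simp: cong_def)
    qed simp
    then show "of_int (c j) * (\<Sum>n\<in>{0..<int k}. e ((j - 1) * n)) = (if j = 1 then of_nat k else 0)"
      by (simp add: e_orthogonality c_1)
  qed
  also have "\<dots> = of_nat k" using k_ge by simp
  finally have "- G\<^sup>2 = of_nat k" using 1 by simp
  then show ?thesis by (metis minus_minus)
qed

end

section \<open>Euler criterion for the character and the prime two\<close>

lemma power_one_plus_mod_square: "x\<^sup>2 dvd (1 + x) ^ m - (1 + int m * x)" for x :: int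
proof (induction m)
  case (Suc m)
  have "(1 + x) ^ Suc m - (1 + int (Suc m) * x) = ((1 + x) ^ m - (1 + int m * x)) * (1 + x) + x\<^sup>2 * int m"
    by (simp add: algebra_simps power2_eq_square)
  then show ?case using Suc by simp
qed simp

lemma sum_mult_power_eq:
  fixes z :: "'a::comm_ring_1"
  shows "(z - 1) * (\<Sum>j<N. of_nat j * z ^ j) = of_nat N * z ^ N - z * (\<Sum>j<N. z ^ j)"
  by (induction N) (simp_all add: algebra_simps)

lemma Im_inverse_cis_minus_one:
  assumes "sin (t / 2) \<noteq> 0"
  shows "Im (1 / (cis t - 1)) = - cot (t / 2) / 2"
proof -
  define s c where "s = sin (t / 2)" and "c = cos (t / 2)"
  have sc: "c\<^sup>2 = 1 - s\<^sup>2" by (simp add: s_def c_def cos_squared_eq)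
  have s: "s \<noteq> 0" using assms by (simp add: s_def)
  have "sin t = 2 * s * c" "cos t = 1 - 2 * s\<^sup>2"
    using sin_double[of "t / 2"] cos_double_sin[of "t / 2"] by (simp_all add: s_def c_def)
  then have "Im (1 / (cis t - 1)) = - (2 * s * c) / ((2 * s\<^sup>2)\<^sup>2 + (2 * s * c)\<^sup>2)"
    by (simp add: Im_divide)
  also have "(2 * s\<^sup>2)\<^sup>2 + (2 * s * c)\<^sup>2 = 4 * s\<^sup>2"
    unfolding power_mult_distrib sc by (simp add: algebra_simps power2_eq_square)
  also have "- (2 * s * c) / (4 * s\<^sup>2) = - (c / s) / 2" using s by (simp add: power2_eq_square)
  finally show ?thesis by (simp add: cot_def s_def c_def)
qed

lemma cong_small_imp_eq:
  fixes x y :: int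
  assumes "p dvd x - y" "x = -1 \<or> x = 0 \<or> x = 1" "y = -1 \<or> y = 0 \<or> y = 1" "p > 2"
  shows "x = y"
proof (rule ccontr)
  assume "x \<noteq> y"
  then have "\<bar>p\<bar> \<le> \<bar>x - y\<bar>" using assms(1) by (intro dvd_imp_le_int) auto
  then show False using assms by auto
qed

lemma neg_two_power_half_prime:
  fixes p :: nat
  assumes p: "prime p" "odd p"
  shows "int p dvd (- 2) ^ ((p - 1) div 2) - (if p mod 8 = 1 \<or> p mod 8 = 3 then 1 else -1)"
proof -
  define m where "m = (p - 1) div 2"
  have pm: "p = 2 * m + 1" using p(2) unfolding m_def by (auto elim!: oddE)
  have "(- 2 :: int) ^ m - (if p mod 8 = 1 \<or> p mod 8 = 3 then 1 else -1)
     = (-1) ^ m * (2 ^ m - (if p mod 8 = 1 \<or> p mod 8 = 7 then 1 else -1))"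
  proof (cases "even m")
    case True
    then have "p mod 8 = 1 \<or> p mod 8 = 5" unfolding pm by presburger
    then show ?thesis using True by auto
  next
    case False
    then have "p mod 8 = 3 \<or> p mod 8 = 7" unfolding pm by presburger
    then show ?thesis using False by auto
  qed
  then show ?thesis using two_power_half_prime[OF p] unfolding m_def[symmetric] by simp
qed

lemma odd_mod_8_cases: "odd (n::nat) \<Longrightarrow> n mod 8 = 1 \<or> n mod 8 = 3 \<or> n mod 8 = 5 \<or> n mod 8 = 7"
  by presburger

text \<open>Both sets are subgroups of index 2 in the units modulo 8, so membership defines a
  multiplicative sign on odd numbers.\<close>

lemma quadratic_residues_mod_8_mult:
  fixes a b :: nat
  assumes "odd a" "odd b"
  shows "a * b mod 8 \<in> {1, 7} \<longleftrightarrow> (a mod 8 \<in> {1, 7} \<longleftrightarrow> b mod 8 \<in> {1, 7})"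
    and "a * b mod 8 \<in> {1, 3} \<longleftrightarrow> (a mod 8 \<in> {1, 3} \<longleftrightarrow> b mod 8 \<in> {1, 3})"
proof -
  have "a * b mod 8 = (a mod 8) * (b mod 8) mod 8" by (rule mod_mult_eq[symmetric])
  with odd_mod_8_cases[OF assms(1)] odd_mod_8_cases[OF assms(2)]
  show "a * b mod 8 \<in> {1, 7} \<longleftrightarrow> (a mod 8 \<in> {1, 7} \<longleftrightarrow> b mod 8 \<in> {1, 7})"
    and "a * b mod 8 \<in> {1, 3} \<longleftrightarrow> (a mod 8 \<in> {1, 3} \<longleftrightarrow> b mod 8 \<in> {1, 3})"
    by (elim disjE; simp)+
qed

context odd_real_primitive_character
begin

text \<open>Expanding the \<open>p\<close>-th power of \<open>\<Sum> c(j) x\<^sup>j\<close> modulo \<open>p\<close> at all \<open>k\<close>-th roots of unity and inverting the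
  Fourier transform replaces the arithmetic of the cyclotomic integers by that of \<open>\<int>[x]\<close>.\<close>

theorem euler_criterion_character:
  assumes p: "prime p" "odd p"
  shows "int p dvd (- int k) ^ ((p - 1) div 2) - c (int p)"
proof -
  define m where "m = (p - 1) div 2"
  have pm: "p = 2 * m + 1" using p(2) unfolding m_def by (auto elim!: oddE)
  define f where "f j = monom (c j) (nat j)" for j
  obtain Q where Q: "sum f {0..<int k} ^ p - (\<Sum>j\<in>{0..<int k}. f j ^ p) = of_nat p * Q"
    using prime_dvd_freshman_sum[OF p(1), of f "{0..<int k}"] by (auto elim: dvdE)
  have Qe: "(of_int (c n) * G) ^ p - of_int (c (n * int p)) * G = of_nat p * ipoly Q (e n)" for n
  proof -
    have "ipoly (f j) (e n) = of_int (c j) * e (n * j)" if "j \<in> {0..<int k}" for j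
      using that by (simp add: f_def e_power)
    moreover have "ipoly (f j ^ p) (e n) = of_int (c j) * e (n * int p * j)" if "j \<in> {0..<int k}" for j
      using that p(2) by (simp add: f_def e_power power_mult_distrib c_odd_power mult_ac flip: of_int_power)
    ultimately show ?thesis
      using arg_cong[OF Q, of "\<lambda>P. ipoly P (e n)"] gauss_sum_separable[of n] gauss_sum_separable[of "n * int p"]
      by simp
  qed
  have ce: "(\<Sum>n\<in>{0..<int k}. of_int (c n) * e (- n)) = - G"
    using gauss_sum_separable[of "-1"] by (simp add: c_minus c_1)
  have "(\<Sum>n\<in>{0..<int k}. ((of_int (c n) * G) ^ p - of_int (c (n * int p)) * G) * e (- n))
      = (G ^ p - of_int (c (int p)) * G) * (\<Sum>n\<in>{0..<int k}. of_int (c n) * e (- n))"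
    unfolding sum_distrib_left using p(2)
    by (intro sum.cong refl) (simp add: power_mult_distrib c_odd_power c_mult algebra_simps flip: of_int_power)
  also have "\<dots> = of_int (c (int p)) * G\<^sup>2 - G ^ Suc p"
    unfolding ce by (simp add: algebra_simps power2_eq_square)
  also have "G ^ Suc p = (G\<^sup>2) ^ (m + 1)" by (simp add: pm power2_eq_square power_mult)
  also have "of_int (c (int p)) * G\<^sup>2 - (G\<^sup>2) ^ (m + 1) = of_int (int k * ((- int k) ^ m - c (int p)))"
    unfolding gauss_sum_square by (simp add: algebra_simps)
  finally have 1: "(\<Sum>n\<in>{0..<int k}. of_nat p * ipoly Q (e n) * e (- n)) = of_int (int k * ((- int k) ^ m - c (int p)))"
    unfolding Qe .
  \<comment> \<open>The inverse transform retains the coefficients of \<open>Q\<close> at exponents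
    congruent to 1 modulo k. Both sides then carry the factor k, which cancels even when p divides
    k.\<close>
  define T where "T = (\<Sum>i\<le>Polynomial.degree Q. coeff Q i * (if int k dvd int i - 1 then 1 else 0))"
  have "(\<Sum>n\<in>{0..<int k}. of_nat p * ipoly Q (e n) * e (- n))
      = of_nat p * (\<Sum>n\<in>{0..<int k}. \<Sum>i\<le>Polynomial.degree Q. of_int (coeff Q i) * e ((int i - 1) * n))"
    unfolding sum_distrib_left ipoly_altdef sum_distrib_right
    by (intro sum.cong refl) (simp add: e_power algebra_simps flip: e_add)
  also have "\<dots> = of_nat p * (\<Sum>i\<le>Polynomial.degree Q. of_int (coeff Q i) * (\<Sum>n\<in>{0..<int k}. e ((int i - 1) * n)))"
    by (subst sum.swap) (simp add: sum_distrib_left)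
  also have "\<dots> = of_int (int p * (int k * T))"
    unfolding e_orthogonality T_def by (simp add: sum_distrib_left mult_ac if_distrib cong: if_cong)
  finally have "int k * ((- int k) ^ m - c (int p)) = int p * (int k * T)"
    unfolding 1 by (simp only: of_int_eq_iff)
  then have "(- int k) ^ m - c (int p) = int p * T" using k_pos by simp
  then show ?thesis by (simp add: m_def)
qed

text \<open>If p^2 divides k, every unit congruent to 1 modulo k/p has p-th power 1 modulo k. As p
  is odd and c is a sign on units, c would be 1 on all of them, against primitivity.\<close>

lemma square_not_dvd_k:
  assumes p: "prime p"
  shows "\<not> p\<^sup>2 dvd k"
proof
  assume p2: "p\<^sup>2 dvd k"
  then obtain r where "k = p\<^sup>2 * r" by (rule dvdE)
  then have r: "k = p * (p * r)" by (simp add: power2_eq_square)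
  have "odd p" using k_odd r by auto
  have p1: "p > 1" using p by (rule prime_gt_1_nat)
  have "p * r dvd k" "p * r < k" using r p1 k_pos by auto
  from c_primitive[OF this] obtain n where n: "[n = 1] (mod int (p * r))" "c n = -1" by blast
  define x where "x = n - 1"
  have x: "int (p * r) dvd x" using n(1) unfolding x_def cong_iff_dvd_diff .
  have "int k dvd int p * x" using x r by (auto simp: mult_ac)
  moreover have "int k dvd x\<^sup>2"
  proof -
    have "int (p * r) * int (p * r) dvd x\<^sup>2" unfolding power2_eq_square by (intro mult_dvd_mono x)
    moreover have "int k dvd int (p * r) * int (p * r)" unfolding r by (simp add: mult_ac)
    ultimately show ?thesis by (rule dvd_trans[rotated])
  qed
  ultimately have "int k dvd ((1 + x) ^ p - (1 + int p * x)) + int p * x"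
    using power_one_plus_mod_square[of x p] dvd_trans by (intro dvd_add) blast+
  then have "[n ^ p = 1] (mod int k)" by (simp add: x_def cong_iff_dvd_diff)
  then have "c n ^ p = 1" using c_cong[of "n ^ p" 1] by (simp add: c_power c_1)
  then show False using n(2) \<open>odd p\<close> by simp
qed

lemma c_eq_of_prime_factors:
  assumes "odd n" and s1: "s 1 = 1" and s: "\<And>a b. odd a \<Longrightarrow> odd b \<Longrightarrow> s (a * b) = s a * s b"
    and prm: "\<And>p. prime p \<Longrightarrow> p dvd n \<Longrightarrow> c (int p) = s p"
  shows "c (int n) = s (n::nat)"
  using assms(1) prm
proof (induction n rule: less_induct)
  case (less n)
  show ?case
  proof (cases "n = 1")
    case True then show ?thesis using s1 c_1 by simp
  next
    case False
    then obtain p where p: "prime p" "p dvd n" using prime_factor_nat by blast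
    then obtain q where q: "n = p * q" by (auto elim: dvdE)
    have n0: "n > 0" using less.prems(1) by (auto intro: Nat.gr0I)
    have qn: "q < n" using p q n0 prime_gt_1_nat[OF p(1)] by auto
    have odd: "odd p" "odd q" using less.prems(1) q by auto
    have prm: "c (int r) = s r" if "prime r" "r dvd q" for r
      by (rule less.prems(2)) (use that q in simp_all)
    have IH: "c (int q) = s q" by (rule less.IH[OF qn odd(2) prm])
    have "c (int p) = s p" by (rule less.prems(2)[OF p])
    with IH show ?thesis unfolding q of_nat_mult c_mult s[OF odd] by (simp only:)
  qed
qed

text \<open>A miniature of reciprocity: modulo each prime factor of n the number -k may be replaced
  by r, so the Euler criterion equates c there with the quadratic character of r.\<close>

lemma c_eq_of_neg_k_cong:
  assumes "odd n" "s 1 = 1" "\<And>a b. odd a \<Longrightarrow> odd b \<Longrightarrow> s (a * b) = s a * s b"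
    and vals: "\<And>p. s p = -1 \<or> s p = 0 \<or> s p = 1"
    and cong: "[- int k = r] (mod int n)"
    and crit: "\<And>p. prime p \<Longrightarrow> odd p \<Longrightarrow> int p dvd r ^ ((p - 1) div 2) - s p"
  shows "c (int n) = s n"
  using assms(1-3)
proof (rule c_eq_of_prime_factors)
  fix p assume p: "prime p" "p dvd n"
  have op: "odd p" using dvd_trans[OF _ p(2), of 2] assms(1) by auto
  have "[- int k = r] (mod int p)" using cong p(2) cong_dvd_modulus by fastforce
  then have "[(- int k) ^ ((p - 1) div 2) = r ^ ((p - 1) div 2)] (mod int p)" by (rule cong_pow)
  moreover have "[(- int k) ^ ((p - 1) div 2) = c (int p)] (mod int p)"
    using euler_criterion_character[OF p(1) op] by (simp add: cong_iff_dvd_diff)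
  moreover have "[r ^ ((p - 1) div 2) = s p] (mod int p)"
    using crit[OF p(1) op] by (simp add: cong_iff_dvd_diff)
  ultimately have "[c (int p) = s p] (mod int p)" by (meson cong_sym cong_trans)
  moreover have "p > 2" using p(1) op prime_gt_1_nat[OF p(1)] by (cases "p = 2") auto
  ultimately show "c (int p) = s p"
    using c_values[of "int p"] vals[of p] by (intro cong_small_imp_eq[of "int p"]) (auto simp: cong_iff_dvd_diff)
qed

text \<open>Evaluate \<open>c\<close> at \<open>k + 2\<close> and \<open>k - 2\<close>: modulo their prime factors \<open>-k\<close> is \<open>2\<close> and \<open>-2\<close>,
  so the values \<open>c 2\<close> and \<open>- c 2\<close> become the two supplementary Jacobi symbols.\<close>

lemma
  shows k_mod_8: "k mod 8 = 3 \<or> k mod 8 = 7" and c_2: "c 2 = (if k mod 8 = 7 then 1 else -1)"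
proof -
  define s where "s n = (if n mod 8 = 1 \<or> n mod 8 = 7 then 1 else - 1 :: int)" for n :: nat
  define s' where "s' n = (if n mod 8 = 1 \<or> n mod 8 = 3 then 1 else - 1 :: int)" for n :: nat
  have "c (int (k + 2)) = s (k + 2)"
  proof (rule c_eq_of_neg_k_cong)
    show "s (a * b) = s a * s b" if "odd a" "odd b" for a b
      using quadratic_residues_mod_8_mult(1)[OF that] unfolding s_def by auto
    have "- int k - 2 = - int (k + 2)" by simp
    then show "[- int k = 2] (mod int (k + 2))" unfolding cong_iff_dvd_diff by (simp only: dvd_minus_iff dvd_refl)
    show "int p dvd 2 ^ ((p - 1) div 2) - s p" if "prime p" "odd p" for p
      using two_power_half_prime[OF that] by (simp add: s_def)
  qed (use k_odd in \<open>auto simp: s_def\<close>)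
  moreover have "c (int (k + 2)) = c 2" using c_cong[of "int (k + 2)" 2] by (simp add: cong_def)
  ultimately have 1: "c 2 = s (k + 2)" by simp
  have "c (int (k - 2)) = s' (k - 2)"
  proof (rule c_eq_of_neg_k_cong)
    show "s' (a * b) = s' a * s' b" if "odd a" "odd b" for a b
      using quadratic_residues_mod_8_mult(2)[OF that] unfolding s'_def by auto
    have "- int k - (- 2) = - int (k - 2)" using k_ge by (simp add: of_nat_diff)
    then show "[- int k = - 2] (mod int (k - 2))" unfolding cong_iff_dvd_diff by (simp only: dvd_minus_iff dvd_refl)
    show "int p dvd (- 2) ^ ((p - 1) div 2) - s' p" if "prime p" "odd p" for p
      using neg_two_power_half_prime[OF that] by (simp add: s'_def)
  qed (use k_odd k_ge in \<open>auto simp: s'_def\<close>)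
  moreover have "c (int (k - 2)) = - c 2"
    using c_cong[of "int (k - 2)" "- 2"] k_ge c_minus[of 2] by (simp add: cong_def of_nat_diff)
  ultimately have 2: "- c 2 = s' (k - 2)" by simp
  \<comment> \<open>The two evaluations are compatible only for k congruent to 3 or 7 modulo 8; k =
    1 and k = 5 modulo 8 make the signs agree instead of being opposite.\<close>
  have neq: "s' (k - 2) = - s (k + 2)" using 1 2 by simp
  have k2: "(k - 2) mod 8 = (k + 6) mod 8" using k_ge mod_add_self2[of "k - 2" 8] by (simp add: add.commute)
  have A: "s (k + 2) = (if (k mod 8 + 2) mod 8 = 1 \<or> (k mod 8 + 2) mod 8 = 7 then 1 else -1)"
    unfolding s_def by (simp add: mod_simps)
  have B: "s' (k - 2) = (if (k mod 8 + 6) mod 8 = 1 \<or> (k mod 8 + 6) mod 8 = 3 then 1 else -1)"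
    unfolding s'_def k2 by (simp add: mod_simps)
  show m8: "k mod 8 = 3 \<or> k mod 8 = 7"
    using odd_mod_8_cases[OF k_odd] neq unfolding A B by auto
  show "c 2 = (if k mod 8 = 7 then 1 else -1)" using m8 unfolding 1 A by auto
qed

section \<open>Sine, cotangent and tangent sums\<close>

definition g :: real where "g = Im G"

text \<open>Conjugating G amounts to separability at -1, which by oddness is negation, so G is
  purely imaginary.\<close>

lemma G_eq: "G = \<i> * of_real g"
proof -
  have "cnj G = (\<Sum>j\<in>{0..<int k}. of_int (c j) * e (- 1 * j))"
    unfolding G_def by (simp add: e_minus)
  also have "\<dots> = - G" unfolding gauss_sum_separable by (simp add: c_minus c_1)
  finally show ?thesis by (simp add: complex_eq_iff g_def)
qed

lemma sine_sum: "(\<Sum>j\<in>{0..<int k}. of_int (c j) * sin (2 * pi * of_int (n * j) / real k)) = of_int (c n) * g"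
  using arg_cong[OF gauss_sum_separable[of n], of Im] by (simp add: e_def g_def)

definition cot_sum :: real where "cot_sum = (\<Sum>n\<in>{0..<int k}. of_int (c n) * cot (pi * of_int n / real k))"
definition first_moment :: real where "first_moment = (\<Sum>n\<in>{0..<int k}. of_int n * of_int (c n))"

lemma sin_ne_0: "\<not> int k dvd n \<Longrightarrow> sin (pi * of_int n / real k) \<noteq> 0"
proof
  assume n: "\<not> int k dvd n" and "sin (pi * of_int n / real k) = 0"
  then obtain i :: int where "pi * of_int n / real k = of_int i * pi" using sin_zero_iff_int2 by blast
  then have "real_of_int n = of_int (int k * i)" using k_pos by (simp add: field_simps)
  then have "n = int k * i" by (simp only: of_int_eq_iff)
  then show False using n by simp
qed

text \<open>The finite Fourier transform of j is a cotangent: at a k-th root of unity z other than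
  1, the sum of j z^j equals k / (z - 1).\<close>

lemma weighted_sine_sum:
  assumes n: "\<not> int k dvd n"
  shows "(\<Sum>j\<in>{0..<int k}. of_int j * sin (2 * pi * of_int (n * j) / real k)) = - real k * cot (pi * of_int n / real k) / 2"
proof -
  have ne: "e n \<noteq> 1" using n by (simp add: e_eq_1_iff)
  have ek: "e n ^ k = 1" by (simp add: e_power e_eq_1_iff)
  have "(\<Sum>j<k. e n ^ j) = 0" using geometric_sum[OF ne, of k] ek by simp
  then have "(e n - 1) * (\<Sum>j<k. of_nat j * e n ^ j) = of_nat k"
    using sum_mult_power_eq[of "e n" k] ek by simp
  then have "(\<Sum>j<k. of_nat j * e n ^ j) = of_nat k * (1 / (e n - 1))"
    using ne by (simp add: field_simps)
  moreover have "Im (of_nat k * w) = real k * Im w" for w by simp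
  ultimately have "Im (\<Sum>j<k. of_nat j * e n ^ j) = real k * Im (1 / (e n - 1))"
    by (simp only:)
  also have "Im (1 / (e n - 1)) = - cot (2 * pi * of_int n / of_nat k / 2) / 2"
    unfolding e_def by (rule Im_inverse_cis_minus_one) (use sin_ne_0[OF n] in simp)
  also have "Im (\<Sum>j<k. of_nat j * e n ^ j) = (\<Sum>j<k. real j * sin (2 * pi * of_int (n * int j) / real k))"
    by (simp add: e_power) (simp add: e_def)
  also have "\<dots> = (\<Sum>j\<in>{0..<int k}. of_int j * sin (2 * pi * of_int (n * j) / real k))"
    by (rule sum.reindex_bij_witness[of _ nat int]) auto
  finally show ?thesis by simp
qed

text \<open>Insert the finite Fourier expansion of the cotangent and swap the sums; the inner sine
  sum is c(j) g. In effect this is the functional equation between L(1) and L(0), to which the two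
  sums are proportional.\<close>

lemma cot_sum_first_moment: "real k * cot_sum = - 2 * g * first_moment"
proof -
  have "- real k * cot_sum / 2 = (\<Sum>n\<in>{0..<int k}. of_int (c n) * (- real k * cot (pi * of_int n / real k) / 2))"
    by (simp add: cot_sum_def sum_distrib_left sum_divide_distrib sum_negf mult_ac)
  also have "\<dots> = (\<Sum>n\<in>{0..<int k}. of_int (c n) * (\<Sum>j\<in>{0..<int k}. of_int j * sin (2 * pi * of_int (n * j) / real k)))"
  proof (intro sum.cong refl)
    fix n assume n: "n \<in> {0..<int k}"
    show "of_int (c n) * (- real k * cot (pi * of_int n / real k) / 2)
       = of_int (c n) * (\<Sum>j\<in>{0..<int k}. of_int j * sin (2 * pi * of_int (n * j) / real k))"
    proof (cases "int k dvd n")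
      case True
      then have "\<not> coprime n (int k)" using k_ge by (auto dest: coprime_common_divisor_int)
      then have "c n = 0" using c_eq_0_iff by simp
      then show ?thesis by simp
    next
      case False then show ?thesis by (simp only: weighted_sine_sum simp_thms)
    qed
  qed
  also have "\<dots> = (\<Sum>j\<in>{0..<int k}. of_int j * (\<Sum>n\<in>{0..<int k}. of_int (c n) * sin (2 * pi * of_int (j * n) / real k)))"
    unfolding sum_distrib_left by (subst sum.swap) (simp add: mult_ac)
  also have "\<dots> = g * first_moment"
    unfolding sine_sum by (simp add: first_moment_def sum_distrib_left mult_ac)
  finally show ?thesis by simp
qed

text \<open>As k is odd, doubling permutes the residues modulo k, so the cotangents at doubled
  angles contribute c(2) times \<open>cot_sum\<close>.\<close>

lemma tan_sum: "(\<Sum>n\<in>{0..<int k}. of_int (c n) * tan (pi * of_int n / real k)) = (1 - 2 * of_int (c 2)) * cot_sum"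
proof -
  define f where "f n = real_of_int (c n) * cot (pi * of_int n / real k)" for n
  have per: "f (n + int k) = f n" for n
    using k_pos by (simp add: f_def c_periodic distrib_left add_divide_distrib cot_def)
  have cop: "coprime 2 (int k)" using k_odd by simp
  have "(\<Sum>n\<in>{0..<int k}. f (2 * n)) = cot_sum"
    unfolding cot_sum_def f_def[symmetric] using periodic_cong[of f, OF per] cop k_pos by (intro sum_periodic_mult) auto
  then have "of_int (c 2) * cot_sum = of_int (c 2) * (\<Sum>n\<in>{0..<int k}. of_int (c 2) * (of_int (c n) * cot (2 * (pi * of_int n / real k))))"
    by (simp add: f_def c_mult mult_ac)
  also have "\<dots> = of_int (c 2 * c 2) * (\<Sum>n\<in>{0..<int k}. of_int (c n) * cot (2 * (pi * of_int n / real k)))"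
    by (simp add: sum_distrib_left mult_ac)
  also have "\<dots> = (\<Sum>n\<in>{0..<int k}. of_int (c n) * cot (2 * (pi * of_int n / real k)))"
    by (simp add: c_square[OF cop])
  finally have 1: "(\<Sum>n\<in>{0..<int k}. of_int (c n) * cot (2 * (pi * of_int n / real k))) = of_int (c 2) * cot_sum" ..
  have "(\<Sum>n\<in>{0..<int k}. of_int (c n) * tan (pi * of_int n / real k))
      = (\<Sum>n\<in>{0..<int k}. of_int (c n) * cot (pi * of_int n / real k) - 2 * (of_int (c n) * cot (2 * (pi * of_int n / real k))))"
  proof (intro sum.cong refl)
    fix n assume n: "n \<in> {0..<int k}"
    show "of_int (c n) * tan (pi * of_int n / real k)
       = of_int (c n) * cot (pi * of_int n / real k) - 2 * (of_int (c n) * cot (2 * (pi * of_int n / real k)))"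
    proof (cases "int k dvd n")
      case True
      then have "\<not> coprime n (int k)" using k_ge by (auto dest: coprime_common_divisor_int)
      then have "c n = 0" using c_eq_0_iff by simp
      then show ?thesis by simp
    next
      case False
      define x where "x = pi * of_int n / real k"
      have "sin x \<noteq> 0" using sin_ne_0[OF False] by (simp add: x_def)
      moreover have "\<not> int k dvd 2 * n" using False cop by (simp add: coprime_dvd_mult_right_iff coprime_commute)
      then have "sin (2 * x) \<noteq> 0" using sin_ne_0[of "2 * n"] by (simp add: x_def mult_ac)
      moreover from this have "cos x \<noteq> 0" by (auto simp: sin_double)
      ultimately have "tan x = cot x - 2 * cot (2 * x)"
        unfolding tan_def cot_def sin_double cos_double by (simp add: field_simps power2_eq_square)
      then show ?thesis unfolding x_def[symmetric] by (simp only: right_diff_distrib mult.left_commute)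
    qed
  qed
  also have "\<dots> = cot_sum - 2 * (of_int (c 2) * cot_sum)"
    unfolding sum_subtractf sum_distrib_left[symmetric] 1 cot_sum_def ..
  finally show ?thesis by (simp add: algebra_simps)
qed

end

section \<open>Counting ideals of given norm\<close>

text \<open>With r = 1 and the character this is the divisor sum of c. With r = 2 and
  \<open>rho\<close> it counts the ideals of norm n, sorted by the largest rational integer e
  dividing the ideal.\<close>

definition power_divisor_sum :: "nat \<Rightarrow> (nat \<Rightarrow> int) \<Rightarrow> nat \<Rightarrow> int" where
  "power_divisor_sum r \<phi> n = (\<Sum>e\<in>{e. e ^ r dvd n}. \<phi> (n div e ^ r))"

lemma power_dvd_coprime_mult:
  fixes a b e :: nat
  assumes "coprime a b" "r > 0" "e ^ r dvd a * b"
  shows "\<exists>x y. e = x * y \<and> x ^ r dvd a \<and> y ^ r dvd b"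
proof -
  have "e dvd a * b" using assms(2,3) by (metis dvd_power dvd_trans)
  then obtain x y where xy: "e = x * y" "x dvd a" "y dvd b" using division_decomp by blast
  have cop: "coprime (x ^ r) b" "coprime (y ^ r) a"
    using assms(1) xy(2,3) by (meson coprime_commute coprime_divisors coprime_power_left_iff dvd_refl)+
  have "x ^ r dvd a * b" "y ^ r dvd a * b"
    using assms(3) unfolding xy(1) power_mult_distrib by (meson dvd_mult_left dvd_mult_right)+
  then have "x ^ r dvd a" "y ^ r dvd b"
    using cop by (simp_all add: coprime_dvd_mult_left_iff coprime_dvd_mult_right_iff)
  with xy(1) show ?thesis by blast
qed

text \<open>An e whose r-th power divides a b factors uniquely into a part for a and a part for b;
  the gcd with a recovers the first part.\<close>

lemma power_divisor_sum_mult: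
  fixes a b :: nat
  assumes cop: "coprime a b" and r: "r > 0" and pos: "a > 0" "b > 0"
    and mult: "\<And>x y. coprime x y \<Longrightarrow> x > 0 \<Longrightarrow> y > 0 \<Longrightarrow> \<phi> (x * y) = \<phi> x * \<phi> y"
  shows "power_divisor_sum r \<phi> (a * b) = power_divisor_sum r \<phi> a * power_divisor_sum r \<phi> b"
proof -
  have dvd: "x dvd n" if "x ^ r dvd n" for x n :: nat using that r by (metis dvd_power dvd_trans)
  have bij: "bij_betw (\<lambda>(x, y). x * y) ({e. e ^ r dvd a} \<times> {e. e ^ r dvd b}) {e. e ^ r dvd a * b}"
    unfolding bij_betw_def
  proof
    have gcdx: "gcd (x * y) a = x" if "x ^ r dvd a" "y ^ r dvd b" for x y
    proof -
      have "coprime y a" using cop dvd[OF that(2)] by (meson coprime_commute coprime_divisors dvd_refl)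
      then have "coprime (gcd (x * y) a) y" by (meson coprime_commute coprime_divisors dvd_refl gcd_dvd2)
      then have "gcd (x * y) a dvd x" by (metis coprime_dvd_mult_left_iff gcd_dvd1)
      moreover have "x dvd gcd (x * y) a" using dvd[OF that(1)] by simp
      ultimately show ?thesis by (rule dvd_antisym)
    qed
    have x0: "x \<noteq> 0" if "x ^ r dvd a" for x using that r pos by (auto simp: power_0_left)
    show "inj_on (\<lambda>(x, y). x * y) ({e. e ^ r dvd a} \<times> {e. e ^ r dvd b})"
    proof (rule inj_onI, clarify)
      fix x y x' y' assume *: "x ^ r dvd a" "y ^ r dvd b" "x' ^ r dvd a" "y' ^ r dvd b" "x * y = x' * y'"
      then have "x = x'" using gcdx[OF *(1,2)] gcdx[OF *(3,4)] by simp
      then show "x = x' \<and> y = y'" using *(5) x0[OF *(1)] by simp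
    qed
    show "(\<lambda>(x, y). x * y) ` ({e. e ^ r dvd a} \<times> {e. e ^ r dvd b}) = {e. e ^ r dvd a * b}"
      using power_dvd_coprime_mult[OF cop r] by (auto simp: power_mult_distrib mult_dvd_mono image_iff)
  qed
  have "power_divisor_sum r \<phi> (a * b)
      = (\<Sum>(x, y)\<in>{e. e ^ r dvd a} \<times> {e. e ^ r dvd b}. \<phi> (a * b div (x * y) ^ r))"
    unfolding power_divisor_sum_def by (subst sum.reindex_bij_betw[OF bij, symmetric]) (simp add: case_prod_beta)
  also have "\<dots> = (\<Sum>(x, y)\<in>{e. e ^ r dvd a} \<times> {e. e ^ r dvd b}. \<phi> (a div x ^ r) * \<phi> (b div y ^ r))"
  proof (intro sum.cong refl, clarsimp)
    fix x y assume xy: "x ^ r dvd a" "y ^ r dvd b"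
    then obtain u v where uv: "a = x ^ r * u" "b = y ^ r * v" by (auto elim!: dvdE)
    have nz: "x ^ r > 0" "y ^ r > 0" "u > 0" "v > 0" using uv pos by auto
    have "coprime u v" using cop uv by (simp add: coprime_commute)
    moreover have "a * b div (x * y) ^ r = u * v"
    proof -
      have "a * b = (x * y) ^ r * (u * v)" by (simp add: uv power_mult_distrib mult_ac)
      moreover have "(x * y) ^ r \<noteq> 0" using nz by (simp add: power_mult_distrib)
      ultimately show ?thesis by (metis nonzero_mult_div_cancel_left)
    qed
    moreover have "a div x ^ r = u" "b div y ^ r = v" using nz uv by auto
    ultimately show "\<phi> (a * b div (x * y) ^ r) = \<phi> (a div x ^ r) * \<phi> (b div y ^ r)"
      using mult[of u v] nz by simp
  qed
  also have "\<dots> = power_divisor_sum r \<phi> a * power_divisor_sum r \<phi> b"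
    unfolding power_divisor_sum_def by (simp add: sum_product sum.cartesian_product)
  finally show ?thesis .
qed

lemma power_divisor_sum_prime_power:
  assumes p: "prime p" and r: "r > 0"
  shows "power_divisor_sum r \<phi> (p ^ j) = (\<Sum>i\<in>{i. r * i \<le> j}. \<phi> (p ^ (j - r * i)))"
proof -
  have p1: "p > 1" using p by (rule prime_gt_1_nat)
  have "{e. e ^ r dvd p ^ j} = (\<lambda>i. p ^ i) ` {i. r * i \<le> j}"
  proof (intro Set.set_eqI iffI)
    fix e assume "e \<in> {e. e ^ r dvd p ^ j}"
    then have d: "e ^ r dvd p ^ j" by simp
    then have "e dvd p ^ j" using r by (metis dvd_power dvd_trans)
    then obtain i where i: "e = p ^ i" using p divides_primepow_nat by blast
    have "p ^ (r * i) dvd p ^ j" using d unfolding i by (simp add: mult.commute flip: power_mult)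
    then have "r * i \<le> j" using p1 power_dvd_imp_le by blast
    then show "e \<in> (\<lambda>i. p ^ i) ` {i. r * i \<le> j}" using i by blast
  next
    fix e assume "e \<in> (\<lambda>i. p ^ i) ` {i. r * i \<le> j}"
    then obtain i where "e = p ^ i" "r * i \<le> j" by blast
    then show "e \<in> {e. e ^ r dvd p ^ j}" by (simp add: le_imp_power_dvd mult.commute flip: power_mult)
  qed
  moreover have "inj_on (\<lambda>i. p ^ i) {i. r * i \<le> j}" using p1 by (auto intro!: inj_onI dest: power_inject_exp[THEN iffD1, rotated])
  ultimately have "power_divisor_sum r \<phi> (p ^ j) = (\<Sum>i\<in>{i. r * i \<le> j}. \<phi> (p ^ j div (p ^ i) ^ r))"
    unfolding power_divisor_sum_def by (simp add: sum.reindex)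
  also have "\<dots> = (\<Sum>i\<in>{i. r * i \<le> j}. \<phi> (p ^ (j - r * i)))"
    using p1 by (intro sum.cong refl) (simp add: mult.commute power_diff flip: power_mult)
  finally show ?thesis .
qed

lemma multiplicative_eqI:
  fixes f h :: "nat \<Rightarrow> int"
  assumes f: "\<And>x y. coprime x y \<Longrightarrow> x > 0 \<Longrightarrow> y > 0 \<Longrightarrow> f (x * y) = f x * f y"
    and h: "\<And>x y. coprime x y \<Longrightarrow> x > 0 \<Longrightarrow> y > 0 \<Longrightarrow> h (x * y) = h x * h y"
    and pp: "\<And>p j. prime p \<Longrightarrow> f (p ^ j) = h (p ^ j)"
    and n: "n > 0"
  shows "f n = h n"
  using n
proof (induction n rule: less_induct)
  case (less n)
  show ?case
  proof (cases "n = 1")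
    case True
    then show ?thesis using pp[OF two_is_prime_nat, of 0] by simp
  next
    case False
    then obtain p where p: "prime p" "p dvd n" using prime_factor_nat by blast
    obtain y where y: "n = p ^ multiplicity p n * y" "\<not> p dvd y"
      using multiplicity_decompose'[of n p] less.prems p(1) by (metis not_prime_unit less_not_refl)
    have "multiplicity p n > 0" using p less.prems by (simp add: prime_multiplicity_gt_zero_iff)
    then have "p ^ multiplicity p n > 1" by (rule one_less_power[OF prime_gt_1_nat[OF p(1)]])
    moreover have y0: "y > 0" using y less.prems by (auto intro: Nat.gr0I)
    ultimately have "y < n" using y(1) by (metis mult.commute mult_less_cancel1 nat_mult_1_right)
    have cop: "coprime (p ^ multiplicity p n) y" using p(1) y(2) by (simp add: prime_imp_coprime)
    have ppos: "p ^ multiplicity p n > 0" using p(1) by (simp add: prime_gt_0_nat)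
    have "f n = f (p ^ multiplicity p n) * f y" using f[OF cop ppos y0] y(1) by simp
    also have "\<dots> = h (p ^ multiplicity p n) * h y" using pp[OF p(1)] less.IH[OF \<open>y < n\<close> y0] by simp
    also have "\<dots> = h n" using h[OF cop ppos y0] y(1) by simp
    finally show ?thesis .
  qed
qed

text \<open>In generating functions: the series of \<phi> is (1 + T) / (1 - x T), and dividing it by
  1 - T^2 leaves 1 / ((1 - T) (1 - x T)), the Euler factor of zeta times the L-function. Division by
  1 - T^2 explains the induction in steps of two.\<close>

lemma alternating_power_sum:
  fixes x :: int and \<phi> :: "nat \<Rightarrow> int"
  assumes "\<phi> 0 = 1" "\<And>l. \<phi> (Suc l) = x ^ Suc l + x ^ l"
  shows "(\<Sum>i\<in>{i. 2 * i \<le> j}. \<phi> (j - 2 * i)) = (\<Sum>i\<in>{i. 1 * i \<le> j}. x ^ (j - 1 * i))"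
proof (induction j rule: induct_nat_012)
  case 1
  have "{i. 2 * i \<le> Suc 0} = {0}" "{i. i \<le> Suc 0} = {0, 1}" by auto
  then show ?case using assms(2)[of 0] by simp
next
  case (ge2 j)
  have s: "{i. 2 * i \<le> Suc (Suc j)} = insert 0 (Suc ` {i. 2 * i \<le> j})"
    "{i. 1 * i \<le> Suc (Suc j)} = insert 0 (insert 1 ((\<lambda>i. Suc (Suc i)) ` {i. 1 * i \<le> j}))"
  proof -
    show "{i. 2 * i \<le> Suc (Suc j)} = insert 0 (Suc ` {i. 2 * i \<le> j})"
    proof (intro Set.set_eqI)
      show "i \<in> {i. 2 * i \<le> Suc (Suc j)} \<longleftrightarrow> i \<in> insert 0 (Suc ` {i. 2 * i \<le> j})" for i by (cases i) auto
    qed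
    show "{i. 1 * i \<le> Suc (Suc j)} = insert 0 (insert 1 ((\<lambda>i. Suc (Suc i)) ` {i. 1 * i \<le> j}))"
    proof (intro Set.set_eqI)
      show "i \<in> {i. 1 * i \<le> Suc (Suc j)} \<longleftrightarrow> i \<in> insert 0 (insert 1 ((\<lambda>i. Suc (Suc i)) ` {i. 1 * i \<le> j}))" for i
      proof (cases i)
        case (Suc i') then show ?thesis by (cases i') auto
      qed simp
    qed
  qed
  have fin: "finite {i. 2 * i \<le> j}" "finite {i. 1 * i \<le> j}"
    by (rule finite_subset[of _ "{..j}"]; auto)+
  have "(\<Sum>i\<in>{i. 2 * i \<le> Suc (Suc j)}. \<phi> (Suc (Suc j) - 2 * i)) = \<phi> (Suc (Suc j)) + (\<Sum>i\<in>{i. 2 * i \<le> j}. \<phi> (j - 2 * i))"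
    unfolding s using fin by (subst sum.insert) (auto simp: sum.reindex)
  moreover have "(\<Sum>i\<in>{i. 1 * i \<le> Suc (Suc j)}. x ^ (Suc (Suc j) - 1 * i))
     = x ^ Suc (Suc j) + (x ^ Suc j + (\<Sum>i\<in>{i. 1 * i \<le> j}. x ^ (j - 1 * i)))"
    unfolding s using fin by (subst sum.insert, force, force, subst sum.insert) (auto simp: sum.reindex inj_on_def)
  ultimately show ?case using ge2.IH(1) assms(2)[of "Suc j"] by simp
qed (use assms(1) in simp)

context odd_real_primitive_character
begin

section \<open>Roots of the norm polynomial modulo a\<close>

definition norm_omega :: int where "norm_omega = (int k + 1) div 4"

lemma four_norm_omega: "4 * norm_omega = int k + 1"
proof -
  have "k mod 4 = 3" using k_mod_8 by presburger
  then have "(int k + 1) mod 4 = 0" by presburger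
  then show ?thesis unfolding norm_omega_def by presburger
qed

text \<open>The norm of b + \<omega> for \<omega> = (1 + sqrt(-k)) / 2; \<open>norm_omega\<close> is
  the norm of \<omega>, an integer because k = 3 modulo 4.\<close>

definition norm_poly :: "int \<Rightarrow> int" where "norm_poly b = b\<^sup>2 + b + norm_omega"

lemma four_norm_poly: "4 * norm_poly b = (2 * b + 1)\<^sup>2 + int k"
  using four_norm_omega by (simp add: norm_poly_def power2_eq_square algebra_simps)

lemma norm_poly_diff: "norm_poly b - norm_poly b' = (b - b') * (b + b' + 1)"
  by (simp add: norm_poly_def power2_eq_square algebra_simps)

lemma norm_poly_pos: "norm_poly b > 0"
proof -
  have "4 * norm_poly b > 0" unfolding four_norm_poly using k_pos by (intro add_nonneg_pos) auto
  then show ?thesis by simp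
qed

lemma norm_poly_cong: "[b = b'] (mod a) \<Longrightarrow> a dvd norm_poly b \<longleftrightarrow> a dvd norm_poly b'"
proof -
  assume "[b = b'] (mod a)"
  then have "a dvd norm_poly b - norm_poly b'" unfolding norm_poly_diff cong_iff_dvd_diff by simp
  then show ?thesis by (metis dvd_add_right_iff add_diff_cancel_left' diff_add_cancel dvd_diff)
qed

text \<open>A root b corresponds to the ideal of norm a spanned by a and b + \<omega>, that is, to
  an ideal divisible by no rational integer beyond units.\<close>

definition roots :: "nat \<Rightarrow> int set" where
  "roots a = {b \<in> {0..<int a}. int a dvd norm_poly b}"

definition rho :: "nat \<Rightarrow> int" where "rho a = int (card (roots a))"

lemma finite_roots [simp]: "finite (roots a)"
  by (rule finite_subset[of _ "{0..<int a}"]) (auto simp: roots_def)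

lemma rho_mult:
  assumes cop: "coprime a b" and pos: "a > 0" "b > 0"
  shows "rho (a * b) = rho a * rho b"
proof -
  have copi: "coprime (int a) (int b)" using cop by simp
  have "bij_betw (\<lambda>x. (x mod int a, x mod int b)) (roots (a * b)) (roots a \<times> roots b)"
    unfolding bij_betw_def
  proof
    show "inj_on (\<lambda>x. (x mod int a, x mod int b)) (roots (a * b))"
    proof (rule inj_onI)
      fix x y assume xy: "x \<in> roots (a * b)" "y \<in> roots (a * b)" "(x mod int a, x mod int b) = (y mod int a, y mod int b)"
      then have "[x = y] (mod int a)" "[x = y] (mod int b)" by (simp_all add: cong_def)
      then have "[x = y] (mod int a * int b)" using copi coprime_cong_mult by blast
      with xy(1,2) show "x = y" by (auto simp: roots_def cong_def)
    qed
    show "(\<lambda>x. (x mod int a, x mod int b)) ` roots (a * b) = roots a \<times> roots b"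
    proof (intro Set.set_eqI iffI)
      fix z assume "z \<in> (\<lambda>x. (x mod int a, x mod int b)) ` roots (a * b)"
      then obtain x where x: "z = (x mod int a, x mod int b)" "int a * int b dvd norm_poly x" by (auto simp: roots_def)
      have "int a dvd norm_poly x" "int b dvd norm_poly x" using x(2) by (auto dest: dvd_mult_left dvd_mult_right)
      then show "z \<in> roots a \<times> roots b"
        using pos norm_poly_cong[of "x mod int a" x "int a"] norm_poly_cong[of "x mod int b" x "int b"]
        by (simp add: x(1) roots_def)
    next
      fix z assume "z \<in> roots a \<times> roots b"
      then obtain u v where z: "z = (u, v)" "u \<in> roots a" "v \<in> roots b" by auto
      obtain x where x: "[x = u] (mod int a)" "[x = v] (mod int b)" using binary_chinese_remainder_int[OF copi] by blast
      define y where "y = x mod (int a * int b)"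
      have y: "[y = u] (mod int a)" "[y = v] (mod int b)"
        using x by (simp_all add: y_def cong_def mod_mod_cancel)
      then have "int a dvd norm_poly y" "int b dvd norm_poly y"
        using z(2,3) norm_poly_cong by (auto simp: roots_def)
      then have "int a * int b dvd norm_poly y" using copi by (intro divides_mult)
      then have "y \<in> roots (a * b)" using pos by (simp add: roots_def y_def)
      moreover have "y mod int a = u" "y mod int b = v" using y z(2,3) by (auto simp: cong_def roots_def)
      ultimately show "z \<in> (\<lambda>x. (x mod int a, x mod int b)) ` roots (a * b)" unfolding z(1) by force
    qed
  qed
  from bij_betw_same_card[OF this] show ?thesis by (simp add: rho_def card_cartesian_product)
qed

lemma rho_1: "rho 1 = 1"
proof -
  have "roots 1 = {0}" by (auto simp: roots_def)
  then show ?thesis by (simp add: rho_def)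
qed

lemma rho_2: "rho 2 = 1 + c 2"
proof -
  have r: "roots 2 = (if even norm_omega then {0, 1} else {})"
    by (auto simp: roots_def norm_poly_def)
  have "even norm_omega \<longleftrightarrow> k mod 8 = 7" using four_norm_omega k_mod_8 by presburger
  then show ?thesis using r c_2 k_mod_8 by (auto simp: rho_def)
qed

text \<open>Completing the square turns roots into square roots of -k modulo p. They come in pairs
  b, p - 1 - b, which coincide exactly when p divides k; the two Euler criteria identify the
  Legendre symbol that decides existence with c(p).\<close>

lemma rho_odd_prime:
  assumes p: "prime p" "odd p"
  shows "rho p = 1 + c (int p)"
proof -
  have p2: "p > 2" using p prime_gt_1_nat[OF p(1)] by (cases "p = 2") auto
  have pp: "prime (int p)" using p by simp
  have 1: "[Legendre (- int k) (int p) = (- int k) ^ ((p - 1) div 2)] (mod int p)"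
    by (rule euler_criterion[OF p(1) p2])
  have 2: "[(- int k) ^ ((p - 1) div 2) = c (int p)] (mod int p)"
    using euler_criterion_character[OF p] by (simp add: cong_iff_dvd_diff)
  have "int p dvd Legendre (- int k) (int p) - c (int p)"
    using cong_trans[OF 1 2] by (simp only: cong_iff_dvd_diff)
  then have leg: "Legendre (- int k) (int p) = c (int p)"
    using c_values p2 by (intro cong_small_imp_eq) (auto simp: Legendre_def)
  have cop2: "coprime (int p) 2" using p(2) by simp
  have "coprime (int p) (2 * 2)" using cop2 by (simp only: coprime_mult_right_iff)
  then have cop4: "coprime (int p) 4" by simp
  have root_iff: "int p dvd norm_poly b \<longleftrightarrow> [(2 * b + 1)\<^sup>2 = - int k] (mod int p)" for b
  proof -
    have "int p dvd norm_poly b \<longleftrightarrow> int p dvd 4 * norm_poly b" using cop4 by (simp add: coprime_dvd_mult_right_iff)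
    then show ?thesis by (simp add: four_norm_poly cong_iff_dvd_diff)
  qed
  have roots_eq: "roots p = {b, int p - 1 - b}" if b: "b \<in> roots p" for b
  proof (intro Set.set_eqI iffI)
    fix x assume x: "x \<in> roots p"
    have "int p dvd norm_poly x - norm_poly b" using x b by (auto simp: roots_def)
    then have "int p dvd x - b \<or> int p dvd x + b + 1"
      unfolding norm_poly_diff using pp prime_dvd_mult_iff by blast
    then show "x \<in> {b, int p - 1 - b}"
    proof
      assume "int p dvd x - b"
      then have "[x = b] (mod int p)" by (simp add: cong_iff_dvd_diff)
      then show ?thesis using x b by (auto simp: roots_def cong_def)
    next
      assume "int p dvd x + b + 1"
      then have "[x = int p - 1 - b] (mod int p)" by (simp add: cong_iff_dvd_diff algebra_simps)
      then show ?thesis using x b by (auto simp: roots_def cong_def)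
    qed
  next
    fix x assume "x \<in> {b, int p - 1 - b}"
    moreover have "norm_poly (int p - 1 - b) - norm_poly b = (int p - 1 - 2 * b) * int p"
      unfolding norm_poly_diff by (simp add: algebra_simps)
    then have "int p dvd norm_poly (int p - 1 - b)"
      using b unfolding roots_def by (metis (no_types, lifting) diff_add_cancel dvd_add dvd_triv_right mem_Collect_eq)
    ultimately show "x \<in> roots p" using b by (auto simp: roots_def)
  qed
  have double: "b = int p - 1 - b \<longleftrightarrow> int p dvd int k" if b: "b \<in> roots p" for b
  proof
    assume "b = int p - 1 - b"
    then have "2 * b + 1 = int p" by simp
    then have "4 * norm_poly b = (int p)\<^sup>2 + int k" using four_norm_poly by simp
    moreover have "int p dvd 4 * norm_poly b" using b by (simp add: roots_def)
    ultimately show "int p dvd int k" by (simp add: dvd_add_right_iff power2_eq_square)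
  next
    assume "int p dvd int k"
    moreover have "int p dvd 4 * norm_poly b" using b by (simp add: roots_def)
    ultimately have "int p dvd (2 * b + 1)\<^sup>2" unfolding four_norm_poly by (simp add: dvd_add_left_iff)
    then have "int p dvd 2 * b + 1" using pp prime_dvd_power by blast
    then obtain t where t: "2 * b + 1 = int p * t" by (elim dvdE)
    have "0 < int p * t" "int p * t < int p * 2" using b unfolding t[symmetric] by (auto simp: roots_def)
    then have "t = 1" using p2 by (simp add: zero_less_mult_iff)
    then show "b = int p - 1 - b" using t by simp
  qed
  have c0: "c (int p) = 0 \<longleftrightarrow> int p dvd int k"
    using c_eq_0_iff[of "int p"] pp by (metis coprime_commute not_prime_unit prime_imp_coprime coprime_absorb_left)
  have ex: "roots p \<noteq> {} \<longleftrightarrow> c (int p) \<noteq> -1"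
  proof
    assume "roots p \<noteq> {}"
    then obtain b where "b \<in> roots p" by blast
    then have "[(2 * b + 1)\<^sup>2 = - int k] (mod int p)" using root_iff by (simp add: roots_def)
    then have "QuadRes (int p) (- int k)" by (auto simp: QuadRes_def)
    then have "Legendre (- int k) (int p) \<noteq> -1" by (simp add: Legendre_def)
    then show "c (int p) \<noteq> -1" using leg by simp
  next
    assume c: "c (int p) \<noteq> -1"
    have "\<exists>y. [y\<^sup>2 = - int k] (mod int p)"
    proof (cases "[- int k = 0] (mod int p)")
      case True
      then show ?thesis by (intro exI[of _ 0]) (simp add: cong_sym)
    next
      case False
      then show ?thesis using c leg by (auto simp: Legendre_def QuadRes_def split: if_splits)
    qed
    then obtain y where y: "[y\<^sup>2 = - int k] (mod int p)" by blast
    obtain x where x: "[2 * x = y - 1] (mod int p)"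
      using cong_solve_coprime_int[of 2 "int p"] cop2 by (metis coprime_commute cong_scalar_right mult.assoc mult_1)
    define b where "b = x mod int p"
    have "[2 * b = 2 * x] (mod int p)" by (simp add: b_def cong_def mod_simps)
    with x have "[2 * b = y - 1] (mod int p)" using cong_trans by blast
    then have "[2 * b + 1 = y - 1 + 1] (mod int p)" by (intro cong_add) simp_all
    then have "[(2 * b + 1)\<^sup>2 = y\<^sup>2] (mod int p)" using cong_pow[of "2 * b + 1" y "int p" 2] by simp
    then have "int p dvd norm_poly b" using y root_iff cong_trans by blast
    then have "b \<in> roots p" using p2 by (simp add: roots_def b_def)
    then show "roots p \<noteq> {}" by blast
  qed
  show ?thesis
  proof (cases "roots p = {}")
    case True
    then show ?thesis using ex by (simp add: rho_def)
  next
    case False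
    then obtain b where b: "b \<in> roots p" by blast
    have "int (card {b, b'}) = (if b = b' then 1 else 2)" for b' by simp
    then have card: "rho p = (if b = int p - 1 - b then 1 else 2)" unfolding rho_def roots_eq[OF b] .
    show ?thesis
    proof (cases "c (int p) = 0")
      case True then show ?thesis using card double[OF b] c0 by simp
    next
      case False
      then have "c (int p) = 1" using ex \<open>roots p \<noteq> {}\<close> c_values[of "int p"] by blast
      then show ?thesis using False card double[OF b] c0 by auto
    qed
  qed
qed

lemma prime_dvd_k_iff: "prime p \<Longrightarrow> c (int p) = 0 \<longleftrightarrow> p dvd k"
proof -
  assume p: "prime p"
  then have "coprime p k \<longleftrightarrow> \<not> p dvd k" by (metis coprime_absorb_left not_prime_unit prime_imp_coprime)
  then show ?thesis using c_eq_0_iff[of "int p"] by simp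
qed

text \<open>Hensel lifting: \<open>4 norm_poly b - (2 b + 1)\<^sup>2 = k\<close>, so roots modulo \<open>p\<close> are simple unless \<open>p\<close> divides \<open>k\<close>.\<close>

lemma rho_lift:
  assumes p: "prime p" "\<not> p dvd k" and j: "j > 0"
  shows "rho (p ^ Suc j) = rho (p ^ j)"
proof -
  have pp: "prime (int p)" using p(1) by simp
  have p0: "int p > 0" using p(1) by (simp add: prime_gt_0_nat)
  have unit: "coprime (int p) (2 * b + 1)" if "int p dvd norm_poly b" for b
  proof (rule prime_imp_coprime[OF pp], rule notI)
    assume "int p dvd 2 * b + 1"
    then have "int p dvd (2 * b + 1)\<^sup>2" by (simp add: power2_eq_square)
    moreover have "int p dvd (2 * b + 1)\<^sup>2 + int k" unfolding four_norm_poly[symmetric] using that by simp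
    ultimately show False using p(2) by (simp add: dvd_add_right_iff)
  qed
  have pj: "int p dvd int p ^ j" using j by simp
  have "bij_betw (\<lambda>b. b mod int p ^ j) (roots (p ^ Suc j)) (roots (p ^ j))"
    unfolding bij_betw_def
  proof
    show "inj_on (\<lambda>b. b mod int p ^ j) (roots (p ^ Suc j))"
    proof (rule inj_onI)
      fix x y assume x: "x \<in> roots (p ^ Suc j)" and y: "y \<in> roots (p ^ Suc j)" and "x mod int p ^ j = y mod int p ^ j"
      then have "int p ^ j dvd x - y" by (simp add: mod_eq_dvd_iff)
      then have "int p dvd x - y" using pj dvd_trans by blast
      have "int p ^ Suc j dvd norm_poly x - norm_poly y" using x y by (simp add: roots_def)
      then have d: "int p ^ Suc j dvd (x - y) * (x + y + 1)" by (simp only: norm_poly_diff)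
      have "int p dvd norm_poly x" using x by (auto simp: roots_def dest: dvd_mult_left)
      from unit[OF this] have cop: "coprime (int p) (2 * x + 1)" .
      have "coprime (int p) (x + y + 1)"
      proof (rule prime_imp_coprime[OF pp], rule notI)
        assume "int p dvd x + y + 1"
        then have "int p dvd (x + y + 1) + (x - y)" using \<open>int p dvd x - y\<close> by (rule dvd_add)
        then have "int p dvd 2 * x + 1" by (simp add: algebra_simps)
        then show False using cop pp by (metis coprime_absorb_left not_prime_unit)
      qed
      then have "coprime (int p ^ Suc j) (x + y + 1)" by (simp only: coprime_power_left_iff) simp
      then have "int p ^ Suc j dvd x - y" using d by (simp only: coprime_dvd_mult_left_iff)
      then have "[x = y] (mod int p ^ Suc j)" by (simp add: cong_iff_dvd_diff)
      then show "x = y" using x y by (simp add: roots_def cong_def)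
    qed
    show "(\<lambda>b. b mod int p ^ j) ` roots (p ^ Suc j) = roots (p ^ j)"
    proof (intro subset_antisym subsetI)
      fix z assume "z \<in> (\<lambda>b. b mod int p ^ j) ` roots (p ^ Suc j)"
      then obtain x where x: "z = x mod int p ^ j" "int p * int p ^ j dvd norm_poly x" by (auto simp: roots_def)
      then have "int p ^ j dvd norm_poly x" by (auto dest: dvd_mult_right)
      then have "int p ^ j dvd norm_poly z" using norm_poly_cong[of z x "int p ^ j"] by (simp add: x(1) cong_def)
      then show "z \<in> roots (p ^ j)" using p0 by (simp add: roots_def x(1))
    next
      fix b assume b: "b \<in> roots (p ^ j)"
      then obtain s where s: "norm_poly b = int p ^ j * s" by (auto simp: roots_def elim: dvdE)
      have "int p dvd norm_poly b" unfolding s using pj by simp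
      from unit[OF this] have "coprime (2 * b + 1) (int p)" by (simp add: coprime_commute)
      then obtain v where v: "[(2 * b + 1) * v = 1] (mod int p)" using cong_solve_coprime_int by blast
      \<comment> \<open>The Newton correction: \<open>v\<close> inverts the derivative 2 b + 1 of
        \<open>norm_poly\<close> modulo p.\<close>
      define t where "t = - s * v"
      define x where "x = b + int p ^ j * t"
      have "norm_poly x - norm_poly b = int p ^ j * t * (2 * b + 1 + int p ^ j * t)"
        unfolding norm_poly_diff x_def by (simp add: algebra_simps)
      then have "norm_poly x = int p ^ j * (s - s * ((2 * b + 1) * v) + int p ^ j * t * t)"
        unfolding s t_def by (simp add: algebra_simps)
      moreover have "int p dvd s - s * ((2 * b + 1) * v) + int p ^ j * t * t"
      proof (rule dvd_add)
        have "int p dvd s * (1 - (2 * b + 1) * v)"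
          using cong_sym[OF v] by (simp add: cong_iff_dvd_diff)
        then show "int p dvd s - s * ((2 * b + 1) * v)" by (simp only: right_diff_distrib mult_1_right)
        show "int p dvd int p ^ j * t * t" using pj by simp
      qed
      ultimately have "int p ^ j * int p dvd norm_poly x" by (simp only: mult_dvd_mono dvd_refl)
      then have xr: "int p ^ Suc j dvd norm_poly x" by (simp add: mult.commute)
      define y where "y = x mod int p ^ Suc j"
      have "int p ^ Suc j dvd norm_poly y" using xr norm_poly_cong[of y x "int p ^ Suc j"] by (simp add: y_def cong_def)
      then have "y \<in> roots (p ^ Suc j)" using p0 unfolding roots_def y_def by simp
      moreover have "y mod int p ^ j = b"
      proof -
        have "y mod int p ^ j = x mod int p ^ j" unfolding y_def by (rule mod_mod_cancel) simp
        also have "\<dots> = b" using b by (simp add: x_def roots_def)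
        finally show ?thesis .
      qed
      ultimately show "b \<in> (\<lambda>b. b mod int p ^ j) ` roots (p ^ Suc j)" by force
    qed
  qed
  from bij_betw_same_card[OF this] show ?thesis by (simp add: rho_def)
qed

text \<open>At a prime p dividing k, a root modulo p^2 makes p divide 2 b + 1, so p^2 divides both
  (2 b + 1)^2 and 4 \<open>norm_poly b\<close>, hence k, which is squarefree.\<close>

lemma rho_ramified:
  assumes p: "prime p" "p dvd k"
  shows "rho (p ^ Suc (Suc j)) = 0"
proof -
  have "\<not> int p ^ Suc (Suc j) dvd norm_poly b" for b
  proof
    assume "int p ^ Suc (Suc j) dvd norm_poly b"
    then have p2: "(int p)\<^sup>2 dvd norm_poly b"
      by (metis dvd_trans le_imp_power_dvd numeral_2_eq_2 Suc_le_mono zero_le)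
    have "int p dvd norm_poly b" using p2 by (auto simp: power2_eq_square dest: dvd_mult_left)
    then have "int p dvd 4 * norm_poly b" by simp
    then have "int p dvd (2 * b + 1)\<^sup>2" using p(2) unfolding four_norm_poly by (simp add: dvd_add_left_iff)
    then have "int p dvd 2 * b + 1" using p(1) prime_dvd_power by (metis prime_nat_int_transfer)
    then have "(int p)\<^sup>2 dvd (2 * b + 1)\<^sup>2" by (rule dvd_power_same)
    moreover have "(int p)\<^sup>2 dvd (2 * b + 1)\<^sup>2 + int k" using p2 unfolding four_norm_poly[symmetric] by simp
    ultimately have "(int p)\<^sup>2 dvd int k" by (simp add: dvd_add_right_iff)
    then have "int (p\<^sup>2) dvd int k" by simp
    then have "p\<^sup>2 dvd k" by (simp only: int_dvd_int_iff)
    with square_not_dvd_k[OF p(1)] show False by blast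
  qed
  then have "roots (p ^ Suc (Suc j)) = {}" by (auto simp: roots_def)
  then show ?thesis by (simp add: rho_def)
qed

lemma rho_prime:
  assumes "prime p" shows "rho p = 1 + c (int p)"
proof (cases "odd p")
  case False
  then have "p = 2" using assms primes_dvd_imp_eq two_is_prime_nat by blast
  then show ?thesis using rho_2 by simp
qed (use assms rho_odd_prime in blast)

text \<open>One expression for three cases: split (always 2), inert (always 0), and ramified (1 at
  the prime itself, 0 at higher powers), the last relying on 0 ^ 0 = 1.\<close>

lemma rho_prime_power:
  assumes p: "prime p"
  shows "rho (p ^ Suc l) = c (int p) ^ Suc l + c (int p) ^ l"
proof (cases "p dvd k")
  case True
  then have "c (int p) = 0" using prime_dvd_k_iff[OF p] by simp
  then show ?thesis using rho_prime[OF p] rho_ramified[OF p True] by (cases l) auto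
next
  case False
  then have c: "c (int p) = 1 \<or> c (int p) = -1" using prime_dvd_k_iff[OF p] c_values by blast
  have "rho (p ^ Suc l) = 1 + c (int p)"
  proof (induction l)
    case (Suc l)
    then show ?case using rho_lift[OF p False, of "Suc l"] by simp
  qed (use rho_prime[OF p] in simp)
  then show ?thesis using c by auto
qed

text \<open>The coefficientwise form of zeta_K = zeta L. Both sides are multiplicative, so only the
  Euler factors need comparing.\<close>

theorem ideal_count_identity:
  assumes "n > 0"
  shows "power_divisor_sum 2 rho n = power_divisor_sum 1 (\<lambda>d. c (int d)) n"
proof (rule multiplicative_eqI[OF _ _ _ assms])
  show "power_divisor_sum 2 rho (x * y) = power_divisor_sum 2 rho x * power_divisor_sum 2 rho y"
    if "coprime x y" "x > 0" "y > 0" for x y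
    by (rule power_divisor_sum_mult) (use that rho_mult in auto)
  show "power_divisor_sum 1 (\<lambda>d. c (int d)) (x * y) = power_divisor_sum 1 (\<lambda>d. c (int d)) x * power_divisor_sum 1 (\<lambda>d. c (int d)) y"
    if "coprime x y" "x > 0" "y > 0" for x y
    by (rule power_divisor_sum_mult) (use that c_mult in auto)
  fix p j :: nat assume p: "prime p"
  have r1: "rho (p ^ 0) = 1" using rho_1 by simp
  from alternating_power_sum[where \<phi> = "\<lambda>l. rho (p ^ l)", OF r1 rho_prime_power[OF p], of j]
  show "power_divisor_sum 2 rho (p ^ j) = power_divisor_sum 1 (\<lambda>d. c (int d)) (p ^ j)"
    unfolding power_divisor_sum_prime_power[OF p zero_less_numeral] power_divisor_sum_prime_power[OF p zero_less_one]
    by (simp add: c_power)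
qed

end

section \<open>The ring of integers\<close>

text \<open>For r = u / v in lowest terms every power of v divides D. If v were at least 2, then 2^D
  would be at most D.\<close>

lemma bounded_denominators_imp_int:
  fixes r :: real
  assumes r: "r \<in> \<rat>" and D: "D > 0" and int: "\<And>i. of_int D * r ^ i \<in> \<int>"
  shows "r \<in> \<int>"
proof -
  from r obtain u v where v: "v > 0" "coprime u v" "r = of_int u / of_int v" by (rule Rats_cases')
  have dvd: "v ^ i dvd D" for i
  proof -
    from int[of i] obtain t where t: "of_int D * r ^ i = real_of_int t" by (rule Ints_cases)
    then have "real_of_int D * of_int u ^ i = of_int t * of_int v ^ i"
      using v(1) by (simp add: v(3) power_divide field_simps)
    then have "real_of_int (D * u ^ i) = of_int (t * v ^ i)" by simp
    then have "D * u ^ i = t * v ^ i" by (simp only: of_int_eq_iff)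
    then have "v ^ i dvd D * u ^ i" by simp
    moreover have "coprime (v ^ i) (u ^ i)" using v(2) by (simp add: coprime_commute)
    ultimately show ?thesis by (simp add: coprime_dvd_mult_left_iff)
  qed
  have "v = 1"
  proof (rule ccontr)
    assume "v \<noteq> 1"
    then have "v \<ge> 2" using v(1) by simp
    then have "2 ^ nat D \<le> v ^ nat D" by (intro power_mono) auto
    also have "\<dots> \<le> D" using dvd D by (intro zdvd_imp_le)
    finally have "2 ^ nat D \<le> int (nat D)" using D by simp
    moreover have "int (nat D) < int (2 ^ nat D)" by (simp only: of_nat_less_iff less_exp)
    ultimately show False by simp
  qed
  then show ?thesis by (simp add: v(3))
qed

context odd_real_primitive_character
begin

definition root_disc :: complex where "root_disc = \<i> * of_real (sqrt (real k))"

lemma root_disc_square: "root_disc * root_disc = - of_nat k"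
  unfolding root_disc_def by (simp add: complex_eq_iff)

lemma csqrt_neg_k: "csqrt (of_int (- int k)) = root_disc"
  using csqrt_of_real_nonpos[of "of_int (- int k)"] by (simp add: root_disc_def)

lemma norm_root_disc: "(cmod (of_real x + of_real y * root_disc))\<^sup>2 = x\<^sup>2 + real k * y\<^sup>2"
  by (simp add: root_disc_def cmod_power2 power_mult_distrib)

text \<open>The powers of an algebraic integer have bounded denominators, hence so do the powers of its norm;
  no closure of the algebraic integers under sums or products is needed.\<close>

lemma algebraic_int_imp_norm_int:
  fixes A B d :: int
  assumes d: "d > 0" and z: "z = (of_int A + of_int B * root_disc) / of_int d" and alg: "algebraic_int z"
  shows "\<exists>N. A\<^sup>2 + int k * B\<^sup>2 = N * d\<^sup>2"
proof -
  define \<Lambda> where "\<Lambda> = {of_int x + of_int y * root_disc |x y. True}"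
  have LI: "of_int x + of_int y * root_disc \<in> \<Lambda>" for x y unfolding \<Lambda>_def by blast
  have add: "u + v \<in> \<Lambda>" if uv: "u \<in> \<Lambda>" "v \<in> \<Lambda>" for u v
  proof -
    obtain x y x' y' where "u = of_int x + of_int y * root_disc" "v = of_int x' + of_int y' * root_disc"
      using uv unfolding \<Lambda>_def by blast
    then have "u + v = of_int (x + x') + of_int (y + y') * root_disc" by (simp add: algebra_simps)
    then show ?thesis using LI by metis
  qed
  have mult: "u * v \<in> \<Lambda>" if uv: "u \<in> \<Lambda>" "v \<in> \<Lambda>" for u v
  proof -
    obtain x y x' y' where "u = of_int x + of_int y * root_disc" "v = of_int x' + of_int y' * root_disc"
      using uv unfolding \<Lambda>_def by blast
    then have "u * v = of_int x * of_int x' + (of_int x * of_int y' + of_int y * of_int x') * root_disc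
        + of_int y * of_int y' * (root_disc * root_disc)"
      by (simp add: algebra_simps)
    also have "\<dots> = of_int (x * x' - int k * y * y') + of_int (x * y' + y * x') * root_disc"
      unfolding root_disc_square by (simp add: algebra_simps)
    finally show ?thesis using LI by metis
  qed
  have int: "of_int x \<in> \<Lambda>" for x using LI[of x 0] by simp
  have pow: "u ^ i \<in> \<Lambda>" if u: "u \<in> \<Lambda>" for u i by (induction i) (use int[of 1] mult[OF u] in auto)
  have sum: "sum f S \<in> \<Lambda>" if "\<And>s. s \<in> S \<Longrightarrow> f s \<in> \<Lambda>" for f :: "nat \<Rightarrow> complex" and S
    using that by (induction S rule: infinite_finite_induct) (use int[of 0] add in auto)
  have dz: "of_int d * z \<in> \<Lambda>" using d LI by (simp add: z)
  from alg obtain p where p: "poly (map_poly of_int p) z = 0" "lead_coeff p = 1"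
    by (auto simp: algebraic_int_altdef_ipoly)
  define n where "n = Polynomial.degree p"
  have "(\<Sum>j\<le>n. of_int (coeff p j) * z ^ j) = 0"
    using p(1) ipoly_altdef[of p z] by (simp add: ipoly_def n_def)
  then have zn: "z ^ n = (\<Sum>j<n. of_int (- coeff p j) * z ^ j)"
    using p(2) unfolding n_def[symmetric] by (simp add: lessThan_Suc_atMost[symmetric] sum_negf add_eq_0_iff)
  \<comment> \<open>The single factor \<open>d ^ n\<close> clears the denominators of all powers of
    z: directly for exponents below n, and through the monic equation from n on.\<close>
  have main: "of_int d ^ n * z ^ i \<in> \<Lambda>" for i
  proof (induction i rule: less_induct)
    case (less i)
    show ?case
    proof (cases "i < n")
      case True
      then have "of_int d ^ n * z ^ i = of_int (d ^ (n - i)) * (of_int d * z) ^ i"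
        by (simp add: power_mult_distrib flip: power_add mult.assoc)
      then show ?thesis using mult int pow[OF dz] by metis
    next
      case False
      have "of_int d ^ n * z ^ i = (\<Sum>j<n. of_int (- coeff p j) * (of_int d ^ n * z ^ (i - n + j)))"
      proof -
        have "z ^ i = z ^ (i - n) * z ^ n" using False by (simp flip: power_add)
        then show ?thesis by (simp only: zn sum_distrib_left power_add mult_ac)
      qed
      also have "\<dots> \<in> \<Lambda>" using False by (intro sum mult int less.IH) auto
      finally show ?thesis .
    qed
  qed
  define r where "r = (cmod z)\<^sup>2"
  have r: "r = of_int (A\<^sup>2 + int k * B\<^sup>2) / of_int (d\<^sup>2)"
    using norm_root_disc[of "of_int A" "of_int B"] by (simp add: r_def z norm_divide power_divide)
  have "r \<in> \<int>"
  proof (rule bounded_denominators_imp_int)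
    show "r \<in> \<rat>" unfolding r by (intro Rats_divide Rats_of_int)
    show "(d ^ n)\<^sup>2 > 0" using d by simp
    fix i
    obtain x y where xy: "of_int d ^ n * z ^ i = of_int x + of_int y * root_disc" using main[of i] unfolding \<Lambda>_def by blast
    have "real_of_int ((d ^ n)\<^sup>2) * r ^ i = (cmod (of_int d ^ n * z ^ i))\<^sup>2"
      using d by (simp add: r_def norm_mult norm_power power_mult_distrib mult.commute flip: power_mult)
    also have "\<dots> = of_int (x\<^sup>2 + int k * y\<^sup>2)"
      unfolding xy using norm_root_disc[of "of_int x" "of_int y"] by simp
    finally show "real_of_int ((d ^ n)\<^sup>2) * r ^ i \<in> \<int>" by simp
  qed
  then obtain N where "r = of_int N" by (rule Ints_cases)
  then have "real_of_int (A\<^sup>2 + int k * B\<^sup>2) = of_int (N * d\<^sup>2)" using r d by (simp add: field_simps)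
  then show ?thesis by (intro exI[of _ N]) (simp only: of_int_eq_iff)
qed

definition \<omega> :: complex where "\<omega> = (1 + root_disc) / 2"

definition el :: "int \<Rightarrow> int \<Rightarrow> complex" where "el x y = of_int x + of_int y * \<omega>"

lemma omega_square: "\<omega> * \<omega> = \<omega> - of_int norm_omega"
proof -
  have "complex_of_int (4 * norm_omega) = of_int (int k + 1)" by (simp only: four_norm_omega)
  then have "4 * (complex_of_int norm_omega) = of_nat k + 1" by simp
  then have m: "complex_of_int norm_omega = (of_nat k + 1) / 4" by (simp add: eq_divide_eq mult.commute)
  have "4 * (\<omega> * \<omega>) = 1 + 2 * root_disc + root_disc * root_disc"
    by (simp add: \<omega>_def field_simps)
  also have "\<dots> = 4 * (\<omega> - of_int norm_omega)"
    unfolding root_disc_square m by (simp add: \<omega>_def field_simps)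
  finally show ?thesis by (metis mult_cancel_left zero_neq_numeral)
qed

lemma el_add: "el x y + el x' y' = el (x + x') (y + y')"
  by (simp add: el_def algebra_simps)

lemma el_minus: "- el x y = el (- x) (- y)"
  by (simp add: el_def)

lemma el_mult: "el x y * el x' y' = el (x * x' - norm_omega * y * y') (x * y' + y * x' + y * y')"
proof -
  have "el x y * el x' y' = of_int x * of_int x' + (of_int x * of_int y' + of_int y * of_int x') * \<omega>
      + of_int y * of_int y' * (\<omega> * \<omega>)"
    by (simp add: el_def algebra_simps)
  then show ?thesis unfolding omega_square by (simp add: el_def algebra_simps)
qed

lemma el_of_int: "of_int x = el x 0" by (simp add: el_def)

lemma Re_el: "Re (el x y) = of_int x + of_int y / 2" and Im_el: "Im (el x y) = of_int y * sqrt (real k) / 2"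
  by (simp_all add: el_def \<omega>_def root_disc_def)

lemma el_eq_iff: "el x y = el x' y' \<longleftrightarrow> x = x' \<and> y = y'"
  using k_pos by (auto simp: complex_eq_iff Re_el Im_el)

lemma el_eq_0_iff: "el x y = 0 \<longleftrightarrow> x = 0 \<and> y = 0"
  using el_eq_iff[of x y 0 0] by (simp add: el_def)

lemma norm_el: "(cmod (el x y))\<^sup>2 = of_int (x\<^sup>2 + x * y + norm_omega * y\<^sup>2)"
proof -
  have "real_of_int (4 * norm_omega) = of_int (int k + 1)" by (simp only: four_norm_omega)
  then have kr: "real k = 4 * of_int norm_omega - 1" by simp
  have "(cmod (el x y))\<^sup>2 = (of_int x + of_int y / 2)\<^sup>2 + (of_int y)\<^sup>2 * real k / 4"
    unfolding cmod_power2 Re_el Im_el by (simp add: power_mult_distrib power_divide)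
  then show ?thesis unfolding kr by (simp add: field_simps power2_eq_square)
qed

definition OK :: "complex set" where "OK = {el x y |x y. True}"

lemma el_OK [simp]: "el x y \<in> OK" by (auto simp: OK_def)

lemma OK_cases: "z \<in> OK \<Longrightarrow> (\<And>x y. z = el x y \<Longrightarrow> P) \<Longrightarrow> P" by (auto simp: OK_def)

lemma OK_add: "u \<in> OK \<Longrightarrow> v \<in> OK \<Longrightarrow> u + v \<in> OK" by (elim OK_cases) (simp add: el_add)
lemma OK_mult: "u \<in> OK \<Longrightarrow> v \<in> OK \<Longrightarrow> u * v \<in> OK" by (elim OK_cases) (simp add: el_mult)
lemma OK_minus: "u \<in> OK \<Longrightarrow> - u \<in> OK" by (elim OK_cases) (simp add: el_minus)
lemma OK_of_int: "of_int x \<in> OK" by (simp add: el_of_int)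

abbreviation K where "K \<equiv> quadratic_field (- int k)"

lemma K_eq: "K = {of_rat a + of_rat b * root_disc |a b. True}"
  unfolding quadratic_field_def csqrt_neg_k ..

lemma el_integral: "el x y \<in> K" "algebraic_int (el x y)"
proof -
  have "el x y = of_rat (of_int x + of_int y / 2) + of_rat (of_int y / 2) * root_disc"
    by (simp add: el_def \<omega>_def of_rat_add of_rat_divide of_rat_mult field_simps)
  then show "el x y \<in> K" unfolding K_eq by blast
  define p where "p = [: x\<^sup>2 + x * y + norm_omega * y\<^sup>2, - (2 * x + y), 1 :]"
  have "map_poly of_int p = [: of_int (x\<^sup>2 + x * y + norm_omega * y\<^sup>2), of_int (- (2 * x + y)), 1 :: complex :]"
    by (simp add: p_def map_poly_pCons)
  moreover have "of_int (x\<^sup>2 + x * y + norm_omega * y\<^sup>2) + el x y * (of_int (- (2 * x + y)) + el x y) = 0"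
    unfolding el_of_int el_add el_mult el_eq_0_iff by (simp add: power2_eq_square algebra_simps)
  ultimately have "poly (map_poly of_int p) (el x y) = 0" by (simp add: algebra_simps)
  then show "algebraic_int (el x y)" unfolding algebraic_int_altdef_ipoly
    by (intro exI[of _ p]) (simp add: p_def)
qed

text \<open>Since z and 1 + z are both integral, their norms are integers, and so is the trace t =
  N(1 + z) - N(z) - 1. Squarefreeness of k then bounds the denominator of the other coordinate by 2,
  and oddness of k makes the two half-integers have equal parity, which is membership in the span of
  1 and \<omega>.\<close>

lemma carrier_eq_OK: "carrier (ring_of_integers K) = OK"
proof (intro subset_antisym subsetI)
  fix z assume "z \<in> OK"
  then show "z \<in> carrier (ring_of_integers K)"
    using el_integral by (auto elim!: OK_cases simp: ring_of_integers_def)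
next
  fix z assume "z \<in> carrier (ring_of_integers K)"
  then have zK: "z \<in> K" and alg: "algebraic_int z" by (auto simp: ring_of_integers_def)
  from zK obtain a b where ab: "z = of_rat a + of_rat b * root_disc" unfolding K_eq by blast
  obtain A d where A: "a = of_int A / of_int d" "d > 0"
    by (cases a) (auto simp: Fract_of_int_quotient)
  obtain B d' where B: "b = of_int B / of_int d'" "d' > 0"
    by (cases b) (auto simp: Fract_of_int_quotient)
  have dd: "d * d' > 0" using A B by simp
  have z: "z = (of_int (A * d') + of_int (B * d) * root_disc) / of_int (d * d')"
  proof -
    have "complex_of_rat a = of_int A / of_int d" "complex_of_rat b = of_int B / of_int d'"
      by (simp_all add: A(1) B(1) of_rat_divide)
    then show ?thesis using A(2) B(2) unfolding ab by (simp add: add_divide_distrib)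
  qed
  obtain N where N: "(A * d')\<^sup>2 + int k * (B * d)\<^sup>2 = N * (d * d')\<^sup>2"
    using algebraic_int_imp_norm_int[OF dd z alg] by blast
  have z1: "1 + z = (of_int (A * d' + d * d') + of_int (B * d) * root_disc) / of_int (d * d')"
    using A B unfolding z by (simp add: field_simps)
  have alg1: "algebraic_int (1 + z)"
  proof -
    from alg obtain p where p: "poly (map_poly of_int p) z = 0" "lead_coeff p = 1"
      by (auto simp: algebraic_int_altdef_ipoly)
    define q where "q = pcompose p [:-1, 1:]"
    have "ipoly (pcompose p [:-1, 1:]) w = ipoly p (w - 1)" for w :: complex
    proof (induction p rule: pCons_induct)
      case (pCons a p)
      have "ipoly [:a:] w = of_int a" "ipoly [:-1, 1:] w = w - 1" "ipoly (pCons a p) (w - 1) = of_int a + (w - 1) * ipoly p (w - 1)"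
        by (simp_all add: ipoly_def map_poly_pCons)
      then show ?case unfolding pcompose_pCons ipoly_hom pCons.IH by simp
    qed (simp add: ipoly_def)
    then have "poly (map_poly of_int q) (1 + z) = 0" using p(1) by (simp add: q_def ipoly_def)
    moreover have "lead_coeff q = 1" using p(2) unfolding q_def by (subst lead_coeff_comp) auto
    ultimately show ?thesis unfolding algebraic_int_altdef_ipoly by blast
  qed
  obtain N' where N': "(A * d' + d * d')\<^sup>2 + int k * (B * d)\<^sup>2 = N' * (d * d')\<^sup>2"
    using algebraic_int_imp_norm_int[OF dd z1 alg1] by blast
  define t where "t = N' - N - 1"
  have "(d * d') * (2 * (A * d')) = (d * d') * (t * (d * d'))"
    using N N' unfolding t_def by (simp add: power2_eq_square algebra_simps)
  moreover have "d * d' \<noteq> 0" using dd by (rule less_imp_neq[symmetric])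
  ultimately have tA: "2 * (A * d') = t * (d * d')" by (metis mult_left_cancel)
  define D where "D = d * d'"
  have D: "D > 0" using dd by (simp add: D_def)
  have key: "int k * (2 * (B * d))\<^sup>2 = (4 * N - t\<^sup>2) * D\<^sup>2"
  proof -
    have "(2 * (A * d'))\<^sup>2 + int k * (2 * (B * d))\<^sup>2 = 4 * N * D\<^sup>2"
      using N unfolding D_def by (simp add: power2_eq_square algebra_simps)
    then show ?thesis unfolding tA D_def by (simp add: power2_eq_square algebra_simps)
  qed
  have "D dvd 2 * (B * d)"
  proof -
    define h where "h = gcd (2 * (B * d)) D"
    have h: "h > 0" using D by (simp add: h_def)
    obtain u v where uv: "2 * (B * d) = u * h" "D = v * h" "coprime u v"
      using gcd_coprime_exists[of "2 * (B * d)" D] h unfolding h_def by auto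
    have "h\<^sup>2 * (int k * u\<^sup>2) = h\<^sup>2 * ((4 * N - t\<^sup>2) * v\<^sup>2)"
      using key unfolding uv by (simp add: power2_eq_square algebra_simps)
    then have "int k * u\<^sup>2 = (4 * N - t\<^sup>2) * v\<^sup>2" using h by simp
    then have "v\<^sup>2 dvd int k * u\<^sup>2" by simp
    moreover have "coprime (v\<^sup>2) (u\<^sup>2)" using uv(3) by (simp add: coprime_commute)
    ultimately have vk: "v\<^sup>2 dvd int k" by (simp add: coprime_dvd_mult_left_iff)
    have "is_unit v"
    proof (rule ccontr)
      assume "\<not> is_unit v"
      moreover have "v \<noteq> 0" using uv(2) D by auto
      ultimately obtain p where p: "p dvd v" "prime p" using prime_divisor_exists by blast
      have "p\<^sup>2 dvd int k" using p(1) vk dvd_trans dvd_power_same by blast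
      moreover have pn: "prime (nat p)" "p = int (nat p)" using p(2) prime_ge_0_int by auto
      ultimately have "int ((nat p)\<^sup>2) dvd int k" by simp
      then have "(nat p)\<^sup>2 dvd k" by (simp only: int_dvd_int_iff)
      then show False using square_not_dvd_k[OF pn(1)] by blast
    qed
    then have "v dvd u" by (rule unit_imp_dvd)
    then show ?thesis unfolding uv by (rule mult_dvd_mono) (rule dvd_refl)
  qed
  then obtain y where "2 * (B * d) = D * y" by (rule dvdE)
  then have y: "2 * (B * d) = y * D" by (simp only: mult.commute)
  have "D\<^sup>2 * (int k * y\<^sup>2) = D\<^sup>2 * (4 * N - t\<^sup>2)" using key unfolding y by (simp add: power2_eq_square algebra_simps)
  then have "int k * y\<^sup>2 = 4 * N - t\<^sup>2" using D by simp
  then have "even (int k * y\<^sup>2 + t\<^sup>2)" by simp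
  then have "even (t - y)" using k_odd by simp
  then obtain x where x: "t - y = 2 * x" by (elim evenE)
  have "complex_of_int 2 * (of_int D * z) = of_int (2 * (A * d')) + of_int (2 * (B * d)) * root_disc"
  proof -
    have "of_int D * z = of_int (A * d') + of_int (B * d) * root_disc"
      unfolding z D_def[symmetric] using D by simp
    then show ?thesis by (simp add: algebra_simps)
  qed
  also have "\<dots> = of_int D * (of_int t + of_int y * root_disc)"
    unfolding y tA D_def by (simp add: algebra_simps)
  finally have "2 * z = of_int t + of_int y * root_disc" using D by (simp add: mult.left_commute)
  also have "t = 2 * x + y" using x by simp
  finally have "z = el x y" by (simp add: el_def \<omega>_def field_simps)
  then show "z \<in> OK" by simp
qed

end

section \<open>Ideals as lattices\<close>

lemma int_subgroup_principal:
  fixes S :: "int set"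
  assumes diff: "\<And>x y. x \<in> S \<Longrightarrow> y \<in> S \<Longrightarrow> x - y \<in> S" and x0: "x0 \<in> S" "x0 \<noteq> 0"
  obtains d where "d > 0" "\<And>x. x \<in> S \<longleftrightarrow> d dvd x"
proof -
  have zero: "0 \<in> S" using diff[OF x0(1) x0(1)] by simp
  have neg: "- x \<in> S" if "x \<in> S" for x using diff[OF zero that] by simp
  have add: "x + y \<in> S" if "x \<in> S" "y \<in> S" for x y using diff[OF that(1) neg[OF that(2)]] by simp
  have multn: "x * int n \<in> S" if "x \<in> S" for x n
    by (induction n) (use zero add[OF that] in \<open>auto simp: distrib_left\<close>)
  have mult: "x * n \<in> S" if "x \<in> S" for x n
    using multn[OF that, of "nat n"] neg[OF multn[OF that, of "nat (- n)"]] by (cases "n \<ge> 0") auto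
  define P where "P n \<longleftrightarrow> n > 0 \<and> int n \<in> S" for n
  have "P (nat \<bar>x0\<bar>)" unfolding P_def using x0 neg[OF x0(1)] by (auto simp: abs_if)
  then have L: "P (LEAST n. P n)" by (rule LeastI)
  define d where "d = int (LEAST n. P n)"
  have d: "d > 0" "d \<in> S" using L unfolding P_def d_def by auto
  have "d dvd x" if "x \<in> S" for x
  proof (rule ccontr)
    assume "\<not> d dvd x"
    then have pos: "x mod d > 0" using d(1) by (simp add: dvd_eq_mod_eq_0 order_less_le)
    have "x mod d = x - d * (x div d)" by (simp add: minus_mult_div_eq_mod)
    then have "x mod d \<in> S" using diff[OF that mult[OF d(2)]] by simp
    then have "P (nat (x mod d))" using pos unfolding P_def by simp
    then have "(LEAST n. P n) \<le> nat (x mod d)" by (rule Least_le)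
    then have "d \<le> x mod d" using pos unfolding d_def by linarith
    then show False using pos_mod_bound[OF d(1), of x] by linarith
  qed
  moreover have "x \<in> S" if "d dvd x" for x using that mult[OF d(2)] by (auto elim: dvdE)
  ultimately show thesis using that d(1) by blast
qed

text \<open>Makes the ideal norm independent of the chosen basis, hence multiplicative under scaling.\<close>

lemma lattice_covolume_unique:
  fixes u v u' v' :: complex
  assumes L: "{of_int x * u + of_int y * v |x y. True} = {of_int x * u' + of_int y * v' |x y. True}"
    and nz: "Im (cnj u * v) \<noteq> 0"
  shows "\<bar>Im (cnj u * v)\<bar> = \<bar>Im (cnj u' * v')\<bar>"
proof -
  have det: "\<exists>D::int. Im (cnj u' * v') = of_int D * Im (cnj u * v)"
    if L: "{of_int x * u' + of_int y * v' |x y. True} \<subseteq> {of_int x * u + of_int y * v |x y. True}"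
    for u v u' v' :: complex
  proof -
    have "u' = of_int 1 * u' + of_int 0 * v'" "v' = of_int 0 * u' + of_int 1 * v'" by simp_all
    then have "u' \<in> {of_int x * u + of_int y * v |x y. True}" "v' \<in> {of_int x * u + of_int y * v |x y. True}"
      using L by blast+
    then obtain p q r s :: int where "u' = of_int p * u + of_int q * v" "v' = of_int r * u + of_int s * v" by blast
    then have "Im (cnj u' * v') = of_int (p * s - q * r) * Im (cnj u * v)"
      by (simp add: algebra_simps)
    then show ?thesis by blast
  qed
  obtain D where D: "Im (cnj u' * v') = of_int D * Im (cnj u * v)" using det[of u' v' u v] L by auto
  obtain D' where D': "Im (cnj u * v) = of_int D' * Im (cnj u' * v')" using det[of u v u' v'] L by auto
  have "of_int (D' * D) * Im (cnj u * v) = 1 * Im (cnj u * v)" using D D' by simp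
  then have "real_of_int (D' * D) = 1" using nz by (simp only: mult_cancel_right) simp
  then have "D' * D = 1" by (simp only: of_int_eq_1_iff)
  then have "\<bar>D\<bar> = 1" using zmult_eq_1_iff[of D' D] by auto
  then have "\<bar>real_of_int D\<bar> = 1" by (metis of_int_1 of_int_abs)
  then show ?thesis unfolding D by (simp only: abs_mult mult_1_left)
qed

abbreviation smul :: "complex \<Rightarrow> complex set \<Rightarrow> complex set" where
  "smul \<gamma> I \<equiv> (\<lambda>x. \<gamma> * x) ` I"

context odd_real_primitive_character
begin

abbreviation "R \<equiv> ring_of_integers K"

lemma ring_R: "ring R"
proof (rule ringI)
  have c: "carrier R = OK" by (rule carrier_eq_OK)
  have s: "x \<oplus>\<^bsub>R\<^esub> y = x + y" "x \<otimes>\<^bsub>R\<^esub> y = x * y" "\<zero>\<^bsub>R\<^esub> = 0" "\<one>\<^bsub>R\<^esub> = 1" for x y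
    by (simp_all add: ring_of_integers_def)
  show "abelian_group R"
    by (rule abelian_groupI) (auto simp: c s OK_add OK_of_int[of 0, simplified] intro!: bexI[OF _ OK_minus])
  show "Group.monoid R"
    by (rule Group.monoidI) (auto simp: c s OK_mult OK_of_int[of 1, simplified] mult.assoc)
qed (simp_all add: ring_of_integers_def algebra_simps)

lemma ideal_iff:
  "ideal I R \<longleftrightarrow> I \<subseteq> OK \<and> 0 \<in> I \<and> (\<forall>x\<in>I. \<forall>y\<in>I. x + y \<in> I) \<and> (\<forall>r\<in>OK. \<forall>x\<in>I. r * x \<in> I)"
proof
  assume id: "ideal I R"
  then interpret ideal I R .
  note sub = ideal.axioms(1)[OF id]
  have "I \<subseteq> OK" using additive_subgroup.a_subset[OF sub] carrier_eq_OK by simp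
  moreover have "0 \<in> I" using additive_subgroup.zero_closed[OF sub] by (simp add: ring_of_integers_def)
  moreover have "x + y \<in> I" if "x \<in> I" "y \<in> I" for x y
    using additive_subgroup.a_closed[OF sub that] by (simp add: ring_of_integers_def)
  moreover have "r * x \<in> I" if "r \<in> OK" "x \<in> I" for r x
    using I_l_closed[of x r] that unfolding carrier_eq_OK by (simp add: ring_of_integers_def)
  ultimately show "I \<subseteq> OK \<and> 0 \<in> I \<and> (\<forall>x\<in>I. \<forall>y\<in>I. x + y \<in> I) \<and> (\<forall>r\<in>OK. \<forall>x\<in>I. r * x \<in> I)" by blast
next
  assume H: "I \<subseteq> OK \<and> 0 \<in> I \<and> (\<forall>x\<in>I. \<forall>y\<in>I. x + y \<in> I) \<and> (\<forall>r\<in>OK. \<forall>x\<in>I. r * x \<in> I)"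
  have s: "x \<oplus>\<^bsub>R\<^esub> y = x + y" "x \<otimes>\<^bsub>R\<^esub> y = x * y" "\<zero>\<^bsub>R\<^esub> = 0" for x y by (simp_all add: ring_of_integers_def)
  interpret ring R by (rule ring_R)
  have neg: "- x \<in> I" if "x \<in> I" for x
  proof -
    have "(- 1) * x \<in> I" using H that OK_of_int[of "-1"] by (metis of_int_1 of_int_minus)
    then show ?thesis by simp
  qed
  show "ideal I R"
  proof (rule idealI[OF ring_R])
    show "subgroup I (add_monoid R)"
    proof (rule group.subgroupI)
      show "group (add_monoid R)" by (rule add.group_axioms) 
      show "I \<subseteq> carrier (add_monoid R)" using H carrier_eq_OK by simp
      show "I \<noteq> {}" using H by blast
      fix x assume x: "x \<in> I"
      have "x \<in> carrier R" "- x \<in> carrier R" using x neg[OF x] H carrier_eq_OK by auto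
      then have "\<ominus>\<^bsub>R\<^esub> x = - x" by (intro minus_equality) (simp_all add: s)
      then show "inv\<^bsub>add_monoid R\<^esub> x \<in> I" using neg[OF x] by (simp add: a_inv_def)
      fix y assume "y \<in> I"
      then show "x \<otimes>\<^bsub>add_monoid R\<^esub> y \<in> I" using x H by (simp add: s)
    qed
    fix x r assume "x \<in> I" "r \<in> carrier R"
    then show "r \<otimes>\<^bsub>R\<^esub> x \<in> I" "x \<otimes>\<^bsub>R\<^esub> r \<in> I" using H carrier_eq_OK by (simp_all add: s mult.commute)
  qed
qed

abbreviation "ideals \<equiv> nonzero_ideals K"

lemma idealsD:
  assumes "I \<in> ideals"
  shows "I \<subseteq> OK" "0 \<in> I" "x \<in> I \<Longrightarrow> y \<in> I \<Longrightarrow> x + y \<in> I" "r \<in> OK \<Longrightarrow> x \<in> I \<Longrightarrow> r * x \<in> I" "I \<noteq> {0}"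
    "x \<in> I \<Longrightarrow> y \<in> I \<Longrightarrow> x - y \<in> I"
proof -
  have *: "ideal I R" "I \<noteq> {0}" using assms by (auto simp: nonzero_ideals_def)
  then show "I \<subseteq> OK" "0 \<in> I" "x \<in> I \<Longrightarrow> y \<in> I \<Longrightarrow> x + y \<in> I" "r \<in> OK \<Longrightarrow> x \<in> I \<Longrightarrow> r * x \<in> I" "I \<noteq> {0}" for x y r
    unfolding ideal_iff by blast+
  note cl = this
  assume "x \<in> I" "y \<in> I"
  then have "x + of_int (- 1) * y \<in> I" by (intro cl OK_of_int)
  then show "x - y \<in> I" by simp
qed

lemma idealsI:
  assumes "I \<subseteq> OK" "0 \<in> I" "\<And>x y. x \<in> I \<Longrightarrow> y \<in> I \<Longrightarrow> x + y \<in> I"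
    "\<And>r x. r \<in> OK \<Longrightarrow> x \<in> I \<Longrightarrow> r * x \<in> I" "z \<in> I" "z \<noteq> 0"
  shows "I \<in> ideals"
  unfolding nonzero_ideals_def mem_Collect_eq ideal_iff using assms by blast

section \<open>Normal forms of ideals and the ideal norm\<close>

definition lat :: "nat \<Rightarrow> nat \<Rightarrow> int \<Rightarrow> complex set" where
  "lat t a b = {of_int x * el (int t * int a) 0 + of_int y * el (int t * b) (int t) |x y. True}"

lemma lat_el: "of_int x * el (int t * int a) 0 + of_int y * el (int t * b) (int t)
    = el (int t * (int a * x + b * y)) (int t * y)"
  unfolding el_of_int el_mult el_add by (simp add: algebra_simps)

lemma el_in_lat_iff: "el x y \<in> lat t a b \<longleftrightarrow> (\<exists>u v. x = int t * (int a * u + b * v) \<and> y = int t * v)"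
  unfolding lat_def lat_el mem_Collect_eq el_eq_iff by auto

lemma lat_cases: "z \<in> lat t a b \<Longrightarrow> (\<And>x y. z = el (int t * (int a * x + b * y)) (int t * y) \<Longrightarrow> P) \<Longrightarrow> P"
  unfolding lat_def lat_el by blast

text \<open>Hermite normal forms: \<open>lat t a b\<close> has the basis t a and t (b + \<omega>).
  Reducing b modulo a makes the triple unique.\<close>

definition params :: "(nat \<times> nat \<times> int) set" where
  "params = {(t, a, b). t > 0 \<and> a > 0 \<and> b \<in> roots a}"

text \<open>Up to the factor t, multiplication by \<omega> sends b + \<omega> to (b + 1) (b +
  \<omega>) - \<open>norm_poly b\<close>, and a divides the last term. That is where the root
  condition enters.\<close>

lemma lat_ideal:
  assumes "(t, a, b) \<in> params"
  shows "lat t a b \<in> ideals"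
proof (rule idealsI)
  from assms have t: "t > 0" "a > 0" "b \<in> roots a" by (auto simp: params_def)
  then obtain q where q: "norm_poly b = int a * q" by (auto simp: roots_def elim: dvdE)
  show "lat t a b \<subseteq> OK" by (auto elim!: lat_cases)
  have "el 0 0 \<in> lat t a b" unfolding el_in_lat_iff by (intro exI[of _ 0]) simp
  then show "0 \<in> lat t a b" by (simp add: el_def)
  have "el (int t * int a) 0 \<in> lat t a b" unfolding el_in_lat_iff by (intro exI[of _ 1] exI[of _ 0]) simp
  then show "el (int t * int a) 0 \<in> lat t a b" .
  show "el (int t * int a) 0 \<noteq> 0" using t by (simp add: el_eq_0_iff)
  show "z + z' \<in> lat t a b" if zz: "z \<in> lat t a b" "z' \<in> lat t a b" for z z'
  proof -
    obtain x y where z: "z = el (int t * (int a * x + b * y)) (int t * y)" using zz(1) by (rule lat_cases)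
    obtain x' y' where z': "z' = el (int t * (int a * x' + b * y')) (int t * y')" using zz(2) by (rule lat_cases)
    show ?thesis
      unfolding z z' el_add el_in_lat_iff by (intro exI[of _ "x + x'"] exI[of _ "y + y'"]) (simp add: algebra_simps)
  qed
  show "r * z \<in> lat t a b" if "r \<in> OK" "z \<in> lat t a b" for r z
  proof -
    obtain p s where r: "r = el p s" using \<open>r \<in> OK\<close> by (rule OK_cases)
    obtain x y where z: "z = el (int t * (int a * x + b * y)) (int t * y)" using \<open>z \<in> lat t a b\<close> by (rule lat_cases)
    define y' where "y' = p * y + s * (int a * x + b * y) + s * y"
    define x' where "x' = p * x - s * b * x - s * y * q"
    have "int a * x' = p * int a * x - s * b * int a * x - s * y * norm_poly b"
      unfolding x'_def q by (simp add: algebra_simps)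
    then have "p * (int a * x + b * y) - norm_omega * s * y = int a * x' + b * y'"
      unfolding y'_def by (simp add: norm_poly_def algebra_simps power2_eq_square)
    moreover have "p * (int t * (int a * x + b * y)) - norm_omega * s * (int t * y)
        = int t * (p * (int a * x + b * y) - norm_omega * s * y)" by (simp add: algebra_simps)
    ultimately have "p * (int t * (int a * x + b * y)) - norm_omega * s * (int t * y) = int t * (int a * x' + b * y')"
      by (simp only:)
    moreover have "p * (int t * y) + s * (int t * (int a * x + b * y)) + s * (int t * y) = int t * y'"
      unfolding y'_def by (simp add: algebra_simps)
    ultimately show ?thesis unfolding r z el_mult el_in_lat_iff by blast
  qed
qed

text \<open>\<open>A\<close> generates the rational integers in I and \<open>T\<close> the
  \<omega>-coordinates of its elements. Multiplying by \<omega> shows that T divides A and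
  \<open>x0\<close>; multiplying by the conjugate b + 1 - \<omega> shows that a divides
  \<open>norm_poly b\<close>.\<close>

lemma ideal_is_lat:
  assumes I: "I \<in> ideals"
  obtains t a b where "(t, a, b) \<in> params" "I = lat t a b"
proof -
  note D = idealsD[OF I]
  have mul: "el p s * el x y \<in> I" if "el x y \<in> I" for p s x y using D(4) that by simp
  define X where "X = {x. el x 0 \<in> I}"
  define Y where "Y = {y. \<exists>x. el x y \<in> I}"
  obtain z where z: "z \<in> I" "z \<noteq> 0" using D(2,5) by blast
  then have "z \<in> OK" using D(1) by blast
  then obtain x1 y1 where xy: "z = el x1 y1" by (rule OK_cases)
  define N where "N = x1\<^sup>2 + x1 * y1 + norm_omega * y1\<^sup>2"
  have NX: "N \<in> X"
  proof -
    have "el (x1 + y1) (- y1) * el x1 y1 \<in> I" using mul z xy by simp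
    moreover have "el (x1 + y1) (- y1) * el x1 y1 = el N 0"
      unfolding el_mult el_eq_iff N_def by (simp add: algebra_simps power2_eq_square)
    ultimately show ?thesis by (simp add: X_def)
  qed
  have N0: "N \<noteq> 0"
  proof
    assume "N = 0"
    then have "(cmod z)\<^sup>2 = 0" unfolding xy norm_el N_def by simp
    then show False using z(2) by simp
  qed
  have NY: "N \<in> Y"
  proof -
    have "el 0 1 * el N 0 \<in> I" using NX mul by (simp add: X_def)
    then show ?thesis unfolding el_mult Y_def by auto
  qed
  have Xd: "x - x' \<in> X" if "x \<in> X" "x' \<in> X" for x x'
    using D(6)[of "el x 0" "el x' 0"] that by (simp add: X_def el_def)
  have Yd: "y - y' \<in> Y" if y: "y \<in> Y" "y' \<in> Y" for y y'
  proof -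
    obtain x x' where "el x y \<in> I" "el x' y' \<in> I" using y unfolding Y_def by blast
    then have "el x y - el x' y' \<in> I" by (rule D(6))
    moreover have "el x y - el x' y' = el (x - x') (y - y')" by (simp add: el_def algebra_simps)
    ultimately show ?thesis by (auto simp: Y_def)
  qed
  obtain A where A: "A > 0" "\<And>x. x \<in> X \<longleftrightarrow> A dvd x" using int_subgroup_principal[of X, OF Xd NX N0] by blast
  obtain T where T: "T > 0" "\<And>x. x \<in> Y \<longleftrightarrow> T dvd x" using int_subgroup_principal[of Y, OF Yd NY N0] by blast
  have "el A 0 \<in> I" using A(2)[of A] by (simp add: X_def)
  then have "el 0 1 * el A 0 \<in> I" by (rule mul)
  then have "A \<in> Y" unfolding el_mult Y_def by auto
  then obtain a where a: "A = T * a" using T(2) by (auto elim: dvdE)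
  have a0: "a > 0" using A(1) T(1) a by (simp add: zero_less_mult_iff)
  obtain x0 where x0: "el x0 T \<in> I" using T(2)[of T] by (auto simp: Y_def)
  then have "el 0 1 * el x0 T \<in> I" by (rule mul)
  then have "T + x0 \<in> Y" unfolding el_mult Y_def by (auto simp: add.commute)
  then have "T dvd x0" using T(2) by (simp add: dvd_add_right_iff)
  then obtain b0 where b0: "x0 = T * b0" by (elim dvdE)
  define b where "b = b0 mod a"
  have bI: "el (T * b) T \<in> I"
  proof -
    have "T * b = x0 - A * (b0 div a)" unfolding b_def a b0 by (simp add: algebra_simps flip: minus_mult_div_eq_mod)
    moreover have "el (A * (b0 div a)) 0 \<in> I" using A(2)[of "A * (b0 div a)"] by (simp add: X_def)
    then have "el x0 T - el (A * (b0 div a)) 0 \<in> I" using x0 D(6) by blast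
    moreover have "el x0 T - el (A * (b0 div a)) 0 = el (x0 - A * (b0 div a)) T" by (simp add: el_def)
    ultimately show ?thesis by (simp only:)
  qed
  have "el (b + 1) (- 1) * el (T * b) T \<in> I" using bI by (rule mul)
  moreover have "el (b + 1) (- 1) * el (T * b) T = el (T * norm_poly b) 0"
    unfolding el_mult el_eq_iff norm_poly_def by (simp add: algebra_simps power2_eq_square)
  ultimately have "T * a dvd T * norm_poly b" using A(2) a by (simp add: X_def)
  then have "a dvd norm_poly b" using T(1) by simp
  then have par: "(nat T, nat a, b) \<in> params"
    using T(1) a0 by (simp add: params_def roots_def b_def)
  moreover have "I = lat (nat T) (nat a) b"
  proof (intro subset_antisym subsetI)
    fix z assume "z \<in> I"
    then have "z \<in> OK" using D(1) by blast
    then obtain x y where z: "z = el x y" by (rule OK_cases)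
    with \<open>z \<in> I\<close> have zI: "el x y \<in> I" by simp
    then have "T dvd y" using T(2) by (auto simp: Y_def)
    then obtain v where v: "y = T * v" by (elim dvdE)
    have "el v 0 * el (T * b) T \<in> I" using bI by (rule mul)
    then have "el x y - el v 0 * el (T * b) T \<in> I" using zI D(6) by blast
    moreover have "el x y - el v 0 * el (T * b) T = el (x - T * b * v) 0"
      unfolding el_mult v by (simp add: el_def algebra_simps)
    ultimately have "A dvd x - T * b * v" using A(2) by (simp add: X_def)
    then obtain u where "x - T * b * v = T * a * u" unfolding a by (elim dvdE)
    then have "x = T * (a * u + b * v)" by (simp add: algebra_simps)
    then show "z \<in> lat (nat T) (nat a) b" unfolding z el_in_lat_iff using v T(1) a0 by auto
  next
    fix z assume "z \<in> lat (nat T) (nat a) b"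
    then obtain x y where z: "z = of_int x * el A 0 + of_int y * el (T * b) T"
      using T(1) a0 unfolding lat_def a by auto
    have "of_int x * el A 0 \<in> I" "of_int y * el (T * b) T \<in> I"
      using bI A(2)[of A] by (auto simp: X_def intro!: D(4) OK_of_int)
    then show "z \<in> I" unfolding z by (rule D(3))
  qed
  ultimately show thesis by (rule that)
qed

lemma lat_inj:
  assumes "(t, a, b) \<in> params" "(t', a', b') \<in> params" "lat t a b = lat t' a' b'"
  shows "t = t' \<and> a = a' \<and> b = b'"
proof -
  have p: "t > 0" "a > 0" "b \<in> roots a" "t' > 0" "a' > 0" "b' \<in> roots a'" using assms(1,2) by (auto simp: params_def)
  have el_iff: "el x y \<in> lat t a b \<longleftrightarrow> el x y \<in> lat t' a' b'" for x y using assms(3) by simp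
  have T: "int s dvd int s'" if s: "\<And>x y. el x y \<in> lat s c d \<longleftrightarrow> el x y \<in> lat s' c' d'" for s c d s' c' d'
  proof -
    have "el (int s' * d') (int s') \<in> lat s' c' d'" unfolding el_in_lat_iff by (intro exI[of _ 0] exI[of _ 1]) simp
    then have "el (int s' * d') (int s') \<in> lat s c d" using s by simp
    then obtain v where "int s' = int s * v" unfolding el_in_lat_iff by blast
    then show ?thesis by (rule dvdI)
  qed
  have tt: "t = t'" using T[OF el_iff] T[OF el_iff[symmetric]] by (simp add: dvd_antisym)
  have Ad: "int (s * c) dvd int (s * c')" if s: "\<And>x y. el x y \<in> lat s c d \<longleftrightarrow> el x y \<in> lat s c' d'" "s > 0" for s c d c' d'
  proof -
    have "el (int s * int c') 0 \<in> lat s c' d'" unfolding el_in_lat_iff by (intro exI[of _ 1] exI[of _ 0]) simp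
    then have "el (int s * int c') 0 \<in> lat s c d" using s by simp
    then obtain u v where uv: "int s * int c' = int s * (int c * u + d * v)" "0 = int s * v"
      unfolding el_in_lat_iff by blast
    then have "v = 0" using s(2) by simp
    then have "int (s * c') = int (s * c) * u" using uv(1) by simp
    then show ?thesis by (rule dvdI)
  qed
  have iff2: "el x y \<in> lat t a b \<longleftrightarrow> el x y \<in> lat t a' b'" for x y using el_iff tt by simp
  have "t * a dvd t * a'" "t * a' dvd t * a"
    using Ad[OF iff2 p(1)] Ad[OF iff2[symmetric] p(1)] unfolding int_dvd_int_iff .
  then have "t * a = t * a'" by (rule dvd_antisym)
  then have aa: "a = a'" using p(1) by simp
  have "el (int t * b') (int t) \<in> lat t a' b'" unfolding el_in_lat_iff by (intro exI[of _ 0] exI[of _ 1]) simp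
  then have "el (int t * b') (int t) \<in> lat t a b" using iff2 by simp
  then obtain u v where uv: "int t * b' = int t * (int a * u + b * v)" "int t = int t * v" unfolding el_in_lat_iff by blast
  then have "v = 1" using p(1) by simp
  then have "b' = int a * u + b" using uv(1) p(1) by simp
  then have "b' mod int a = b mod int a" by simp
  moreover have "b' mod int a = b'" "b mod int a = b" using p aa by (auto simp: roots_def)
  ultimately show ?thesis using tt aa by simp
qed

text \<open>Unspecified unless \<open>I\<close> is a nonzero ideal.\<close>

definition ideal_norm :: "complex set \<Rightarrow> nat" where
  "ideal_norm I = (THE n. \<exists>t a b. (t, a, b) \<in> params \<and> I = lat t a b \<and> n = t\<^sup>2 * a)"

lemma ideal_norm_lat:
  assumes "(t, a, b) \<in> params"
  shows "ideal_norm (lat t a b) = t\<^sup>2 * a"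
  unfolding ideal_norm_def
proof (rule the_equality)
  show "\<exists>t' a' b'. (t', a', b') \<in> params \<and> lat t a b = lat t' a' b' \<and> t\<^sup>2 * a = t'\<^sup>2 * a'" using assms by blast
  fix n assume "\<exists>t' a' b'. (t', a', b') \<in> params \<and> lat t a b = lat t' a' b' \<and> n = t'\<^sup>2 * a'"
  then obtain t' a' b' where *: "(t', a', b') \<in> params" "lat t a b = lat t' a' b'" "n = t'\<^sup>2 * a'" by blast
  from lat_inj[OF assms *(1,2)] show "n = t\<^sup>2 * a" using *(3) by simp
qed

text \<open>A normal form has covolume equal to its norm times sqrt k / 2, and scaling by \<gamma>
  multiplies covolumes by the square of the modulus of \<gamma>.\<close>

lemma ideal_norm_scale:
  assumes I: "I \<in> ideals" and J: "J \<in> ideals" and g: "\<gamma> \<noteq> 0" "J = smul \<gamma> I"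
  shows "real (ideal_norm J) = (cmod \<gamma>)\<^sup>2 * real (ideal_norm I)"
proof -
  obtain t a b where I': "(t, a, b) \<in> params" "I = lat t a b" using I by (rule ideal_is_lat)
  obtain t' a' b' where J': "(t', a', b') \<in> params" "J = lat t' a' b'" using J by (rule ideal_is_lat)
  define u v where "u = el (int t * int a) 0" and "v = el (int t * b) (int t)"
  define u' v' where "u' = el (int t' * int a') 0" and "v' = el (int t' * b') (int t')"
  have vol: "Im (cnj (el (int s * int c) 0) * el (int s * d) (int s)) = real (s\<^sup>2 * c) * sqrt (real k) / 2" for s c d
    by (simp add: Re_el Im_el power2_eq_square)
  have "{of_int x * (\<gamma> * u) + of_int y * (\<gamma> * v) |x y. True} = smul \<gamma> (lat t a b)"
  proof -
    have "\<gamma> * (of_int x * u + of_int y * v) = of_int x * (\<gamma> * u) + of_int y * (\<gamma> * v)" for x y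
      by (simp add: algebra_simps)
    then have "{of_int x * (\<gamma> * u) + of_int y * (\<gamma> * v) |x y. True} = {\<gamma> * (of_int x * u + of_int y * v) |x y. True}"
      by (simp only:)
    then show ?thesis unfolding lat_def u_def[symmetric] v_def[symmetric] by blast
  qed
  also have "\<dots> = lat t' a' b'" using g(2) I'(2) J'(2) by simp
  also have "\<dots> = {of_int x * u' + of_int y * v' |x y. True}" by (simp add: lat_def u'_def v'_def)
  finally have L: "{of_int x * (\<gamma> * u) + of_int y * (\<gamma> * v) |x y. True} = {of_int x * u' + of_int y * v' |x y. True}" .
  have sc: "cnj (\<gamma> * u) * (\<gamma> * v) = of_real ((cmod \<gamma>)\<^sup>2) * (cnj u * v)"
    using complex_norm_square[of \<gamma>] by (simp add: mult_ac)
  have im: "Im (cnj (\<gamma> * u) * (\<gamma> * v)) = (cmod \<gamma>)\<^sup>2 * (real (t\<^sup>2 * a) * sqrt (real k) / 2)"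
  proof -
    have "Im (of_real r * w) = r * Im w" for r w by simp
    then show ?thesis unfolding sc unfolding u_def v_def by (simp only: vol)
  qed
  have pos: "t > 0" "a > 0" using I'(1) by (auto simp: params_def)
  have "Im (cnj (\<gamma> * u) * (\<gamma> * v)) \<noteq> 0" unfolding im using g(1) pos k_pos by simp
  from lattice_covolume_unique[OF L this]
  have "(cmod \<gamma>)\<^sup>2 * (real (t\<^sup>2 * a) * sqrt (real k) / 2) = real (t'\<^sup>2 * a') * sqrt (real k) / 2"
    unfolding im unfolding u'_def v'_def vol by (simp add: abs_mult)
  then have "(cmod \<gamma>)\<^sup>2 * real (t\<^sup>2 * a) = real (t'\<^sup>2 * a')" using k_pos by simp
  then show ?thesis unfolding I'(2) J'(2) ideal_norm_lat[OF I'(1)] ideal_norm_lat[OF J'(1)] by simp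
qed

lemma scaled_ideal:
  assumes I: "I \<in> ideals" and g: "\<gamma> \<noteq> 0" "smul \<gamma> I \<subseteq> OK"
  shows "smul \<gamma> I \<in> ideals"
proof -
  note D = idealsD[OF I]
  obtain z where z: "z \<in> I" "z \<noteq> 0" using D(2,5) by blast
  show ?thesis
  proof (rule idealsI[OF g(2)])
    show "0 \<in> smul \<gamma> I" using D(2) by force
    show "\<gamma> * z \<in> smul \<gamma> I" "\<gamma> * z \<noteq> 0" using z g by auto
    fix x y assume "x \<in> smul \<gamma> I" "y \<in> smul \<gamma> I"
    then obtain u v where "x = \<gamma> * u" "y = \<gamma> * v" "u \<in> I" "v \<in> I" by blast
    then show "x + y \<in> smul \<gamma> I" using D(3)[of u v] by (auto simp flip: distrib_left)
  next
    fix r x assume "r \<in> OK" "x \<in> smul \<gamma> I"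
    then obtain u where "x = \<gamma> * u" "u \<in> I" by blast
    then show "r * x \<in> smul \<gamma> I" using D(4)[OF \<open>r \<in> OK\<close>, of u] by (auto simp: mult.left_commute)
  qed
qed

text \<open>A complex factor \<gamma> is enough: for any nonzero z in I both z and \<gamma> z lie in
  the ring, and (\<gamma> z) I = z J.\<close>

lemma class_rel_iff:
  assumes I: "I \<in> ideals" and J: "J \<in> ideals"
  shows "(I, J) \<in> ideal_class_rel K \<longleftrightarrow> (\<exists>\<gamma>. \<gamma> \<noteq> 0 \<and> J = smul \<gamma> I)"
proof
  assume "(I, J) \<in> ideal_class_rel K"
  then obtain \<alpha> \<beta> where ab: "\<alpha> \<noteq> 0" "\<beta> \<noteq> 0" "smul \<alpha> I = smul \<beta> J"
    unfolding ideal_class_rel_def by blast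
  have "J = (\<lambda>x. x / \<beta>) ` (smul \<beta> J)" using ab(2) by (simp add: image_image)
  also have "\<dots> = smul (\<alpha> / \<beta>) I" unfolding ab(3)[symmetric] by (simp add: image_image)
  finally show "\<exists>\<gamma>. \<gamma> \<noteq> 0 \<and> J = smul \<gamma> I" using ab by (intro exI[of _ "\<alpha> / \<beta>"]) simp
next
  assume "\<exists>\<gamma>. \<gamma> \<noteq> 0 \<and> J = smul \<gamma> I"
  then obtain \<gamma> where g: "\<gamma> \<noteq> 0" "J = smul \<gamma> I" by blast
  obtain z where z: "z \<in> I" "z \<noteq> 0" using idealsD(2,5)[OF I] by blast
  have zc: "z \<in> OK - {0}" "\<gamma> * z \<in> OK - {0}" using z g idealsD(1)[OF I] idealsD(1)[OF J] by auto
  have "smul (\<gamma> * z) I = smul (z) J" unfolding g(2) by (simp add: image_image mult_ac)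
  then show "(I, J) \<in> ideal_class_rel K" unfolding ideal_class_rel_def carrier_eq_OK using I J zc by blast
qed

end

section \<open>The generating series of ideal norms\<close>

context odd_real_primitive_character
begin

lemma g_square: "g\<^sup>2 = real k"
proof -
  have "- (complex_of_real (g\<^sup>2)) = - of_nat k"
    using gauss_sum_square unfolding G_eq by (simp add: power_mult_distrib)
  then have "complex_of_real (g\<^sup>2) = complex_of_real (real k)" by simp
  then show ?thesis by (simp only: of_real_eq_iff)
qed

lemma g_ne_0: "g \<noteq> 0"
  using g_square k_pos by auto

definition angle :: "int \<Rightarrow> real" where "angle n = 2 * pi * of_int n / real k"

text \<open>Separability expresses c(d) g through sines of multiples of d, and the exponential
  series of each sine is a kernel value. Only g nonzero is used, not its sign.\<close>

lemma character_exp_sums: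
  assumes u: "u > 0"
  shows "(\<lambda>d. of_int (c (int (Suc d))) * exp (- u * real (Suc d))) sums
    ((\<Sum>n\<in>{0..<int k}. of_int (c n) * (kernel (angle n) u)) / (2 * g))"
proof -
  have "(\<lambda>d. \<Sum>n\<in>{0..<int k}. of_int (c n) * (2 * exp (- u * real (Suc d)) * sin (real (Suc d) * angle n))) sums
    (\<Sum>n\<in>{0..<int k}. of_int (c n) * (kernel (angle n) u))"
    by (intro sums_sum sums_mult sums_exp_sin u)
  moreover have "(\<Sum>n\<in>{0..<int k}. of_int (c n) * (2 * exp (- u * real (Suc d)) * sin (real (Suc d) * angle n)))
      = 2 * g * (of_int (c (int (Suc d))) * exp (- u * real (Suc d)))" for d
  proof -
    have "(\<Sum>n\<in>{0..<int k}. of_int (c n) * (2 * exp (- u * real (Suc d)) * sin (real (Suc d) * angle n)))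
      = 2 * exp (- u * real (Suc d)) * (\<Sum>n\<in>{0..<int k}. of_int (c n) * sin (2 * pi * of_int (int (Suc d) * n) / real k))"
      unfolding sum_distrib_left by (intro sum.cong refl) (simp add: angle_def mult_ac)
    then show ?thesis unfolding sine_sum by simp
  qed
  ultimately have "(\<lambda>d. 2 * g * (of_int (c (int (Suc d))) * exp (- u * real (Suc d)))) sums
    (\<Sum>n\<in>{0..<int k}. of_int (c n) * (kernel (angle n) u))" by simp
  from sums_divide[OF this, of "2 * g"] show ?thesis using g_ne_0 by simp
qed

definition ideal_series :: "real \<Rightarrow> real" where
  "ideal_series \<epsilon> = (\<Sum>\<^sub>\<infinity>N\<in>{1..}. of_int (power_divisor_sum 2 rho N) * exp (- \<epsilon> * real N))"

lemma exp_product_summable: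
  fixes \<epsilon> :: real
  assumes e: "\<epsilon> > 0"
  shows "(\<lambda>(m, d). exp (- \<epsilon> * real (Suc m) * real (Suc d))) summable_on (UNIV \<times> UNIV)"
proof -
  define r where "r = exp (- \<epsilon>)"
  have r: "0 < r" "r < 1" using e by (auto simp: r_def)
  have ex: "exp (- \<epsilon> * real (Suc m) * real (Suc d)) = (r ^ Suc m) * (r ^ Suc m) ^ d" for m d
  proof -
    have "(r ^ Suc m) * (r ^ Suc m) ^ d = (r ^ Suc m) ^ Suc d" by (rule power_Suc[symmetric])
    also have "\<dots> = r ^ (Suc m * Suc d)" by (rule power_mult[symmetric])
    also have "\<dots> = exp (- \<epsilon> * real (Suc m) * real (Suc d))"
      unfolding r_def by (simp only: exp_of_nat_mult[symmetric] of_nat_mult mult_ac)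
    finally show ?thesis ..
  qed
  have rm: "0 < r ^ Suc m" "r ^ Suc m < 1" "r ^ Suc m \<le> r" for m
    using r by (auto simp: power_less_one_iff mult_le_cancel_left1 power_le_one simp del: power_Suc intro: power_Suc_less_one)
      (simp add: power_le_one mult_left_le)
  have inner: "((\<lambda>d. (r ^ Suc m) * (r ^ Suc m) ^ d) has_sum ((r ^ Suc m) * (1 / (1 - r ^ Suc m)))) UNIV" for m
  proof (rule norm_summable_imp_has_sum)
    show "(\<lambda>d. (r ^ Suc m) * (r ^ Suc m) ^ d) sums ((r ^ Suc m) * (1 / (1 - r ^ Suc m)))"
      by (intro sums_mult geometric_sums) (use rm[of m] in auto)
    then show "summable (\<lambda>d. norm ((r ^ Suc m) * (r ^ Suc m) ^ d))"
      using rm[of m] by (simp add: sums_iff)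
  qed
  have outer: "(\<lambda>m. (r ^ Suc m) * (1 / (1 - r ^ Suc m))) summable_on UNIV"
  proof (rule summable_on_comparison_test[where f = "\<lambda>m. r ^ Suc m * (1 / (1 - r))"])
    have "summable (\<lambda>m. norm (r ^ Suc m * (1 / (1 - r))))"
      using r by (simp add: summable_mult summable_mult2 summable_geometric)
    then show "(\<lambda>m. r ^ Suc m * (1 / (1 - r))) summable_on UNIV"
      by (rule norm_summable_imp_summable_on)
    show "(r ^ Suc m) * (1 / (1 - r ^ Suc m)) \<le> r ^ Suc m * (1 / (1 - r))" for m
      using rm[of m] r by (intro mult_left_mono divide_left_mono) auto
    show "0 \<le> (r ^ Suc m) * (1 / (1 - r ^ Suc m))" for m
      using rm[of m] by simp
  qed
  have "(\<lambda>(m, d). (r ^ Suc m) * (r ^ Suc m) ^ d) summable_on (SIGMA m:UNIV. UNIV)"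
    by (rule summable_on_SigmaI[OF _ outer]) (use inner r in auto)
  then show ?thesis unfolding ex by simp
qed

text \<open>A double series over (m, d), summed in two ways that absolute convergence permits: row
  by row it yields the kernel sums, along the fibres m d = N the divisor sums, which count
  ideals.\<close>

lemma ideal_series_eq:
  assumes e: "\<epsilon> > 0"
  shows "((\<lambda>N. of_int (power_divisor_sum 2 rho N) * exp (- \<epsilon> * real N)) has_sum ideal_series \<epsilon>) {1..}"
    and "ideal_series \<epsilon> = (\<Sum>n\<in>{1..<int k}. of_int (c n) *
      (\<Sum>m. kernel (angle n) (\<epsilon> * real (Suc m)))) / (2 * g)"
proof -
  define f where "f = (\<lambda>(m, d). of_int (c (int (Suc d))) * exp (- \<epsilon> * real (Suc m) * real (Suc d)))"
  have fs: "(\<lambda>z. norm (f z)) summable_on (UNIV \<times> UNIV)"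
  proof (rule summable_on_comparison_test[OF exp_product_summable[OF e]])
    fix z :: "nat \<times> nat"
    show "norm (f z) \<le> (case z of (m, d) \<Rightarrow> exp (- \<epsilon> * real (Suc m) * real (Suc d)))"
      using c_values[of "int (Suc (snd z))"] by (auto simp: f_def case_prod_beta abs_mult)
  qed simp
  define V where "V m = (\<Sum>n\<in>{0..<int k}. of_int (c n) * (kernel (angle n) (\<epsilon> * real (Suc m)))) / (2 * g)" for m
  define H where "H = infsum f (UNIV \<times> UNIV)"
  have fH: "(f has_sum H) (SIGMA m:UNIV. UNIV)"
    unfolding H_def using abs_summable_summable[OF fs] by (simp add: has_sum_infsum)
  have inner: "((\<lambda>d. f (m, d)) has_sum V m) UNIV" for m
  proof (rule norm_summable_imp_has_sum)
    have "\<epsilon> * real (Suc m) > 0" using e by simp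
    from character_exp_sums[OF this] show "(\<lambda>d. f (m, d)) sums V m" unfolding f_def V_def by simp
    have "(\<lambda>d. norm (f (m, d))) summable_on UNIV"
      using summable_on_SigmaD1[of "\<lambda>m d. norm (f (m, d))" UNIV "\<lambda>_. UNIV" m] fs by (simp add: case_prod_beta')
    then show "summable (\<lambda>d. norm (f (m, d)))" by (rule summable_on_imp_summable)
  qed
  have VH: "(V has_sum H) UNIV" by (rule has_sum_SigmaD[OF fH inner])
  have ang: "0 < angle n" "angle n < 2 * pi" if "n \<in> {1..<int k}" for n
    using that k_pos by (auto simp: angle_def field_simps)
  have z: "{0..<int k} = insert 0 {1..<int k}" using k_pos by auto
  have c0: "c 0 = 0" using c_eq_0_iff[of 0] k_ge by simp
  have "H = suminf V" using has_sum_imp_sums[OF VH] by (simp add: sums_iff)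
  also have "V sums ((\<Sum>n\<in>{1..<int k}. of_int (c n) *
      (\<Sum>m. kernel (angle n) (\<epsilon> * real (Suc m)))) / (2 * g))"
  proof -
    have "(\<lambda>m. (\<Sum>n\<in>{1..<int k}. of_int (c n) * (kernel (angle n) (\<epsilon> * real (Suc m)))) / (2 * g)) sums
      ((\<Sum>n\<in>{1..<int k}. of_int (c n) * (\<Sum>m. kernel (angle n) (\<epsilon> * real (Suc m)))) / (2 * g))"
      by (intro sums_divide sums_sum sums_mult summable_sums hyperbolic_kernel_sum(1) ang e)
    then show ?thesis unfolding V_def z by (simp add: c0)
  qed
  then have "suminf V = (\<Sum>n\<in>{1..<int k}. of_int (c n) *
      (\<Sum>m. kernel (angle n) (\<epsilon> * real (Suc m)))) / (2 * g)"
    by (simp add: sums_iff)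
  finally have H2: "H = (\<Sum>n\<in>{1..<int k}. of_int (c n) *
      (\<Sum>m. kernel (angle n) (\<epsilon> * real (Suc m)))) / (2 * g)" .
  \<comment> \<open>Pairs (N, t) with t the factor m. The shifts by \<open>Suc\<close> turn indices
    from 0 into positive integers, and \<open>t ^ 1\<close> matches
    \<open>power_divisor_sum 1\<close>.\<close>
  define S where "S = (SIGMA N:{1..}. {t::nat. t ^ 1 dvd N})"
  have bij: "bij_betw (\<lambda>(m, d). (Suc m * Suc d, Suc m)) (SIGMA m:UNIV. UNIV) S"
  proof (rule bij_betwI[where g = "\<lambda>(N, t). (t - 1, N div t - 1)"])
    show "(\<lambda>(m, d). (Suc m * Suc d, Suc m)) \<in> (SIGMA m:UNIV. UNIV) \<rightarrow> S"
      by (auto simp: S_def Suc_le_eq simp del: mult_Suc mult_Suc_right)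
    show "(\<lambda>(N, t). (t - 1, N div t - 1)) \<in> S \<rightarrow> (SIGMA m:UNIV. UNIV)" by auto
    show "(\<lambda>(N, t). (t - 1, N div t - 1)) ((\<lambda>(m, d). (Suc m * Suc d, Suc m)) z) = z" for z
      by (cases z) (simp del: mult_Suc mult_Suc_right)
    show "(\<lambda>(m, d). (Suc m * Suc d, Suc m)) ((\<lambda>(N, t). (t - 1, N div t - 1)) z) = z" if zS: "z \<in> S" for z
    proof -
      obtain N t where z: "z = (N, t)" "N \<ge> 1" "t dvd N" using zS by (auto simp: S_def)
      then obtain q where q: "N = t * q" by (elim dvdE)
      then have "t > 0" "q > 0" using z(2) by (auto intro: Nat.gr0I)
      then obtain t' q' where "t = Suc t'" "q = Suc q'" using gr0_implies_Suc by blast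
      then show ?thesis by (simp add: z(1) q del: mult_Suc mult_Suc_right)
    qed
  qed
  define h where "h = (\<lambda>(N, t). of_int (c (int (N div t ^ 1))) * exp (- \<epsilon> * real N))"
  have "(h has_sum H) S"
  proof -
    have "h ((\<lambda>(m, d). (Suc m * Suc d, Suc m)) z) = f z" for z
      by (cases z) (simp add: h_def f_def mult.assoc del: mult_Suc mult_Suc_right)
    then show ?thesis using fH has_sum_reindex_bij_betw[OF bij, of h H] by simp
  qed
  then have "((\<lambda>N. \<Sum>t\<in>{t. t ^ 1 dvd N}. h (N, t)) has_sum H) {1..}"
    unfolding S_def by (rule has_sum_SigmaD) (auto intro!: has_sum_finite)
  moreover have "(\<Sum>t\<in>{t. t ^ 1 dvd N}. h (N, t)) = of_int (power_divisor_sum 2 rho N) * exp (- \<epsilon> * real N)"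
    if "N \<in> {1..}" for N
    using that ideal_count_identity[of N] by (simp add: h_def power_divisor_sum_def sum_distrib_right)
  ultimately have hs: "((\<lambda>N. of_int (power_divisor_sum 2 rho N) * exp (- \<epsilon> * real N)) has_sum H) {1..}"
    using has_sum_cong by (metis (no_types, lifting))
  then have "ideal_series \<epsilon> = H" unfolding ideal_series_def by (rule infsumI)
  with hs H2 show "((\<lambda>N. of_int (power_divisor_sum 2 rho N) * exp (- \<epsilon> * real N)) has_sum ideal_series \<epsilon>) {1..}"
    and "ideal_series \<epsilon> = (\<Sum>n\<in>{1..<int k}. of_int (c n) *
      (\<Sum>m. kernel (angle n) (\<epsilon> * real (Suc m)))) / (2 * g)"
    by simp_all
qed

theorem ideal_series_asymptotics:
  "((\<lambda>\<epsilon>. ideal_series \<epsilon> - (- pi * first_moment / (real k * g)) / \<epsilon>) \<longlongrightarrow> - cot_sum / (4 * g)) (at_right 0)"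
proof -
  have ang: "0 < angle n" "angle n < 2 * pi" if "n \<in> {1..<int k}" for n
    using that k_pos by (auto simp: angle_def field_simps)
  have z: "{0..<int k} = insert 0 {1..<int k}" using k_pos by auto
  have c0: "c 0 = 0" using c_eq_0_iff[of 0] k_ge by simp
  define T where "T \<epsilon> n = (\<Sum>m. kernel (angle n) (\<epsilon> * real (Suc m)))" for \<epsilon> n
  have lim: "((\<lambda>\<epsilon>. (\<Sum>n\<in>{1..<int k}. of_int (c n) * (T \<epsilon> n - (pi - angle n) / \<epsilon>)) / (2 * g))
     \<longlongrightarrow> (\<Sum>n\<in>{1..<int k}. of_int (c n) * (- cot (angle n / 2) / 2)) / (2 * g)) (at_right 0)"
    unfolding T_def
    by (intro tendsto_divide tendsto_sum tendsto_mult tendsto_const hyperbolic_kernel_sum(2) ang) (use g_ne_0 in auto)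
  \<comment> \<open>The character sums to 0, so the constant pi in pi - \<open>angle n\<close> drops
    out and only the first moment survives in the 1/\<epsilon> term.\<close>
  have csum: "(\<Sum>n\<in>{1..<int k}. real_of_int (c n)) = 0"
  proof -
    have "(\<Sum>n\<in>{0..<int k}. complex_of_int (c n)) = 0"
      using gauss_sum_separable[of 0] by (simp add: c0)
    then have "complex_of_int (\<Sum>n\<in>{0..<int k}. c n) = 0" by simp
    then have "(\<Sum>n\<in>{0..<int k}. c n) = 0" by (simp only: of_int_eq_0_iff)
    then have "(\<Sum>n\<in>{1..<int k}. c n) = 0" unfolding z by (simp add: c0)
    then show ?thesis by (simp flip: of_int_sum)
  qed
  have L: "(\<Sum>n\<in>{1..<int k}. of_int (c n) * ((pi - angle n) / \<epsilon>)) / (2 * g) = (- pi * first_moment / (real k * g)) / \<epsilon>" for \<epsilon>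
  proof -
    have "(\<Sum>n\<in>{1..<int k}. of_int (c n) * ((pi - angle n) / \<epsilon>))
       = pi / \<epsilon> * (\<Sum>n\<in>{1..<int k}. real_of_int (c n)) - 2 * pi / (real k * \<epsilon>) * (\<Sum>n\<in>{1..<int k}. of_int n * of_int (c n))"
      unfolding sum_distrib_left sum_subtractf[symmetric]
      by (intro sum.cong refl) (simp add: angle_def diff_divide_distrib right_diff_distrib mult_ac)
    also have "(\<Sum>n\<in>{1..<int k}. of_int n * of_int (c n)) = first_moment"
      unfolding first_moment_def z by simp
    finally show ?thesis unfolding csum by simp
  qed
  have R: "(\<Sum>n\<in>{1..<int k}. of_int (c n) * (- cot (angle n / 2) / 2)) / (2 * g) = - cot_sum / (4 * g)"
  proof -
    have "cot_sum = (\<Sum>n\<in>{1..<int k}. of_int (c n) * cot (angle n / 2))"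
      unfolding cot_sum_def z by (simp add: c0 angle_def)
    then show ?thesis by (simp add: sum_negf sum_divide_distrib[symmetric])
  qed
  show ?thesis
    using lim unfolding R
  proof (rule Lim_transform_eventually)
    show "\<forall>\<^sub>F \<epsilon> in at_right 0. (\<Sum>n\<in>{1..<int k}. of_int (c n) * (T \<epsilon> n - (pi - angle n) / \<epsilon>)) / (2 * g)
       = ideal_series \<epsilon> - (- pi * first_moment / (real k * g)) / \<epsilon>"
    proof (rule eventually_mono[OF eventually_at_right_less])
      fix \<epsilon> :: real assume e: "0 < \<epsilon>"
      show "(\<Sum>n\<in>{1..<int k}. of_int (c n) * (T \<epsilon> n - (pi - angle n) / \<epsilon>)) / (2 * g)
       = ideal_series \<epsilon> - (- pi * first_moment / (real k * g)) / \<epsilon>"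
        unfolding ideal_series_eq(2)[OF e] L[symmetric] T_def right_diff_distrib sum_subtractf diff_divide_distrib ..
    qed
  qed
qed

text \<open>In normal form, an ideal of norm N is a choice of t with t^2 dividing N and of a root
  modulo N / t^2, which is what \<open>power_divisor_sum 2 rho\<close> counts.\<close>

theorem sum_over_ideals:
  assumes e: "\<epsilon> > 0"
  shows "((\<lambda>I. exp (- \<epsilon> * real (ideal_norm I))) has_sum ideal_series \<epsilon>) ideals"
proof -
  define fib where "fib N = {(t, a, b). (t, a, b) \<in> params \<and> t\<^sup>2 * a = N}" for N :: nat
  have card_fib: "finite (fib N)" "int (card (fib N)) = power_divisor_sum 2 rho N" if N: "N \<in> {1..}" for N
  proof -
    define U where "U = (SIGMA t:{t. t ^ 2 dvd N}. roots (N div t ^ 2))"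
    have bij: "bij_betw (\<lambda>(t, b). (t, N div t ^ 2, b)) U (fib N)"
    proof (rule bij_betwI[where g = "\<lambda>(t, a, b). (t, b)"])
      show "(\<lambda>(t, b). (t, N div t ^ 2, b)) \<in> U \<rightarrow> fib N"
        using N by (auto simp: U_def fib_def params_def Suc_le_eq elim!: dvdE intro: Nat.gr0I)
      show "(\<lambda>(t, a, b). (t, b)) \<in> fib N \<rightarrow> U" by (auto simp: U_def fib_def params_def)
      show "(\<lambda>(t, b). (t, N div t ^ 2, b)) ((\<lambda>(t, a, b). (t, b)) z) = z" if "z \<in> fib N" for z
        using that by (auto simp: fib_def params_def)
    qed auto
    have fin: "finite {t. t ^ 2 dvd N}"
    proof (rule finite_subset[of _ "{..N}"])
      show "{t. t ^ 2 dvd N} \<subseteq> {..N}"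
      proof
        fix t assume "t \<in> {t. t ^ 2 dvd N}"
        then have "t * t \<le> N" using N by (auto simp: power2_eq_square intro: dvd_imp_le)
        from le_trans[OF le_square this] show "t \<in> {..N}" by simp
      qed
    qed simp
    have "finite U" unfolding U_def using fin by auto
    then show "finite (fib N)" using bij bij_betw_finite by blast
    have "card (fib N) = card U" using bij_betw_same_card[OF bij] by simp
    also have "\<dots> = (\<Sum>t\<in>{t. t ^ 2 dvd N}. card (roots (N div t ^ 2)))"
      unfolding U_def using fin by (intro card_SigmaI) auto
    finally show "int (card (fib N)) = power_divisor_sum 2 rho N"
      by (simp add: power_divisor_sum_def rho_def)
  qed
  define w where "w = (\<lambda>(t::nat, a::nat, b::int). exp (- \<epsilon> * real (t\<^sup>2 * a)))"
  have inner: "((\<lambda>z. w (snd (N, z))) has_sum (of_int (power_divisor_sum 2 rho N) * exp (- \<epsilon> * real N))) (fib N)"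
    if N: "N \<in> {1..}" for N
  proof -
    have "(\<Sum>z\<in>fib N. w z) = (\<Sum>z\<in>fib N. exp (- \<epsilon> * real N))"
      by (intro sum.cong refl) (auto simp: w_def fib_def)
    also have "\<dots> = of_int (power_divisor_sum 2 rho N) * exp (- \<epsilon> * real N)"
      unfolding card_fib(2)[OF N, symmetric] by simp
    finally show ?thesis using has_sum_finite[OF card_fib(1)[OF N], of w] by simp
  qed
  have "((\<lambda>z. w (snd z)) has_sum ideal_series \<epsilon>) (SIGMA N:{1..}. fib N)"
  proof (rule has_sum_SigmaI[OF inner ideal_series_eq(1)[OF e]])
    show "(\<lambda>z. w (snd z)) summable_on (SIGMA N:{1..}. fib N)"
      by (rule summable_on_SigmaI[OF inner]) (use ideal_series_eq(1)[OF e] in \<open>auto simp: summable_on_def w_def\<close>)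
  qed
  moreover have "bij_betw snd (SIGMA N:{1..}. fib N) params"
  proof (rule bij_betwI[where g = "\<lambda>(t, a, b). (t\<^sup>2 * a, (t, a, b))"])
    show "snd \<in> (SIGMA N:{1..}. fib N) \<rightarrow> params" by (auto simp: fib_def)
    show "(\<lambda>(t, a, b). (t\<^sup>2 * a, (t, a, b))) \<in> params \<rightarrow> (SIGMA N:{1..}. fib N)"
      by (auto simp: fib_def params_def Suc_le_eq)
  qed (auto simp: fib_def)
  ultimately have "(w has_sum ideal_series \<epsilon>) params" using has_sum_reindex_bij_betw by blast
  moreover have "bij_betw (\<lambda>(t, a, b). lat t a b) params ideals"
    unfolding bij_betw_def
  proof
    show "inj_on (\<lambda>(t, a, b). lat t a b) params"
      using lat_inj by (auto intro!: inj_onI)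
    show "(\<lambda>(t, a, b). lat t a b) ` params = ideals"
      using lat_ideal ideal_is_lat by (auto simp: image_iff) (metis (no_types, lifting) case_prod_conv)
  qed
  moreover have "w z = exp (- \<epsilon> * real (ideal_norm ((\<lambda>(t, a, b). lat t a b) z)))" if "z \<in> params" for z
    using that ideal_norm_lat by (cases z) (simp add: w_def)
  ultimately show ?thesis
    using has_sum_reindex_bij_betw[of "\<lambda>(t, a, b). lat t a b" params ideals "\<lambda>I. exp (- \<epsilon> * real (ideal_norm I))"]
      has_sum_cong[of params w "\<lambda>z. exp (- \<epsilon> * real (ideal_norm ((\<lambda>(t, a, b). lat t a b) z)))"] by auto
qed

end

section \<open>The class number formula\<close>

lemma has_sum_disjoint_Union:
  fixes f :: "'a \<Rightarrow> 'b::topological_comm_monoid_add"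
  assumes "finite F" "\<And>C. C \<in> F \<Longrightarrow> (f has_sum s C) C" "pairwise disjnt F"
  shows "(f has_sum sum s F) (\<Union>F)"
  using assms
proof (induction F rule: finite_induct)
  case (insert C F)
  have "C \<inter> \<Union>F = {}" using insert.prems(2) insert.hyps(2) unfolding pairwise_insert disjnt_def by blast
  moreover have "(f has_sum sum s F) (\<Union>F)"
    using insert.prems by (intro insert.IH) (auto simp: pairwise_insert)
  moreover have "(f has_sum s C) C" using insert.prems(1) by simp
  ultimately have "(f has_sum (s C + sum s F)) (C \<union> \<Union>F)" by (intro has_sum_Un_disjoint)
  then show ?case using insert.hyps by simp
qed simp

text \<open>Multiplying by x shows a = 0. This separates the 1/\<epsilon> coefficient from the
  constant term when two expansions of one function are subtracted.\<close>

lemma tendsto_div_right_0_imp: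
  fixes a b :: real
  assumes "((\<lambda>x. a / x) \<longlongrightarrow> b) (at_right 0)"
  shows "a = 0 \<and> b = 0"
proof -
  have "((\<lambda>x. a / x * x) \<longlongrightarrow> b * 0) (at_right 0)"
    by (intro tendsto_mult assms tendsto_ident_at)
  moreover have "\<forall>\<^sub>F x in at_right 0. a / x * x = a"
    by (rule eventually_mono[OF eventually_at_right_less]) simp
  ultimately have "((\<lambda>x. a) \<longlongrightarrow> 0) (at_right (0::real))"
    using Lim_transform_eventually by fastforce
  then have "a = 0" using tendsto_const tendsto_unique[of "at_right (0::real)"] by (metis trivial_limit_at_right_real)
  then show ?thesis using assms tendsto_unique[of "at_right (0::real)" "\<lambda>x. 0" b 0] by (simp add: trivial_limit_at_right_real)
qed

context odd_real_primitive_character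
begin

section \<open>One ideal class and its binary quadratic form\<close>

context
  fixes a :: nat and b :: int
  assumes par: "(1, a, b) \<in> params"
begin

private lemma a_pos: "a > 0" and b_root: "b \<in> roots a" using par by (auto simp: params_def)

text \<open>Last coefficient of the form (a, 2 b + 1, \<open>third\<close>), whose discriminant is
  -k.\<close>

definition third :: int where "third = norm_poly b div int a"

private lemma third: "int a * third = norm_poly b"
  using b_root unfolding third_def roots_def by simp

private lemma third_pos: "third > 0"
  using norm_poly_pos[of b] a_pos unfolding third[symmetric] by (simp add: zero_less_mult_iff)

private lemma discriminant: "4 * int a * third - (2 * b + 1)\<^sup>2 = int k"
  using four_norm_poly[of b] unfolding third[symmetric] by (simp add: algebra_simps)

definition form :: "int \<times> int \<Rightarrow> int" where
  "form = (\<lambda>(x, y). int a * x\<^sup>2 + (2 * b + 1) * x * y + third * y\<^sup>2)"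

abbreviation J where "J \<equiv> lat 1 a b"

text \<open>The element x a + y (b + 1 - \<omega>) of the conjugate of the ideal J. Division by a,
  the norm of J, turns the conjugate into the inverse.\<close>

definition conj_gen :: "int \<times> int \<Rightarrow> complex" where
  "conj_gen = (\<lambda>(x, y). el (int a * x + (b + 1) * y) (- y))"

text \<open>\<open>inv_elem\<close> parametrizes the fractional ideal inverse to \<open>J\<close>; hence the ideals in the class of \<open>J\<close>
  are the multiples \<open>inv_elem z J\<close>, each obtained from exactly two values of \<open>z\<close>.\<close>

definition inv_elem :: "int \<times> int \<Rightarrow> complex" where "inv_elem z = conj_gen z / of_nat a"

lemma J_ideal: "J \<in> ideals" by (rule lat_ideal[OF par])

lemma inv_elem_a: "inv_elem z * of_nat a = conj_gen z" using a_pos by (simp add: inv_elem_def)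

lemma conj_gen_el: "conj_gen (x, y) * el b 1 = of_nat a * el (x * b + y * third) x"
proof -
  have "of_nat a * el (x * b + y * third) x = el (int a * (x * b) + y * (int a * third)) (int a * x)"
    by (simp add: el_def algebra_simps)
  then show ?thesis unfolding third conj_gen_def case_prod_conv el_mult
    by (simp add: el_eq_iff norm_poly_def algebra_simps power2_eq_square)
qed

lemma inv_elem_el: "inv_elem (x, y) * el b 1 = el (x * b + y * third) x"
  using conj_gen_el[of x y] a_pos by (simp add: inv_elem_def)

lemma J_eq: "J = {of_int u * of_nat a + of_int v * el b 1 |u v. True}"
  unfolding lat_def by (simp add: el_def)

lemma inv_elem_J_subset: "smul (inv_elem z) J \<subseteq> OK"
proof
  fix w assume "w \<in> smul (inv_elem z) J"
  then obtain u v where w: "w = inv_elem z * (of_int u * of_nat a + of_int v * el b 1)" unfolding J_eq by blast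
  obtain x y where z: "z = (x, y)" by fastforce
  have "w = of_int u * (inv_elem z * of_nat a) + of_int v * (inv_elem z * el b 1)" by (simp add: w algebra_simps)
  also have "\<dots> \<in> OK" unfolding inv_elem_a z inv_elem_el conj_gen_def case_prod_conv
    by (intro OK_add OK_mult OK_of_int) simp_all
  finally show "w \<in> OK" .
qed

text \<open>Integrality of \<gamma> a gives coordinates s, t, and integrality of \<gamma> (b +
  \<omega>) forces s + (b + 1) t to be a multiple of a; this is the shape of
  \<open>conj_gen\<close>.\<close>

lemma inv_elem_surj:
  assumes "smul \<gamma> J \<subseteq> OK"
  shows "\<exists>z. \<gamma> = inv_elem z"
proof -
  have "of_nat a \<in> J" "el b 1 \<in> J"
    unfolding J_eq mem_Collect_eq by (intro exI[of _ 1] exI[of _ 0], simp, intro exI[of _ 0] exI[of _ 1], simp)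
  then have "\<gamma> * of_nat a \<in> OK" "\<gamma> * el b 1 \<in> OK" using assms by auto
  then obtain s t p q where st: "\<gamma> * of_nat a = el s t" and pq: "\<gamma> * el b 1 = el p q" by (elim OK_cases)
  have "el s t * el b 1 = of_nat a * el p q" using st pq by (simp add: mult_ac flip: st pq)
  also have "of_nat a * el p q = el (int a * p) (int a * q)" by (simp add: el_def algebra_simps)
  finally have "s + t * b + t = int a * q" unfolding el_mult el_eq_iff by simp
  then have "s = int a * q + (b + 1) * (- t)" by (simp add: algebra_simps)
  then have "el s t = conj_gen (q, - t)" by (simp add: conj_gen_def)
  then have "\<gamma> = inv_elem (q, - t)" using st a_pos by (simp add: inv_elem_def field_simps)
  then show ?thesis by blast
qed

lemma inv_elem_eq_iff: "inv_elem z = inv_elem z' \<longleftrightarrow> z = z'"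
proof -
  obtain x y x' y' where z: "z = (x, y)" "z' = (x', y')" by fastforce
  show ?thesis using a_pos by (auto simp: inv_elem_def z conj_gen_def el_eq_iff)
qed

lemma inv_elem_minus: "inv_elem (- z) = - inv_elem z"
proof -
  obtain x y where z: "z = (x, y)" by fastforce
  have "el (int a * (- x) + (b + 1) * (- y)) (- (- y)) = - el (int a * x + (b + 1) * y) (- y)"
    unfolding el_minus by (simp add: algebra_simps)
  then show ?thesis
    by (simp only: z inv_elem_def conj_gen_def uminus_prod_def fst_conv snd_conv case_prod_conv minus_divide_left)
qed

lemma inv_elem_eq_0_iff: "inv_elem z = 0 \<longleftrightarrow> z = 0"
  using inv_elem_eq_iff[of z 0] by (simp add: inv_elem_def conj_gen_def zero_prod_def el_def)

lemma norm_inv_elem: "(cmod (inv_elem z))\<^sup>2 * real a = of_int (form z)"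
proof -
  obtain x y where z: "z = (x, y)" by fastforce
  have "(int a * x + (b + 1) * y)\<^sup>2 + (int a * x + (b + 1) * y) * (- y) + norm_omega * (- y)\<^sup>2
      = int a * (int a * x\<^sup>2 + (2 * b + 1) * x * y) + norm_poly b * y\<^sup>2"
    by (simp add: norm_poly_def algebra_simps power2_eq_square)
  also have "\<dots> = int a * form z"
    unfolding third[symmetric] z form_def by (simp add: algebra_simps)
  finally have "(cmod (conj_gen z))\<^sup>2 = of_int (int a * form z)"
    unfolding z conj_gen_def case_prod_conv norm_el by (simp only:)
  then show ?thesis using a_pos by (simp add: inv_elem_def norm_divide power_divide power2_eq_square)
qed

text \<open>Primitivity of the form: the square of a prime common to its coefficients would divide
  the discriminant, hence the squarefree k.\<close>

lemma bezout_form: "\<exists>p q r. p * int a + q * (2 * b + 1) + r * third = 1"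
proof -
  define d where "d = gcd (gcd (int a) (2 * b + 1)) third"
  have dd: "d dvd int a" "d dvd 2 * b + 1" "d dvd third" unfolding d_def by (auto intro: dvd_trans[OF gcd_dvd1])
  have "is_unit d"
  proof (rule ccontr)
    assume "\<not> is_unit d"
    moreover have "d \<noteq> 0" using a_pos by (simp add: d_def)
    ultimately obtain p where p: "p dvd d" "prime p" using prime_divisor_exists by blast
    have "p * p dvd 4 * int a * third" using p(1) dd by (meson dvd_mult dvd_trans mult_dvd_mono)
    moreover have "p * p dvd (2 * b + 1)\<^sup>2" unfolding power2_eq_square using p(1) dd(2) by (meson dvd_trans mult_dvd_mono)
    ultimately have "p\<^sup>2 dvd int k" unfolding discriminant[symmetric] power2_eq_square by (rule dvd_diff)
    moreover have pn: "prime (nat p)" "p = int (nat p)" using p(2) prime_ge_0_int by auto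
    ultimately have "int ((nat p)\<^sup>2) dvd int k" by simp
    then have "(nat p)\<^sup>2 dvd k" by (simp only: int_dvd_int_iff)
    then show False using square_not_dvd_k[OF pn(1)] by blast
  qed
  then have "d = 1" unfolding d_def by simp
  obtain u v where "u * int a + v * (2 * b + 1) = gcd (int a) (2 * b + 1)" using bezout_int by blast
  moreover obtain u' v' where "u' * gcd (int a) (2 * b + 1) + v' * third = d" unfolding d_def using bezout_int by blast
  ultimately have "u' * (u * int a + v * (2 * b + 1)) + v' * third = 1" using \<open>d = 1\<close> by simp
  then have "(u' * u) * int a + (u' * v) * (2 * b + 1) + v' * third = 1" by (simp add: algebra_simps)
  then show ?thesis by blast
qed

text \<open>As the form is primitive, only elements of the ring map J into itself, so \<eta> is an
  integer of norm 1. Then (2 X + Y)^2 + k Y^2 = 4 with k >= 7 forces Y = 0.\<close>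

lemma stabilizer:
  assumes "\<eta> \<noteq> 0" "smul \<eta> J = J"
  shows "\<eta> = 1 \<or> \<eta> = - 1"
proof -
  have "real (ideal_norm J) = (cmod \<eta>)\<^sup>2 * real (ideal_norm J)"
    by (rule ideal_norm_scale[OF J_ideal J_ideal assms(1) assms(2)[symmetric]])
  moreover have "real (ideal_norm J) > 0" using ideal_norm_lat[OF par] a_pos by simp
  ultimately have n1: "(cmod \<eta>)\<^sup>2 = 1" by simp
  have "of_nat a \<in> J" "el b 1 \<in> J"
    unfolding J_eq mem_Collect_eq by (intro exI[of _ 1] exI[of _ 0], simp, intro exI[of _ 0] exI[of _ 1], simp)
  then have J1: "\<eta> * of_nat a \<in> J" and J2: "\<eta> * el b 1 \<in> J" using assms(2) by auto
  from J1 obtain x y where xy: "\<eta> * of_nat a = el (int a * x + b * y) y" by (elim lat_cases) auto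
  from J2 obtain u v where uv: "\<eta> * el b 1 = el (int a * u + b * v) v" by (elim lat_cases) auto
  have "el (int a * x + b * y) y * el b 1 = of_nat a * el (int a * u + b * v) v"
    unfolding xy[symmetric] uv[symmetric] by simp
  also have "\<dots> = el (int a * (int a * u + b * v)) (int a * v)" by (simp add: el_def algebra_simps)
  finally have e1: "(int a * x + b * y) * b - norm_omega * y = int a * (int a * u + b * v)"
    and e2: "int a * x + b * y + y * b + y = int a * v" unfolding el_mult el_eq_iff by simp_all
  have d1: "y * (2 * b + 1) = int a * (v - x)" using e2 by (simp add: algebra_simps)
  have "int a * (int a * u) = (int a * x + b * y) * b - norm_omega * y - b * (int a * v)"
    using e1 by (simp add: algebra_simps)
  also have "\<dots> = - (y * norm_poly b)" unfolding e2[symmetric] norm_poly_def by (simp add: algebra_simps power2_eq_square)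
  also have "\<dots> = int a * (- y * third)" unfolding third[symmetric] by (simp add: algebra_simps)
  finally have "int a * (int a * u) = int a * (- y * third)" .
  moreover have "int a \<noteq> 0" using a_pos by simp
  ultimately have "int a * u = - y * third" by (metis mult_left_cancel)
  then have d2: "y * third = int a * (- u)" by simp
  \<comment> \<open>The integer a divides y times each coefficient of the form; the Bezout relation
    concludes that it divides y itself.\<close>
  obtain p q r where pqr: "p * int a + q * (2 * b + 1) + r * third = 1" using bezout_form by blast
  have "y = y * (p * int a + q * (2 * b + 1) + r * third)" using pqr by simp
  also have "\<dots> = int a * (y * p) + q * (y * (2 * b + 1)) + r * (y * third)" by (simp add: algebra_simps)
  also have "\<dots> = int a * (y * p + q * (v - x) - r * u)" unfolding d1 d2 by (simp add: algebra_simps)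
  finally obtain Y where Y: "y = int a * Y" by blast
  define X where "X = x + b * Y"
  have "\<eta> * of_nat a = of_nat a * el X Y" unfolding xy Y X_def by (simp add: el_def algebra_simps)
  then have eta: "\<eta> = el X Y" using a_pos by simp
  then have "real_of_int (X\<^sup>2 + X * Y + norm_omega * Y\<^sup>2) = of_int 1" using n1 norm_el[of X Y] by simp
  then have "X\<^sup>2 + X * Y + norm_omega * Y\<^sup>2 = 1" by (simp only: of_int_eq_iff)
  then have "4 * X\<^sup>2 + 4 * X * Y + (4 * norm_omega) * Y\<^sup>2 = 4" by simp
  then have q: "(2 * X + Y)\<^sup>2 + int k * Y\<^sup>2 = 4" unfolding four_norm_omega by (simp add: algebra_simps power2_eq_square)
  have "Y = 0"
  proof (rule ccontr)
    assume "Y \<noteq> 0"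
    then have "Y\<^sup>2 \<ge> 1" by (simp add: int_one_le_iff_zero_less)
    then have "int k * 1 \<le> int k * Y\<^sup>2" by (intro mult_left_mono) auto
    moreover have "(2 * X + Y)\<^sup>2 \<ge> 0" by simp
    ultimately show False using q k_ge by linarith
  qed
  then have "X\<^sup>2 = 1" using q by simp
  then show ?thesis unfolding eta \<open>Y = 0\<close> by (auto simp: power2_eq_1_iff el_def)
qed

lemma inv_elem_J_eq_iff:
  assumes "z \<noteq> 0" "z' \<noteq> 0"
  shows "smul (inv_elem z) J = smul (inv_elem z') J \<longleftrightarrow> z = z' \<or> z = - z'"
proof
  assume eq: "smul (inv_elem z) J = smul (inv_elem z') J"
  have nz: "inv_elem z \<noteq> 0" "inv_elem z' \<noteq> 0" using assms inv_elem_eq_0_iff by auto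
  have "smul (inv_elem z / inv_elem z') J = (\<lambda>x. x / inv_elem z') ` (smul (inv_elem z) J)" by (simp add: image_image)
  also have "\<dots> = J" unfolding eq using nz by (simp add: image_image)
  finally have "inv_elem z / inv_elem z' = 1 \<or> inv_elem z / inv_elem z' = - 1" using nz by (intro stabilizer) auto
  then have "inv_elem z = inv_elem z' \<or> inv_elem z = inv_elem (- z')" using nz by (auto simp: inv_elem_minus divide_eq_eq)
  then show "z = z' \<or> z = - z'" by (simp add: inv_elem_eq_iff)
next
  assume "z = z' \<or> z = - z'"
  then show "smul (inv_elem z) J = smul (inv_elem z') J"
  proof
    assume "z = - z'"
    have "- x \<in> J" if "x \<in> J" for x
      using idealsD(6)[OF J_ideal idealsD(2)[OF J_ideal] that] by simp
    then have neg: "uminus ` J = J" by force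
    have "smul (inv_elem z) J = (\<lambda>x. inv_elem z' * x) ` (uminus ` J)"
      unfolding \<open>z = - z'\<close> inv_elem_minus by (simp add: image_image)
    then show ?thesis unfolding neg .
  qed simp
qed

lemma class_eq: "ideal_class_rel K `` {J} = (\<lambda>z. smul (inv_elem z) J) ` (UNIV - {0})"
proof (intro subset_antisym subsetI)
  fix I assume "I \<in> ideal_class_rel K `` {J}"
  then have rel: "(J, I) \<in> ideal_class_rel K" and I: "I \<in> ideals" by (auto simp: ideal_class_rel_def)
  then obtain \<gamma> where g: "\<gamma> \<noteq> 0" "I = smul \<gamma> J" using class_rel_iff[OF J_ideal I] by blast
  then obtain z where z: "\<gamma> = inv_elem z" using inv_elem_surj idealsD(1)[OF I] by blast
  then have "z \<noteq> 0" using g(1) inv_elem_eq_0_iff by auto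
  then show "I \<in> (\<lambda>z. smul (inv_elem z) J) ` (UNIV - {0})" using g(2) z by blast
next
  fix I assume "I \<in> (\<lambda>z. smul (inv_elem z) J) ` (UNIV - {0})"
  then obtain z where z: "z \<noteq> 0" "I = smul (inv_elem z) J" by blast
  then have nz: "inv_elem z \<noteq> 0" using inv_elem_eq_0_iff by simp
  have I: "I \<in> ideals" unfolding z(2) by (rule scaled_ideal[OF J_ideal nz inv_elem_J_subset])
  then have "(J, I) \<in> ideal_class_rel K" using class_rel_iff[OF J_ideal I] nz z(2) by blast
  then show "I \<in> ideal_class_rel K `` {J}" by blast
qed

lemma norm_inv_elem_J:
  assumes "z \<noteq> 0"
  shows "real (ideal_norm (smul (inv_elem z) J)) = of_int (form z)"
proof -
  have nz: "inv_elem z \<noteq> 0" using assms inv_elem_eq_0_iff by simp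
  have "real (ideal_norm (smul (inv_elem z) J)) = (cmod (inv_elem z))\<^sup>2 * real (ideal_norm J)"
    by (rule ideal_norm_scale[OF J_ideal scaled_ideal[OF J_ideal nz inv_elem_J_subset] nz refl])
  then show ?thesis using norm_inv_elem ideal_norm_lat[OF par] by simp
qed

lemma form_theta:
  "\<epsilon> > 0 \<Longrightarrow> (\<lambda>z. exp (- \<epsilon> * real_of_int (form z))) summable_on UNIV"
  "((\<lambda>\<epsilon>. (\<Sum>\<^sub>\<infinity>z. exp (- \<epsilon> * real_of_int (form z))) - 2 * pi / (\<epsilon> * sqrt (real k))) \<longlongrightarrow> 0) (at_right 0)"
proof -
  have fe: "(\<lambda>(x, y). real a * (of_int x)\<^sup>2 + of_int (2 * b + 1) * of_int x * of_int y + of_int third * (of_int y)\<^sup>2)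
      = (\<lambda>z. real_of_int (form z))"
    by (auto simp: form_def)
  have D: "real_of_int third > 0" "real k > 0" "4 * real a * of_int third - (of_int (2 * b + 1))\<^sup>2 = real k"
  proof -
    have "real_of_int (4 * int a * third - (2 * b + 1)\<^sup>2) = of_int (int k)" by (simp only: discriminant)
    then show "4 * real a * of_int third - (of_int (2 * b + 1))\<^sup>2 = real k" by simp
  qed (use third_pos k_pos in auto)
  show "\<epsilon> > 0 \<Longrightarrow> (\<lambda>z. exp (- \<epsilon> * real_of_int (form z))) summable_on UNIV"
    using binary_form_theta(1)[OF D] unfolding fe .
  show "((\<lambda>\<epsilon>. (\<Sum>\<^sub>\<infinity>z. exp (- \<epsilon> * real_of_int (form z))) - 2 * pi / (\<epsilon> * sqrt (real k))) \<longlongrightarrow> 0) (at_right 0)"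
    using binary_form_theta(2)[OF D] unfolding fe .
qed

text \<open>The theta series counts z = 0 once and each ideal of the class twice, from z and -z,
  with the value of the form as its norm.\<close>

lemma class_sum:
  assumes e: "\<epsilon> > 0"
  shows "((\<lambda>I. exp (- \<epsilon> * real (ideal_norm I))) has_sum (((\<Sum>\<^sub>\<infinity>z. exp (- \<epsilon> * of_int (form z))) - 1) / 2)) (ideal_class_rel K `` {J})"
proof -
  define f where "f z = exp (- \<epsilon> * real_of_int (form z))" for z
  have summ: "f summable_on UNIV" unfolding f_def by (rule form_theta(1)[OF e])
  \<comment> \<open>A half-plane with half of its boundary line, containing exactly one of z and -z
    for every nonzero z.\<close>
  define H1 where "H1 = {(x, y). y > 0 \<or> y = 0 \<and> x > (0::int)} \<inter> (UNIV :: (int \<times> int) set)"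
  have U: "UNIV = {0} \<union> (H1 \<union> uminus ` H1)" "{0} \<inter> (H1 \<union> uminus ` H1) = {}" "H1 \<inter> uminus ` H1 = {}"
  proof -
    have neg: "z \<in> uminus ` H1 \<longleftrightarrow> - z \<in> H1" for z by (metis image_iff minus_minus)
    show "UNIV = {0} \<union> (H1 \<union> uminus ` H1)" "{0} \<inter> (H1 \<union> uminus ` H1) = {}" "H1 \<inter> uminus ` H1 = {}"
      by (auto simp: neg) (auto simp: H1_def zero_prod_def)
  qed
  have fm: "f (- z) = f z" for z by (cases z) (simp add: f_def form_def uminus_prod_def)
  define s where "s = infsum f H1"
  have s1: "(f has_sum s) H1" unfolding s_def by (intro has_sum_infsum summable_on_subset_banach[OF summ]) auto
  have "inj_on uminus H1" by (auto intro: inj_onI)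
  then have s2: "(f has_sum s) (uminus ` H1)" using s1 by (subst has_sum_reindex) (simp_all add: o_def fm)
  have s0: "(f has_sum 1) {0}" using has_sum_finite[of "{0}" f] by (simp add: f_def form_def zero_prod_def)
  have "(f has_sum (1 + (s + s))) UNIV"
    unfolding U(1) by (intro has_sum_Un_disjoint s0 s1 s2 U)
  then have tot: "infsum f UNIV = 1 + (s + s)" by (rule infsumI)
  have bij: "bij_betw (\<lambda>z. smul (inv_elem z) J) H1 (ideal_class_rel K `` {J})"
    unfolding bij_betw_def
  proof
    have H0: "z \<noteq> 0" if "z \<in> H1" for z using that U(2) by auto
    show "inj_on (\<lambda>z. smul (inv_elem z) J) H1"
    proof (rule inj_onI)
      fix z z' assume z: "z \<in> H1" "z' \<in> H1" "smul (inv_elem z) J = smul (inv_elem z') J"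
      then have "z = z' \<or> z = - z'" using inv_elem_J_eq_iff[OF H0[OF z(1)] H0[OF z(2)]] by simp
      moreover have "z \<noteq> - z'" using z(1,2) U(3) by auto
      ultimately show "z = z'" by simp
    qed
    show "(\<lambda>z. smul (inv_elem z) J) ` H1 = ideal_class_rel K `` {J}"
      unfolding class_eq
    proof (intro subset_antisym subsetI)
      fix I assume "I \<in> (\<lambda>z. smul (inv_elem z) J) ` H1"
      then show "I \<in> (\<lambda>z. smul (inv_elem z) J) ` (UNIV - {0})" using H0 by blast
    next
      fix I assume "I \<in> (\<lambda>z. smul (inv_elem z) J) ` (UNIV - {0})"
      then obtain z where z: "z \<noteq> 0" "I = smul (inv_elem z) J" by blast
      then consider "z \<in> H1" | z' where "z = - z'" "z' \<in> H1" using U(1) by blast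
      then show "I \<in> (\<lambda>z. smul (inv_elem z) J) ` H1"
      proof cases
        case 2
        then have "I = smul (inv_elem z') J" using z inv_elem_J_eq_iff[of z z'] by auto
        then show ?thesis using 2(2) by blast
      qed (use z in blast)
    qed
  qed
  have "f z = exp (- \<epsilon> * real (ideal_norm (smul (inv_elem z) J)))" if "z \<in> H1" for z
    using that U(2) by (subst norm_inv_elem_J) (auto simp: f_def)
  then have "((\<lambda>z. exp (- \<epsilon> * real (ideal_norm (smul (inv_elem z) J)))) has_sum s) H1"
    using s1 has_sum_cong by (metis (no_types, lifting))
  then have "((\<lambda>I. exp (- \<epsilon> * real (ideal_norm I))) has_sum s) (ideal_class_rel K `` {J})"
    using has_sum_reindex_bij_betw[OF bij, of "\<lambda>I. exp (- \<epsilon> * real (ideal_norm I))" s] by simp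
  moreover have "s = (infsum f UNIV - 1) / 2" using tot by simp
  ultimately show ?thesis unfolding f_def by simp
qed

lemma class_sum_asymptotics:
  "((\<lambda>\<epsilon>. ((\<Sum>\<^sub>\<infinity>z. exp (- \<epsilon> * of_int (form z))) - 1) / 2 - (pi / sqrt (real k)) / \<epsilon>) \<longlongrightarrow> - 1 / 2) (at_right 0)"
proof -
  have "((\<lambda>\<epsilon>. ((\<Sum>\<^sub>\<infinity>z. exp (- \<epsilon> * of_int (form z))) - 2 * pi / (\<epsilon> * sqrt (real k))) / 2 - 1 / 2) \<longlongrightarrow> 0 / 2 - 1 / 2) (at_right 0)"
    by (intro tendsto_intros form_theta(2)) auto
  then show ?thesis by (simp add: diff_divide_distrib algebra_simps)
qed

end

text \<open>Dropping the rational factor t of a normal form stays within the class, so each class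
  contains an ideal spanned by some a and b + \<omega>. The limit does not depend on that
  choice.\<close>

lemma class_sum_exists:
  assumes "C \<in> ideals // ideal_class_rel K"
  shows "\<exists>s. (\<forall>\<epsilon>>0. ((\<lambda>I. exp (- \<epsilon> * real (ideal_norm I))) has_sum s \<epsilon>) C) \<and>
    ((\<lambda>\<epsilon>. s \<epsilon> - (pi / sqrt (real k)) / \<epsilon>) \<longlongrightarrow> - 1 / 2) (at_right 0)"
proof -
  obtain I where I: "I \<in> ideals" "C = ideal_class_rel K `` {I}" using assms by (rule quotientE)
  obtain t a b where tab: "(t, a, b) \<in> params" "I = lat t a b" using I(1) by (rule ideal_is_lat)
  have par: "(1, a, b) \<in> params" using tab(1) by (simp add: params_def)
  have "lat t a b = smul (of_nat t) (lat 1 a b)"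
  proof -
    have "of_int x * el (int t * int a) 0 + of_int y * el (int t * b) (int t)
        = of_nat t * (of_int x * el (int 1 * int a) 0 + of_int y * el (int 1 * b) (int 1))" for x y
      by (simp add: el_def algebra_simps)
    then have "lat t a b = {of_nat t * (of_int x * el (int 1 * int a) 0 + of_int y * el (int 1 * b) (int 1)) |x y. True}"
      unfolding lat_def by (simp only:)
    then show ?thesis unfolding lat_def by blast
  qed
  moreover have "complex_of_nat t \<noteq> 0" using tab(1) by (simp add: params_def)
  ultimately have "(lat 1 a b, I) \<in> ideal_class_rel K"
    using class_rel_iff[OF lat_ideal[OF par] I(1)] tab(2) by blast
  then have "C = ideal_class_rel K `` {lat 1 a b}"
    unfolding I(2) using equiv_class_eq[OF equiv_ideal_class_rel] by blast
  then show ?thesis using class_sum[OF par] class_sum_asymptotics[OF par]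
    by (intro exI[of _ "\<lambda>\<epsilon>. ((\<Sum>\<^sub>\<infinity>z. exp (- \<epsilon> * of_int (form a b z))) - 1) / 2"]) simp
qed

text \<open>Each class has the same expansion, so any finite set F of classes forces card F pi /
  sqrt k to be at most the 1/\<epsilon> coefficient \<open>L\<close> of the whole series. This
  bounds the number of classes; with all of them present, both coefficients are compared.\<close>

theorem class_number_formula:
  "h_neg k > 0" "real (h_neg k) * pi / sqrt (real k) = - pi * first_moment / (real k * g)" "real (h_neg k) = cot_sum / (2 * g)"
proof -
  define X where "X = ideals // ideal_class_rel K"
  define L where "L = - pi * first_moment / (real k * g)"
  define w where "w \<epsilon> I = exp (- \<epsilon> * real (ideal_norm I))" for \<epsilon> I
  have "\<forall>C\<in>X. \<exists>s. (\<forall>\<epsilon>>0. (w \<epsilon> has_sum s \<epsilon>) C) \<and>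
      ((\<lambda>\<epsilon>. s \<epsilon> - (pi / sqrt (real k)) / \<epsilon>) \<longlongrightarrow> - 1 / 2) (at_right 0)"
    using class_sum_exists unfolding X_def w_def[abs_def] by blast
  from bchoice[OF this] obtain s where s: "\<And>C \<epsilon>. C \<in> X \<Longrightarrow> \<epsilon> > 0 \<Longrightarrow> (w \<epsilon> has_sum s C \<epsilon>) C"
    and slim: "\<And>C. C \<in> X \<Longrightarrow> ((\<lambda>\<epsilon>. s C \<epsilon> - (pi / sqrt (real k)) / \<epsilon>) \<longlongrightarrow> - 1 / 2) (at_right 0)"
    by blast
  have Xu: "\<Union>X = ideals" unfolding X_def by (rule Union_quotient[OF equiv_ideal_class_rel])
  have Xd: "pairwise disjnt X"
  proof (rule pairwiseI)
    fix C D assume CD: "C \<in> X" "D \<in> X" "C \<noteq> D"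
    from quotient_disj[OF equiv_ideal_class_rel CD(1,2)[unfolded X_def]] CD(3)
    show "disjnt C D" by (simp add: disjnt_def)
  qed
  have part: "(w \<epsilon> has_sum (\<Sum>C\<in>F. s C \<epsilon>)) (\<Union>F)" if "finite F" "F \<subseteq> X" "\<epsilon> > 0" for F \<epsilon>
    using that s Xd by (intro has_sum_disjoint_Union) (auto intro: pairwise_subset)
  have tot: "(w \<epsilon> has_sum ideal_series \<epsilon>) ideals" if "\<epsilon> > 0" for \<epsilon>
    unfolding w_def by (rule sum_over_ideals[OF that])
  have Flim: "((\<lambda>\<epsilon>. (\<Sum>C\<in>F. s C \<epsilon>) - (real (card F) * pi / sqrt (real k)) / \<epsilon>) \<longlongrightarrow> - real (card F) / 2) (at_right 0)"
    if F: "finite F" "F \<subseteq> X" for F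
  proof -
    have "((\<lambda>\<epsilon>. \<Sum>C\<in>F. s C \<epsilon> - (pi / sqrt (real k)) / \<epsilon>) \<longlongrightarrow> (\<Sum>C\<in>F. - 1 / 2)) (at_right 0)"
      using F by (intro tendsto_sum slim) auto
    then show ?thesis by (simp add: sum_subtractf algebra_simps)
  qed
  have Hlim: "((\<lambda>\<epsilon>. ideal_series \<epsilon> - L / \<epsilon>) \<longlongrightarrow> - cot_sum / (4 * g)) (at_right 0)"
    unfolding L_def by (rule ideal_series_asymptotics)
  have scaled: "((\<lambda>\<epsilon>. \<epsilon> * f \<epsilon>) \<longlongrightarrow> A) (at_right 0)"
    if "((\<lambda>\<epsilon>. f \<epsilon> - A / \<epsilon>) \<longlongrightarrow> B) (at_right 0)" for f :: "real \<Rightarrow> real" and A B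
  proof -
    have "((\<lambda>\<epsilon>. \<epsilon> * (f \<epsilon> - A / \<epsilon>) + A) \<longlongrightarrow> 0 * B + A) (at_right 0)"
      by (intro tendsto_intros that)
    moreover have "\<forall>\<^sub>F \<epsilon> in at_right 0. \<epsilon> * (f \<epsilon> - A / \<epsilon>) + A = \<epsilon> * f \<epsilon>"
      by (rule eventually_mono[OF eventually_at_right_less]) (simp add: right_diff_distrib)
    ultimately show ?thesis using Lim_transform_eventually by fastforce
  qed
  have bound: "real (card F) * pi / sqrt (real k) \<le> L" if F: "finite F" "F \<subseteq> X" for F
  proof (rule tendsto_le[OF _ scaled[OF Hlim] scaled[OF Flim[OF F]]])
    show "\<forall>\<^sub>F \<epsilon> in at_right 0. \<epsilon> * (\<Sum>C\<in>F. s C \<epsilon>) \<le> \<epsilon> * ideal_series \<epsilon>"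
    proof (rule eventually_mono[OF eventually_at_right_less])
      fix \<epsilon> :: real assume e: "0 < \<epsilon>"
      have "(\<Sum>C\<in>F. s C \<epsilon>) \<le> ideal_series \<epsilon>"
        by (rule has_sum_mono2[OF part[OF F e] tot[OF e]]) (use F Xu in \<open>auto simp: w_def\<close>)
      then show "\<epsilon> * (\<Sum>C\<in>F. s C \<epsilon>) \<le> \<epsilon> * ideal_series \<epsilon>" using e by simp
    qed
  qed (simp add: trivial_limit_at_right_real)
  \<comment> \<open>As \<open>card\<close> of an infinite set is 0, the positivity of h(-k) rests on
    this and on the class of the unit ideal.\<close>
  have fin: "finite X"
  proof (rule ccontr)
    assume "infinite X"
    define n where "n = nat \<lceil>L * sqrt (real k) / pi\<rceil> + 1"
    obtain F where F: "F \<subseteq> X" "finite F" "card F = n" using infinite_arbitrarily_large[OF \<open>infinite X\<close>] by blast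
    from bound[OF F(2,1)] have "real n \<le> L * sqrt (real k) / pi" using F(3) k_pos by (simp add: field_simps)
    then show False unfolding n_def by linarith
  qed
  have h: "h_neg k = card X" unfolding h_neg_def class_number_def X_def ..
  have "1 \<in> OK" using OK_of_int[of 1] by simp
  then have "OK \<in> ideals" using OK_add OK_mult OK_of_int[of 0] by (intro idealsI[of _ 1]) auto
  then have "X \<noteq> {}" using Xu by blast
  then show "h_neg k > 0" using fin h by (simp add: card_gt_0_iff)
  have "((\<lambda>\<epsilon>. ideal_series \<epsilon> - (real (card X) * pi / sqrt (real k)) / \<epsilon>) \<longlongrightarrow> - real (card X) / 2) (at_right 0)"
  proof (rule Lim_transform_eventually[OF Flim[OF fin subset_refl]])
    show "\<forall>\<^sub>F \<epsilon> in at_right 0. (\<Sum>C\<in>X. s C \<epsilon>) - (real (card X) * pi / sqrt (real k)) / \<epsilon>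
        = ideal_series \<epsilon> - (real (card X) * pi / sqrt (real k)) / \<epsilon>"
    proof (rule eventually_mono[OF eventually_at_right_less])
      fix \<epsilon> :: real assume e: "0 < \<epsilon>"
      have "(\<Sum>C\<in>X. s C \<epsilon>) = ideal_series \<epsilon>"
        using has_sum_unique[OF part[OF fin subset_refl e]] tot[OF e] unfolding Xu by blast
      then show "(\<Sum>C\<in>X. s C \<epsilon>) - (real (card X) * pi / sqrt (real k)) / \<epsilon>
        = ideal_series \<epsilon> - (real (card X) * pi / sqrt (real k)) / \<epsilon>" by simp
    qed
  qed
  from tendsto_diff[OF this Hlim]
  have "((\<lambda>\<epsilon>. (L - real (card X) * pi / sqrt (real k)) / \<epsilon>) \<longlongrightarrow> - real (card X) / 2 - (- cot_sum / (4 * g))) (at_right 0)"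
    by (simp add: diff_divide_distrib)
  from tendsto_div_right_0_imp[OF this]
  show "real (h_neg k) * pi / sqrt (real k) = - pi * first_moment / (real k * g)" "real (h_neg k) = cot_sum / (2 * g)"
    using g_ne_0 unfolding h L_def by (auto simp: field_simps)
qed

text \<open>Both formulas for \<open>h(-k)\<close> reduce to the first moment, with factors differing by \<open>g / \<surd>k\<close>.\<close>

theorem gauss_sum_sign: "g = sqrt (real k)"
proof -
  define s where "s = sqrt (real k)"
  have s: "s > 0" "real k = s * s" using k_pos by (simp_all add: s_def)
  define h where "h = real (h_neg k)"
  have h: "h > 0" using class_number_formula(1) by (simp add: h_def)
  have "pi * (h / s) = pi * (- first_moment / (real k * g))"
    using class_number_formula(2) by (simp add: s_def h_def mult.commute)
  then have "h / s = - first_moment / (real k * g)" using pi_neq_zero by (metis mult_left_cancel)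
  then have h1: "h * g * s = - first_moment" using s g_ne_0 by (simp add: field_simps)
  have "cot_sum = 2 * g * h" using class_number_formula(3) g_ne_0 by (simp add: h_def)
  then have "(2 * g) * (s * s * h) = (2 * g) * (- first_moment)"
    using cot_sum_first_moment unfolding s(2) by (simp add: mult_ac)
  then have "s * s * h = - first_moment" using g_ne_0 by (metis mult_left_cancel mult_eq_0_iff zero_neq_numeral)
  then have "(h * s) * g = (h * s) * s" using h1 by (simp add: mult_ac)
  then have "g = s" using h s(1) by simp
  then show ?thesis by (simp add: s_def)
qed

section \<open>Evaluation of the sine-tangent sum\<close>

lemma cot_sum_eq: "cot_sum = 2 * sqrt (real k) * real (h_neg k)"
  using class_number_formula(3) g_ne_0 by (simp flip: gauss_sum_sign)

lemma sin_tan_sum: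
  "(\<Sum>n\<in>{0..<int k}. of_int (c n) * ((sin (pi * of_int n / real k))\<^sup>2 * tan (pi * of_int n / real k)))
    = sqrt (real k) * (- 1 / 2 + (2 - 4 * of_int (c 2)) * real (h_neg k))"
proof -
  have "(sin x)\<^sup>2 * tan x = tan x - sin (2 * x) / 2" if "cos x \<noteq> 0" for x :: real
  proof -
    have "sin (2 * x) / 2 = sin x * cos x" by (simp add: sin_double)
    moreover have "(sin x)\<^sup>2 * tan x = tan x - sin x * cos x"
      unfolding sin_squared_eq tan_def using that by (simp add: field_simps power2_eq_square)
    ultimately show ?thesis by simp
  qed
  \<comment> \<open>A zero of the cosine would make 2 n an odd multiple of the odd number k.\<close>
  moreover have "cos (pi * of_int n / real k) \<noteq> 0" for n
  proof
    assume "cos (pi * of_int n / real k) = 0"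
    then obtain i where i: "odd i" "pi * of_int n / real k = of_int i * (pi / 2)" using cos_zero_iff_int by blast
    then have "real_of_int (2 * n) = of_int (i * int k)" using k_pos by (simp add: field_simps)
    then have "2 * n = i * int k" by (simp only: of_int_eq_iff)
    then have "even (i * int k)" by (metis dvd_triv_left)
    then show False using i(1) k_odd by simp
  qed
  ultimately have "(\<Sum>n\<in>{0..<int k}. of_int (c n) * ((sin (pi * of_int n / real k))\<^sup>2 * tan (pi * of_int n / real k)))
     = (\<Sum>n\<in>{0..<int k}. of_int (c n) * tan (pi * of_int n / real k) - of_int (c n) * sin (2 * pi * of_int (1 * n) / real k) / 2)"
    by (intro sum.cong refl) (simp add: right_diff_distrib mult_ac)
  also have "\<dots> = (1 - 2 * of_int (c 2)) * cot_sum - g / 2"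
    unfolding sum_subtractf sum_divide_distrib[symmetric] tan_sum sine_sum c_1 by simp
  finally show ?thesis unfolding cot_sum_eq gauss_sum_sign by (simp add: algebra_simps)
qed

end

theorem theorem4p12:
  fixes k :: nat and \<chi> :: "int \<Rightarrow> complex"
  assumes "k \<ge> 7" and "odd k"
    and "dirichlet_character k \<chi>"
    and "\<not> principal_character k \<chi>"
    and "real_character \<chi>"
    and "primitive_character k \<chi>"
    and "odd_character \<chi>"
  shows "(\<Sum>j = 1..k - 1. \<chi> (int j) *
            complex_of_real ((sin (pi * real j / real k))\<^sup>2 * tan (pi * real j / real k)))
           = complex_of_real (sqrt (real k)) * (- 1 / 2 + (2 - 4 * \<chi> 2) * of_nat (h_neg k))
       \<and> (k mod 8 = 3 \<or> k mod 8 = 7)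
       \<and> (k mod 8 = 3 \<longrightarrow>
            complex_of_real (sqrt (real k)) * (- 1 / 2 + (2 - 4 * \<chi> 2) * of_nat (h_neg k))
              = complex_of_real (sqrt (real k) * (- 1 / 2 + 6 * real (h_neg k))))
       \<and> (k mod 8 = 7 \<longrightarrow>
            complex_of_real (sqrt (real k)) * (- 1 / 2 + (2 - 4 * \<chi> 2) * of_nat (h_neg k))
              = complex_of_real (sqrt (real k) * (- 1 / 2 - 2 * real (h_neg k))))"
proof -
  obtain c where c: "odd_real_primitive_character k c" "\<chi> = (\<lambda>n. of_int (c n))"
    using real_primitive_character_int[OF assms(1,2,3,5,6,7)] by blast
  interpret odd_real_primitive_character k c by (rule c(1))
  define F where "F n = real_of_int (c n) * ((sin (pi * of_int n / real k))\<^sup>2 * tan (pi * of_int n / real k))" for n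
  have "(\<Sum>j = 1..k - 1. \<chi> (int j) *
            complex_of_real ((sin (pi * real j / real k))\<^sup>2 * tan (pi * real j / real k)))
      = complex_of_real (\<Sum>j = 1..k - 1. F (int j))"
    by (simp add: F_def c(2))
  also have "(\<Sum>j = 1..k - 1. F (int j)) = (\<Sum>n\<in>{0..<int k}. F n)"
  proof -
    have "(\<Sum>n\<in>{0..<int k}. F n) = (\<Sum>n\<in>{1..<int k}. F n)"
    proof -
      have "{0..<int k} = insert 0 {1..<int k}" using k_pos by auto
      then show ?thesis by (simp add: F_def)
    qed
    also have "\<dots> = (\<Sum>j = 1..k - 1. F (int j))"
      by (rule sum.reindex_bij_witness[of _ int nat]) (use k_pos in auto)
    finally show ?thesis ..
  qed
  also have "\<dots> = sqrt (real k) * (- 1 / 2 + (2 - 4 * of_int (c 2)) * real (h_neg k))"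
    unfolding F_def by (rule sin_tan_sum)
  finally show ?thesis
    using k_mod_8 c_2 by (auto simp: c(2))
qed

end
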